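(* Let $\lambda>1$ and let $A_\lambda$ be the lower bounded selfadjoint operator on $L^2([\lambda^{-1},\lambda],d^*u)$ associated with the closed, densely defined, lower bounded quadratic form $QW_\lambda$, so that $QW_\lambda(f,f)=\langle A_\lambda f\mid f\rangle$. Then $A_\lambda$ has purely discrete spectrum, bounded below.
   Context: $d^*u=du/u$. For $f\in L^2([\lambda^{-1},\lambda],d^*u)$ extended by $0$ to $\mathbb{R}_+^*$, $\widehat f(s)=\int f(u)u^{-is}d^*u$ (entire in $s$). Let $\theta(t)=-\frac t2\log\pi+\Im\log\Gamma(\frac14+\frac{it}{2})$ (branch of $\log\Gamma$ real on the positive real axis). The semilocal Weil quadratic form is $QW_\lambda(f,f)=\int_\mathbb{R}|\widehat f(t)|^2\frac{2\partial_t\theta(t)}{2\pi}dt+2\Re\big(\widehat f(\tfrac i2)\overline{\widehat f(-\tfrac i2)}\big)-\sum_{1<n\le\lambda^2}\Lambda(n)\langle f\mid T(n)f\rangle$, with value in $(-\infty,+\infty]$, where $\Lambda$ is the von Mangoldt function and $\langle f\mid T(n)g\rangle=n^{-1/2}\big((f^**g)(n)+(f^**g)(n^{-1})\big)$, with $(f*g)(y)=\int f(x)g(y/x)d^*x$, $f^*(u)=\overline{f(u^{-1})}$. It is known (and assumed here) that $QW_\lambda$ is lower bounded and lower semicontinuous on $L^2([\lambda^{-1},\lambda],d^*u)$, hence a closed, densely defined, lower semibounded form, so $A_\lambda$ exists by the representation theorem for semibounded forms. *)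

theory Defs
  imports "HOL-Analysis.Analysis" "HOL-Number_Theory.Prime_Powers"
begin

section \<open>Square-integrable functions\<close>

text \<open>
  Vectors of \<open>L\<^sup>2(M)\<close> are represented by square-integrable functions; equality of vectors is equality
  almost everywhere. The inner product is antilinear in its first argument.
\<close>

definition L2_space :: "'a measure \<Rightarrow> ('a \<Rightarrow> complex) set" where
  "L2_space M = {f \<in> borel_measurable M. integrable M (\<lambda>x. (cmod (f x))\<^sup>2)}"

definition L2_inner :: "'a measure \<Rightarrow> ('a \<Rightarrow> complex) \<Rightarrow> ('a \<Rightarrow> complex) \<Rightarrow> complex" where
  "L2_inner M f g = (LINT x|M. cnj (f x) * g x)"

definition L2_norm :: "'a measure \<Rightarrow> ('a \<Rightarrow> complex) \<Rightarrow> real" where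
  "L2_norm M f = sqrt (LINT x|M. (cmod (f x))\<^sup>2)"

definition L2_eq :: "'a measure \<Rightarrow> ('a \<Rightarrow> complex) \<Rightarrow> ('a \<Rightarrow> complex) \<Rightarrow> bool" where
  "L2_eq M f g \<longleftrightarrow> (AE x in M. f x = g x)"


section \<open>Quadratic forms with values in \<open>(-\<infinity>, \<infinity>]\<close> and their operators\<close>

definition form_domain :: "'a measure \<Rightarrow> (('a \<Rightarrow> complex) \<Rightarrow> ereal) \<Rightarrow> ('a \<Rightarrow> complex) set" where
  "form_domain M q = {f \<in> L2_space M. q f < \<infinity>}"

definition form_lower_bounded :: "'a measure \<Rightarrow> (('a \<Rightarrow> complex) \<Rightarrow> ereal) \<Rightarrow> bool" where
  "form_lower_bounded M q \<longleftrightarrow> (\<exists>c::real. \<forall>f\<in>L2_space M. ereal (c * (L2_norm M f)\<^sup>2) \<le> q f)"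

definition form_lsc :: "'a measure \<Rightarrow> (('a \<Rightarrow> complex) \<Rightarrow> ereal) \<Rightarrow> bool" where
  "form_lsc M q \<longleftrightarrow>
     (\<forall>f\<in>L2_space M. \<forall>a. a < q f \<longrightarrow>
        (\<exists>e>0. \<forall>g\<in>L2_space M. L2_norm M (\<lambda>x. g x - f x) < e \<longrightarrow> a < q g))"

text \<open>
  The sesquilinear form, antilinear in its first argument, obtained from \<open>q\<close> by polarization;
  it is only meaningful on \<open>form_domain M q\<close>.
\<close>

definition polar_form ::
    "(('a \<Rightarrow> complex) \<Rightarrow> ereal) \<Rightarrow> ('a \<Rightarrow> complex) \<Rightarrow> ('a \<Rightarrow> complex) \<Rightarrow> complex" where
  "polar_form q f g =
     (\<Sum>k<4. (- \<i>) ^ k * complex_of_real (real_of_ereal (q (\<lambda>x. f x + \<i> ^ k * g x)))) / 4"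

text \<open>
  An unbounded operator on \<open>L\<^sup>2(M)\<close> is given by its graph. The operator \<open>A\<close> associated with \<open>q\<close> by the
  representation theorem has as domain those \<open>f\<close> in the form domain for which some \<open>g\<close> in
  \<open>L\<^sup>2(M)\<close> satisfies \<open>q(f,h) = \<langle>g | h\<rangle>\<close> for all \<open>h\<close> in the form domain, and \<open>A f = g\<close>.
\<close>

type_synonym 'a L2_operator = "(('a \<Rightarrow> complex) \<times> ('a \<Rightarrow> complex)) set"

definition form_operator :: "'a measure \<Rightarrow> (('a \<Rightarrow> complex) \<Rightarrow> ereal) \<Rightarrow> 'a L2_operator" where
  "form_operator M q =
     {(f, g). f \<in> form_domain M q \<and> g \<in> L2_space M \<and>
              (\<forall>h\<in>form_domain M q. polar_form q f h = L2_inner M g h)}"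


section \<open>Spectrum of an unbounded operator\<close>

text \<open>
  \<open>z\<close> is in the resolvent set if \<open>A - z\<close> maps the domain of \<open>A\<close> onto \<open>L\<^sup>2(M)\<close> and has a bounded
  inverse; injectivity is part of the norm estimate.
\<close>

definition resolvent_set :: "'a measure \<Rightarrow> 'a L2_operator \<Rightarrow> complex set" where
  "resolvent_set M A =
     {z. (\<forall>g\<in>L2_space M. \<exists>(f, h)\<in>A. L2_eq M (\<lambda>x. h x - z * f x) g) \<and>
         (\<exists>C. \<forall>(f, h)\<in>A. L2_norm M f \<le> C * L2_norm M (\<lambda>x. h x - z * f x))}"

definition op_spectrum :: "'a measure \<Rightarrow> 'a L2_operator \<Rightarrow> complex set" where
  "op_spectrum M A = - resolvent_set M A"

definition eigenspace :: "'a measure \<Rightarrow> 'a L2_operator \<Rightarrow> complex \<Rightarrow> ('a \<Rightarrow> complex) set" where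
  "eigenspace M A z = {f. \<exists>g. (f, g) \<in> A \<and> L2_eq M g (\<lambda>x. z * f x)}"

definition is_eigenvalue :: "'a measure \<Rightarrow> 'a L2_operator \<Rightarrow> complex \<Rightarrow> bool" where
  "is_eigenvalue M A z \<longleftrightarrow> (\<exists>f\<in>eigenspace M A z. \<not> L2_eq M f (\<lambda>_. 0))"

definition L2_finite_dim :: "'a measure \<Rightarrow> ('a \<Rightarrow> complex) set \<Rightarrow> bool" where
  "L2_finite_dim M E \<longleftrightarrow>
     (\<exists>B. finite B \<and> B \<subseteq> L2_space M \<and> (\<forall>f\<in>E. \<exists>c. L2_eq M f (\<lambda>x. \<Sum>b\<in>B. c b * b x)))"

definition purely_discrete_spectrum :: "'a measure \<Rightarrow> 'a L2_operator \<Rightarrow> bool" where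
  "purely_discrete_spectrum M A \<longleftrightarrow>
     (\<forall>z\<in>op_spectrum M A.
        \<not> z islimpt op_spectrum M A \<and> is_eigenvalue M A z \<and> L2_finite_dim M (eigenspace M A z))"

definition spectrum_bounded_below :: "'a measure \<Rightarrow> 'a L2_operator \<Rightarrow> bool" where
  "spectrum_bounded_below M A \<longleftrightarrow> (\<exists>c::real. op_spectrum M A \<subseteq> complex_of_real ` {c..})"


section \<open>The semilocal Weil quadratic form\<close>

text \<open>The measure \<open>d\<^sup>*u = du/u\<close>; it gives no mass to \<open>u \<le> 0\<close>.\<close>

definition dstar :: "real measure" where
  "dstar = density lborel (\<lambda>u. indicator {0<..} u * ennreal (1 / u))"

definition dstar_on :: "real \<Rightarrow> real measure" where
  "dstar_on lam = restrict_space dstar {1 / lam..lam}"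

definition extend_zero :: "real \<Rightarrow> (real \<Rightarrow> complex) \<Rightarrow> real \<Rightarrow> complex" where
  "extend_zero lam f u = (if u \<in> {1 / lam..lam} then f u else 0)"

definition mult_fourier :: "(real \<Rightarrow> complex) \<Rightarrow> complex \<Rightarrow> complex" where
  "mult_fourier f s = (LINT u|dstar. f u * complex_of_real u powr (- \<i> * s))"

definition mult_conv :: "(real \<Rightarrow> complex) \<Rightarrow> (real \<Rightarrow> complex) \<Rightarrow> real \<Rightarrow> complex" where
  "mult_conv f g y = (LINT x|dstar. f x * g (y / x))"

definition mult_star :: "(real \<Rightarrow> complex) \<Rightarrow> real \<Rightarrow> complex" where
  "mult_star f u = cnj (f (1 / u))"

text \<open>On \<open>Re z > 0\<close>, \<open>ln_Gamma\<close> is the branch of \<open>log \<Gamma>\<close> that is real on the positive real axis.\<close>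

definition theta :: "real \<Rightarrow> real" where
  "theta t = - (t / 2) * ln pi + Im (ln_Gamma (1 / 4 + \<i> * complex_of_real t / 2))"

text \<open>\<open>\<langle>f | T(n) g\<rangle>\<close>\<close>

definition T_form :: "nat \<Rightarrow> (real \<Rightarrow> complex) \<Rightarrow> (real \<Rightarrow> complex) \<Rightarrow> complex" where
  "T_form n f g =
     complex_of_real (real n powr (- 1 / 2)) *
       (mult_conv (mult_star f) g (real n) + mult_conv (mult_star f) g (1 / real n))"

text \<open>
  The integrand of the archimedean term is negative only for \<open>t\<close> in a bounded set, so its negative
  part has a finite integral and the term is well defined in \<open>(-\<infinity>, \<infinity>]\<close>.
\<close>

definition arch_density :: "(real \<Rightarrow> complex) \<Rightarrow> real \<Rightarrow> real" where
  "arch_density f t = (cmod (mult_fourier f (complex_of_real t)))\<^sup>2 * (2 * deriv theta t / (2 * pi))"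

definition arch_term :: "(real \<Rightarrow> complex) \<Rightarrow> ereal" where
  "arch_term f =
     enn2ereal (\<integral>\<^sup>+ t. ennreal (arch_density f t) \<partial>lborel) -
     enn2ereal (\<integral>\<^sup>+ t. ennreal (- arch_density f t) \<partial>lborel)"

text \<open>
  \<open>\<langle>f | T(n) f\<rangle>\<close> is real because \<open>(f\<^sup>* * f)(1/y)\<close> is the complex conjugate of \<open>(f\<^sup>* * f)(y)\<close>,
  so \<open>Re\<close> in the sum over \<open>n\<close> is only a type conversion.
\<close>

definition QW :: "real \<Rightarrow> (real \<Rightarrow> complex) \<Rightarrow> ereal" where
  "QW lam f =
     (let F = extend_zero lam f in
        arch_term F +
        ereal (2 * Re (mult_fourier F (\<i> / 2) * cnj (mult_fourier F (- \<i> / 2))) -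
               (\<Sum>n | 1 < n \<and> real n \<le> lam\<^sup>2. mangoldt n * Re (T_form n F F))))"

definition Weil_operator :: "real \<Rightarrow> real L2_operator" where
  "Weil_operator lam = form_operator (dstar_on lam) (QW lam)"

end

theory Submission
  imports Defs "HOL-Probability.Probability" "HOL-Complex_Analysis.Great_Picard"
begin

text \<open>
  In the coordinate \<open>x = log u\<close> the space becomes \<open>L\<^sup>2([-log \<lambda>, log \<lambda>])\<close> and the archimedean term becomes
  the integral of \<open>\<bar>f^(t)\<bar>\<^sup>2 w(t)\<close> with \<open>w = \<theta>'/\<pi>\<close>; the other two terms are bounded forms. Since
  \<open>w(t) \<rightarrow> \<infinity>\<close>, a bound on the form makes the tails of \<open>f^\<close> uniformly small in \<open>L\<^sup>2\<close>, while on bounded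
  sets the transforms of functions with common bounded support are uniformly bounded and Lipschitz. With
  the Plancherel inequality, every form-bounded sequence therefore has an \<open>L\<^sup>2\<close>-Cauchy subsequence.

  For a lower bounded, lower semicontinuous form with this compactness property, \<open>A - z\<close> is bounded
  below and has closed range as soon as \<open>z\<close> is not an eigenvalue, a vector orthogonal to the range is
  an eigenvector for the conjugate of \<open>z\<close>, and an orthonormal sequence of eigenvectors cannot have
  bounded eigenvalues. Vectors are functions and norms are seminorms throughout, so no quotient by
  null functions is formed.
\<close>

section \<open>Semi-inner products on spaces of functions\<close>

text \<open>The weight \<open>w\<close> grows only like log |t|, so a bound on the form yields no
  Sobolev regularity of positive order; the usable fact is just that high frequencies carry little
  mass. At low frequencies the common support makes the transforms equicontinuous, and compactness
  comes from there.

  Plancherel is needed in one direction only, for transforms already known to be square integrable: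
  the norm is bounded by the transform. Averaging against a Gaussian and letting it spread out gives
  exactly this, without an inversion formula.

  The spectral part does not pass through the resolvent as a compact operator. One real point below
  the lower bound is solved by Riesz representation in the form norm, whose completeness is what
  lower semicontinuity supplies. This single solvable point does the work of selfadjointness: it
  shows that a vector orthogonal to the range of \<open>A - z\<close> agrees almost everywhere with
  an element of the domain. Eigenvalues are real, so if \<open>z\<close> is not an eigenvalue then
  neither is its conjugate, and real and nonreal \<open>z\<close> are treated alike.\<close>

lemma cnj_mult_self: "cnj c * c = complex_of_real ((cmod c)\<^sup>2)"
  by (metis complex_norm_square mult.commute)

text \<open>Positivity is split off because two instances, the form \<open>S\<close> and the bounded
  part of the Weil form, may take negative values. Closure under \<open>f + c * g\<close> together
  with the zero function gives all linear operations; linearity on the right and hermitian symmetry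
  give antilinearity on the left.\<close>

locale sesquilinear =
  fixes V :: "('a \<Rightarrow> complex) set" and B :: "('a \<Rightarrow> complex) \<Rightarrow> ('a \<Rightarrow> complex) \<Rightarrow> complex"
  assumes zero_mem: "(\<lambda>_. 0) \<in> V"
    and lin_mem: "\<And>f g c. f \<in> V \<Longrightarrow> g \<in> V \<Longrightarrow> (\<lambda>x. f x + c * g x) \<in> V"
    and lin_right: "\<And>f g h c. f \<in> V \<Longrightarrow> g \<in> V \<Longrightarrow> h \<in> V \<Longrightarrow> B f (\<lambda>x. g x + c * h x) = B f g + c * B f h"
    and hermitian: "\<And>f g. f \<in> V \<Longrightarrow> g \<in> V \<Longrightarrow> B g f = cnj (B f g)"
begin

lemma scale_mem: "f \<in> V \<Longrightarrow> (\<lambda>x. c * f x) \<in> V"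
  using lin_mem[OF zero_mem, of f c] by simp

lemma add_mem: "f \<in> V \<Longrightarrow> g \<in> V \<Longrightarrow> (\<lambda>x. f x + g x) \<in> V"
  using lin_mem[of f g 1] by simp

lemma diff_mem: "f \<in> V \<Longrightarrow> g \<in> V \<Longrightarrow> (\<lambda>x. f x - g x) \<in> V"
  using lin_mem[of f g "-1"] by simp

lemma sum_mem: "(\<And>i. i \<in> I \<Longrightarrow> F i \<in> V) \<Longrightarrow> (\<lambda>x. \<Sum>i\<in>I. c i * F i x) \<in> V"
proof (induction I rule: infinite_finite_induct)
  case (insert i I)
  then show ?case using lin_mem[of "\<lambda>x. \<Sum>i\<in>I. c i * F i x" "F i" "c i"] by (simp add: add.commute)
qed (auto simp: zero_mem)

lemma add_right: "f \<in> V \<Longrightarrow> g \<in> V \<Longrightarrow> h \<in> V \<Longrightarrow> B f (\<lambda>x. g x + h x) = B f g + B f h"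
  using lin_right[of f g h 1] by simp

lemma diff_right: "f \<in> V \<Longrightarrow> g \<in> V \<Longrightarrow> h \<in> V \<Longrightarrow> B f (\<lambda>x. g x - h x) = B f g - B f h"
  using lin_right[of f g h "-1"] by simp

lemma zero_right: "f \<in> V \<Longrightarrow> B f (\<lambda>_. 0) = 0"
  using diff_right[of f f f] by simp

lemma scale_right: "f \<in> V \<Longrightarrow> g \<in> V \<Longrightarrow> B f (\<lambda>x. c * g x) = c * B f g"
  using lin_right[of f "\<lambda>_. 0" g c] zero_mem zero_right by simp

lemma lin_left:
  "f \<in> V \<Longrightarrow> g \<in> V \<Longrightarrow> h \<in> V \<Longrightarrow> B (\<lambda>x. f x + c * g x) h = B f h + cnj c * B g h"
  using hermitian[of h "\<lambda>x. f x + c * g x"] hermitian[of h f] hermitian[of h g]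
  by (simp add: lin_mem lin_right)

lemma diff_left: "f \<in> V \<Longrightarrow> g \<in> V \<Longrightarrow> h \<in> V \<Longrightarrow> B (\<lambda>x. f x - g x) h = B f h - B g h"
  using lin_left[of f g h "-1"] by simp

lemma scale_left: "f \<in> V \<Longrightarrow> g \<in> V \<Longrightarrow> B (\<lambda>x. c * f x) g = cnj c * B f g"
  using hermitian[of g "\<lambda>x. c * f x"] hermitian[of g f] by (simp add: scale_mem scale_right)

lemma sum_right:
  "f \<in> V \<Longrightarrow> (\<And>i. i \<in> I \<Longrightarrow> F i \<in> V) \<Longrightarrow> B f (\<lambda>x. \<Sum>i\<in>I. c i * F i x) = (\<Sum>i\<in>I. c i * B f (F i))"
proof (induction I rule: infinite_finite_induct)
  case (insert i I)
  then show ?case using lin_right[of f "\<lambda>x. \<Sum>i\<in>I. c i * F i x" "F i" "c i"]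
    by (simp add: add.commute sum_mem)
qed (auto simp: zero_right)

lemma Im_diag: "f \<in> V \<Longrightarrow> Im (B f f) = 0"
  using hermitian[of f f] by (metis cnj.simps(2) equal_neg_zero)

definition sq :: "('a \<Rightarrow> complex) \<Rightarrow> real" where "sq f = Re (B f f)"

lemma sq_lin:
  assumes "f \<in> V" "g \<in> V"
  shows "sq (\<lambda>x. f x + c * g x) = sq f + 2 * Re (c * B f g) + (cmod c)\<^sup>2 * sq g"
proof -
  have "B (\<lambda>x. f x + c * g x) (\<lambda>x. f x + c * g x)
      = B f f + c * B f g + cnj c * cnj (B f g) + (cnj c * c) * B g g"
    using assms by (simp add: lin_left lin_right lin_mem hermitian[of f g] algebra_simps)
  then have "sq (\<lambda>x. f x + c * g x) = sq f + 2 * Re (c * B f g) + Re ((cnj c * c) * B g g)"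
    by (simp add: sq_def)
  moreover have "cnj c * c = complex_of_real ((cmod c)\<^sup>2)"
    by (rule cnj_mult_self)
  ultimately show ?thesis by (simp add: sq_def)
qed

lemma sq_scale: "f \<in> V \<Longrightarrow> sq (\<lambda>x. c * f x) = (cmod c)\<^sup>2 * sq f"
  using sq_lin[OF zero_mem, of f c] zero_right[OF zero_mem] hermitian[OF zero_mem, of f] zero_right[of f]
  by (simp add: sq_def)

lemma sq_minus_commute: "f \<in> V \<Longrightarrow> g \<in> V \<Longrightarrow> sq (\<lambda>x. f x - g x) = sq (\<lambda>x. g x - f x)"
  using sq_scale[OF diff_mem, of f g "-1"] by simp

end

section \<open>The seminorm of a positive semidefinite form\<close>

locale semi_inner = sesquilinear +
  assumes nonneg: "\<And>f. f \<in> V \<Longrightarrow> 0 \<le> Re (B f f)"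
begin

definition nrm :: "('a \<Rightarrow> complex) \<Rightarrow> real" where "nrm f = sqrt (sq f)"

lemma sq_nonneg: "f \<in> V \<Longrightarrow> 0 \<le> sq f"
  using nonneg by (simp add: sq_def)

lemma nrm_nonneg: "f \<in> V \<Longrightarrow> 0 \<le> nrm f"
  by (simp add: nrm_def sq_nonneg)

lemma nrm_power2: "f \<in> V \<Longrightarrow> (nrm f)\<^sup>2 = sq f"
  by (simp add: nrm_def sq_nonneg)

lemma nrm_scale: "f \<in> V \<Longrightarrow> nrm (\<lambda>x. c * f x) = cmod c * nrm f"
  by (simp add: nrm_def sq_scale real_sqrt_mult)

lemma nrm_minus_commute: "f \<in> V \<Longrightarrow> g \<in> V \<Longrightarrow> nrm (\<lambda>x. f x - g x) = nrm (\<lambda>x. g x - f x)"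
  by (simp add: nrm_def sq_minus_commute[of f g])

text \<open>\<open>sq\<close> of \<open>f\<close> plus a multiple of \<open>g\<close> is a quadratic
  in a real parameter \<open>s\<close> that is never negative. The factor \<open>cnj (B f g)\<close>
  makes the cross term real, so real \<open>s\<close> suffices. A null vector \<open>g\<close> has
  to be treated apart, since \<open>B\<close> is only semidefinite.\<close>

lemma Cauchy_Schwarz:
  assumes f: "f \<in> V" and g: "g \<in> V"
  shows "cmod (B f g) \<le> nrm f * nrm g"
proof -
  define b where "b = cmod (B f g)"
  have key: "0 \<le> sq f - 2 * s * b\<^sup>2 + s\<^sup>2 * b\<^sup>2 * sq g" for s :: real
  proof -
    let ?c = "- complex_of_real s * cnj (B f g)"
    have "0 \<le> sq (\<lambda>x. f x + ?c * g x)"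
      using f g by (intro sq_nonneg lin_mem)
    also have "\<dots> = sq f + 2 * Re (?c * B f g) + (cmod ?c)\<^sup>2 * sq g"
      using f g by (rule sq_lin)
    also have "?c * B f g = - complex_of_real (s * b\<^sup>2)"
      using cnj_mult_self[of "B f g"] by (simp add: b_def mult.assoc)
    also have "(cmod ?c)\<^sup>2 = s\<^sup>2 * b\<^sup>2"
      by (simp add: b_def norm_mult power_mult_distrib)
    finally show ?thesis by simp
  qed
  have "b\<^sup>2 \<le> sq f * sq g"
  proof (cases "sq g = 0")
    case True
    \<comment> \<open>For null \<open>g\<close> the expression in \<open>key\<close> is affine in
      \<open>s\<close> with slope \<open>- 2 * b\<^sup>2\<close>; a large \<open>s\<close> makes it
      negative unless \<open>b\<close> vanishes.\<close>
    have "b = 0"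
    proof (rule ccontr)
      assume "b \<noteq> 0"
      then have "0 < b\<^sup>2" by simp
      have "2 * ((sq f + 1) / b\<^sup>2) * b\<^sup>2 = 2 * (sq f + 1)" using \<open>0 < b\<^sup>2\<close> by simp
      then show False using key[of "(sq f + 1) / b\<^sup>2"] True sq_nonneg[OF f] by simp
    qed
    then show ?thesis using True by simp
  next
    case False
    then have pos: "0 < sq g" using sq_nonneg[OF g] by simp
    have "sq f - 2 * (1 / sq g) * b\<^sup>2 + (1 / sq g)\<^sup>2 * b\<^sup>2 * sq g = sq f - b\<^sup>2 / sq g"
      using pos by (simp add: field_simps power2_eq_square)
    then have "0 \<le> sq f - b\<^sup>2 / sq g" using key[of "1 / sq g"] by simp
    then show ?thesis using pos by (simp add: field_simps)
  qed
  then have "sqrt (b\<^sup>2) \<le> sqrt (sq f * sq g)" by (rule real_sqrt_le_mono)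
  then show ?thesis by (simp add: b_def nrm_def real_sqrt_mult)
qed

lemma nrm_triangle:
  assumes f: "f \<in> V" and g: "g \<in> V"
  shows "nrm (\<lambda>x. f x + g x) \<le> nrm f + nrm g"
proof -
  have "sq (\<lambda>x. f x + g x) = sq f + 2 * Re (B f g) + sq g"
    using sq_lin[OF f g, of 1] by simp
  also have "\<dots> \<le> sq f + 2 * (nrm f * nrm g) + sq g"
    using Cauchy_Schwarz[OF f g] complex_Re_le_cmod[of "B f g"] by simp
  also have "\<dots> = (nrm f + nrm g)\<^sup>2"
    by (simp add: power2_sum nrm_power2 f g algebra_simps)
  finally have "(nrm (\<lambda>x. f x + g x))\<^sup>2 \<le> (nrm f + nrm g)\<^sup>2"
    by (simp add: nrm_power2 f g add_mem)
  then show ?thesis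
    by (rule power2_le_imp_le) (simp add: nrm_nonneg f g)
qed

lemma nrm_triangle_diff:
  assumes "f \<in> V" "g \<in> V" "h \<in> V"
  shows "nrm (\<lambda>x. f x - h x) \<le> nrm (\<lambda>x. f x - g x) + nrm (\<lambda>x. g x - h x)"
  using nrm_triangle[of "\<lambda>x. f x - g x" "\<lambda>x. g x - h x"] assms by (simp add: diff_mem)

lemma nrm_diff_le:
  assumes "f \<in> V" "g \<in> V"
  shows "nrm (\<lambda>x. f x - g x) \<le> nrm f + nrm g"
  using nrm_triangle_diff[of f "\<lambda>_. 0" g] nrm_minus_commute[OF zero_mem, of g] assms
  by (simp add: zero_mem)

lemma nrm_abs_diff:
  assumes "f \<in> V" "g \<in> V"
  shows "\<bar>nrm f - nrm g\<bar> \<le> nrm (\<lambda>x. f x - g x)"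
  using nrm_triangle_diff[of f g "\<lambda>_. 0"] nrm_triangle_diff[of g f "\<lambda>_. 0"]
    nrm_minus_commute[of f g] assms by (simp add: zero_mem abs_le_iff)

section \<open>Convergence, completeness and Riesz representation in a seminorm\<close>

definition converges :: "(nat \<Rightarrow> 'a \<Rightarrow> complex) \<Rightarrow> ('a \<Rightarrow> complex) \<Rightarrow> bool" where
  "converges F f \<longleftrightarrow> (\<lambda>n. nrm (\<lambda>x. F n x - f x)) \<longlonglongrightarrow> 0"

definition cauchy :: "(nat \<Rightarrow> 'a \<Rightarrow> complex) \<Rightarrow> bool" where
  "cauchy F \<longleftrightarrow> (\<forall>e>0. \<exists>N. \<forall>m\<ge>N. \<forall>n\<ge>N. nrm (\<lambda>x. F m x - F n x) < e)"

definition is_complete :: bool where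
  "is_complete \<longleftrightarrow> (\<forall>F. (\<forall>n. F n \<in> V) \<longrightarrow> cauchy F \<longrightarrow> (\<exists>f\<in>V. converges F f))"

lemma converges_nrm:
  assumes "\<And>n. F n \<in> V" "f \<in> V" "converges F f"
  shows "(\<lambda>n. nrm (F n)) \<longlonglongrightarrow> nrm f"
proof -
  have "(\<lambda>n. nrm (F n) - nrm f) \<longlonglongrightarrow> 0"
    using assms(3) unfolding converges_def
    by (rule Lim_null_comparison[rotated]) (use nrm_abs_diff assms in auto)
  then show ?thesis by (simp add: LIM_zero_iff)
qed

lemma converges_left:
  assumes "\<And>n. F n \<in> V" "f \<in> V" "converges F f" "h \<in> V"
  shows "(\<lambda>n. B (F n) h) \<longlonglongrightarrow> B f h"
proof -
  have "(\<lambda>n. B (F n) h - B f h) \<longlonglongrightarrow> 0"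
  proof (rule Lim_null_comparison)
    show "\<forall>\<^sub>F n in sequentially. norm (B (F n) h - B f h) \<le> nrm (\<lambda>x. F n x - f x) * nrm h"
      using Cauchy_Schwarz[OF diff_mem, of _ f h] assms by (simp add: diff_left)
    show "(\<lambda>n. nrm (\<lambda>x. F n x - f x) * nrm h) \<longlonglongrightarrow> 0"
      using assms(3) unfolding converges_def by (rule tendsto_mult_left_zero)
  qed
  then show ?thesis by (simp add: LIM_zero_iff)
qed

lemma cauchy_bounded:
  assumes F: "\<And>n. F n \<in> V" and c: "cauchy F"
  obtains K where "\<And>n. nrm (F n) \<le> K"
proof -
  obtain N where N: "\<And>m n. m \<ge> N \<Longrightarrow> n \<ge> N \<Longrightarrow> nrm (\<lambda>x. F m x - F n x) < 1"
    using c unfolding cauchy_def by (metis zero_less_one)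
  define K where "K = Max ((\<lambda>n. nrm (F n)) ` {..N}) + 1"
  have le: "nrm (F n) \<le> Max ((\<lambda>n. nrm (F n)) ` {..N})" if "n \<le> N" for n
    using that by (intro Max_ge) auto
  have "nrm (F n) \<le> K" for n
  proof (cases "n \<le> N")
    case True then show ?thesis using le[of n] unfolding K_def by linarith
  next
    case False
    then have "nrm (F n) - nrm (F N) \<le> 1"
      using nrm_abs_diff[OF F[of n] F[of N]] N[of n N] by simp
    then show ?thesis using le[of N] unfolding K_def by linarith
  qed
  then show ?thesis using that by blast
qed

lemma converges_cauchy:
  assumes F: "\<And>n. F n \<in> V" and f: "f \<in> V" and c: "converges F f"
  shows "cauchy F"
  unfolding cauchy_def
proof safe
  fix e :: real assume "e > 0"
  then obtain N where N: "\<And>n. n \<ge> N \<Longrightarrow> nrm (\<lambda>x. F n x - f x) < e / 2"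
    using order_tendstoD(2)[OF c[unfolded converges_def], of "e / 2"]
    by (auto simp: eventually_sequentially)
  have "nrm (\<lambda>x. F m x - F n x) < e" if "m \<ge> N" "n \<ge> N" for m n
    using nrm_triangle_diff[OF F[of m] f F[of n]] N[OF that(1)] N[OF that(2)]
      nrm_minus_commute[OF F[of n] f] by simp
  then show "\<exists>N. \<forall>m\<ge>N. \<forall>n\<ge>N. nrm (\<lambda>x. F m x - F n x) < e" by blast
qed

text \<open>The representing vector minimises \<open>\<parallel>f\<parallel>\<^sup>2 - 2 Re (l f)\<close>; minimising sequences are Cauchy by the
  parallelogram identity.\<close>

lemma Riesz_representation:
  assumes compl: "is_complete"
    and l_lin: "\<And>f g c. f \<in> V \<Longrightarrow> g \<in> V \<Longrightarrow> l (\<lambda>x. f x + c * g x) = l f + c * l g"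
    and l_bound: "\<And>f. f \<in> V \<Longrightarrow> cmod (l f) \<le> K * nrm f"
  shows "\<exists>f\<in>V. \<forall>h\<in>V. B f h = l h"
proof -
  define J where "J f = sq f - 2 * Re (l f)" for f
  have J_lb: "- (K\<^sup>2) \<le> J f" if "f \<in> V" for f
  proof -
    have "Re (l f) \<le> K * nrm f"
      using l_bound[OF that] complex_Re_le_cmod[of "l f"] by linarith
    moreover have "0 \<le> (nrm f - K)\<^sup>2" by simp
    ultimately show ?thesis
      unfolding J_def using nrm_power2[OF that] by (simp add: power2_diff algebra_simps)
  qed
  define m where "m = Inf (J ` V)"
  have bdd: "bdd_below (J ` V)" using J_lb by (auto intro!: bdd_belowI)
  have m_le: "m \<le> J f" if "f \<in> V" for f
    unfolding m_def using that bdd by (auto intro: cInf_lower)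
  have "\<exists>f\<in>V. J f < m + 1 / real (Suc n)" for n
    using cInf_lessD[of "J ` V" "m + 1 / real (Suc n)"] zero_mem unfolding m_def by auto
  then obtain F where F: "\<And>n. F n \<in> V" and JF: "\<And>n. J (F n) < m + 1 / real (Suc n)"
    by metis
  have J_par: "sq (\<lambda>x. f x - g x) \<le> 2 * (J f - m) + 2 * (J g - m)" if f: "f \<in> V" and g: "g \<in> V" for f g
  proof -
    let ?h = "\<lambda>x. (1/2) * f x + (1/2) * g x"
    have hV: "?h \<in> V" using f g by (intro lin_mem scale_mem)
    have "sq ?h = (1/4) * sq f + (1/2) * Re (B f g) + (1/4) * sq g"
      unfolding sq_lin[OF scale_mem[OF f, of "1/2"] g, of "1/2"] sq_scale[OF f] scale_left[OF f g]
      by (simp add: power2_eq_square)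
    moreover have "l ?h = (1/2) * l f + (1/2) * l g"
      unfolding l_lin[OF scale_mem[OF f, of "1/2"] g, of "1/2"]
      using l_lin[OF zero_mem f, of "1/2"] l_lin[OF zero_mem zero_mem, of 1] by simp
    moreover have "sq (\<lambda>x. f x - g x) = sq f - 2 * Re (B f g) + sq g"
      using sq_lin[OF f g, of "-1"] by simp
    ultimately have "sq (\<lambda>x. f x - g x) = 2 * J f + 2 * J g - 4 * J ?h"
      by (simp add: J_def)
    then show ?thesis using m_le[OF hV] by simp
  qed
  have "cauchy F"
    unfolding cauchy_def
  proof safe
    fix e :: real assume "e > 0"
    \<comment> \<open>Beyond \<open>N\<close> both values of \<open>J\<close> lie within
      \<open>1 / real (Suc N)\<close> of the infimum, so \<open>J_par\<close> bounds the squared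
      distance by four times this.\<close>
    obtain N where N: "4 / e\<^sup>2 < real (Suc N)"
      using reals_Archimedean2[of "4 / e\<^sup>2"] by (metis lessI less_trans of_nat_less_iff)
    have "nrm (\<lambda>x. F p x - F q x) < e" if "p \<ge> N" "q \<ge> N" for p q
    proof -
      have "1 / real (Suc p) \<le> 1 / real (Suc N)" "1 / real (Suc q) \<le> 1 / real (Suc N)"
        using that by (auto simp: field_simps)
      moreover have "s < 4 * c" if "a \<le> c" "b \<le> c" "s \<le> 2 * (x - m) + 2 * (y - m)" "x < m + a" "y < m + b"
        for a b c s x y :: real using that by argo
      ultimately have "sq (\<lambda>x. F p x - F q x) < 4 * (1 / real (Suc N))"
        using J_par[OF F[of p] F[of q]] JF[of p] JF[of q] by blast
      also have "\<dots> < e\<^sup>2" using N \<open>e > 0\<close> by (simp add: field_simps)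
      finally have "nrm (\<lambda>x. F p x - F q x) < sqrt (e\<^sup>2)"
        unfolding nrm_def by (rule real_sqrt_less_mono)
      then show ?thesis using \<open>e > 0\<close> by simp
    qed
    then show "\<exists>N. \<forall>m\<ge>N. \<forall>n\<ge>N. nrm (\<lambda>x. F m x - F n x) < e" by blast
  qed
  then obtain f where f: "f \<in> V" and conv: "converges F f"
    using compl F unfolding is_complete_def by blast
  have l_diff: "l (\<lambda>x. u x - v x) = l u - l v" if "u \<in> V" "v \<in> V" for u v
    using l_lin[OF that, of "-1"] by simp
  have "(\<lambda>n. l (F n) - l f) \<longlonglongrightarrow> 0"
  proof (rule Lim_null_comparison)
    show "\<forall>\<^sub>F n in sequentially. norm (l (F n) - l f) \<le> K * nrm (\<lambda>x. F n x - f x)"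
      using l_bound[OF diff_mem[OF F f]] by (simp add: l_diff F f)
    show "(\<lambda>n. K * nrm (\<lambda>x. F n x - f x)) \<longlonglongrightarrow> 0"
      using conv unfolding converges_def by (rule tendsto_mult_right_zero)
  qed
  then have "(\<lambda>n. l (F n)) \<longlonglongrightarrow> l f" by (simp add: LIM_zero_iff)
  then have "(\<lambda>n. (nrm (F n))\<^sup>2 - 2 * Re (l (F n))) \<longlonglongrightarrow> (nrm f)\<^sup>2 - 2 * Re (l f)"
    using converges_nrm[OF F f conv] by (intro tendsto_intros)
  then have lim: "(\<lambda>n. J (F n)) \<longlonglongrightarrow> J f"
    by (simp add: J_def nrm_power2 F f)
  have "(\<lambda>n. m + 1 / real (Suc n)) \<longlonglongrightarrow> m + 0"
    by (intro tendsto_add tendsto_const LIMSEQ_Suc lim_1_over_n)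
  then have lim': "(\<lambda>n. m + 1 / real (Suc n)) \<longlonglongrightarrow> m" by simp
  have Jf: "J f \<le> m"
    by (rule LIMSEQ_le[OF lim lim']) (intro exI[of _ 0] allI impI less_imp_le JF)
  have "B f h = l h" if h: "h \<in> V" for h
  proof (rule ccontr)
    assume ne: "B f h \<noteq> l h"
    define d where "d = B f h - l h"
    have d0: "0 < (cmod d)\<^sup>2" using ne by (simp add: d_def)
    have J_lin: "J (\<lambda>x. f x + k * h x) = J f + 2 * Re (k * d) + (cmod k)\<^sup>2 * sq h" for k
      unfolding J_def sq_lin[OF f h] l_lin[OF f h] d_def by (simp add: algebra_simps)
    \<comment> \<open>Moving the minimiser \<open>f\<close> by \<open>- s * cnj d\<close> times
      \<open>h\<close> changes \<open>J\<close> to first order by the real number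
      \<open>- 2 * s * (cmod d)\<^sup>2\<close>, so a nonzero \<open>d\<close> would contradict
      minimality.\<close>
    have key: "0 \<le> - 2 * s * (cmod d)\<^sup>2 + s\<^sup>2 * (cmod d)\<^sup>2 * sq h" for s :: real
    proof -
      let ?c = "- complex_of_real s * cnj d"
      have "J f \<le> J (\<lambda>x. f x + ?c * h x)"
        using Jf m_le[OF lin_mem[OF f h]] by (rule order_trans)
      also have "\<dots> = J f + 2 * Re (?c * d) + (cmod ?c)\<^sup>2 * sq h"
        by (rule J_lin)
      also have "?c * d = - complex_of_real (s * (cmod d)\<^sup>2)"
        using cnj_mult_self[of d] by (simp add: mult.assoc)
      also have "(cmod ?c)\<^sup>2 = s\<^sup>2 * (cmod d)\<^sup>2"
        by (simp add: norm_mult power_mult_distrib)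
      finally show ?thesis by simp
    qed
    \<comment> \<open>The step must be so small that the linear term beats the quadratic one, that
      is \<open>s * sq h < 2\<close>; the \<open>+ 1\<close> covers a null \<open>h\<close>.\<close>
    define s where "s = 1 / (sq h + 1)"
    have s: "s > 0" "s * sq h < 2" using sq_nonneg[OF h] by (auto simp: s_def field_simps)
    have "- 2 * s * (cmod d)\<^sup>2 + s\<^sup>2 * (cmod d)\<^sup>2 * sq h = (s * (cmod d)\<^sup>2) * (s * sq h - 2)"
      by (simp add: power2_eq_square algebra_simps)
    moreover have "(s * (cmod d)\<^sup>2) * (s * sq h - 2) < 0"
      using s d0 by (intro mult_pos_neg) auto
    ultimately show False using key[of s] by linarith
  qed
  then show ?thesis using f by blast
qed

end

section \<open>The space of square-integrable functions\<close>

lemma L2_space_measurable: "f \<in> L2_space M \<Longrightarrow> f \<in> borel_measurable M"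
  by (simp add: L2_space_def)

lemma L2_space_integrable: "f \<in> L2_space M \<Longrightarrow> integrable M (\<lambda>x. (cmod (f x))\<^sup>2)"
  by (simp add: L2_space_def)

lemma borel_measurable_cnj [measurable (raw)]:
  "f \<in> borel_measurable M \<Longrightarrow> (\<lambda>x. cnj (f x)) \<in> borel_measurable M"
  by (rule borel_measurable_continuous_on[of cnj, OF continuous_on_cnj[OF continuous_on_id]])

lemma L2_inner_integrable:
  assumes f: "f \<in> L2_space M" and g: "g \<in> L2_space M"
  shows "integrable M (\<lambda>x. cnj (f x) * g x)"
proof (rule Bochner_Integration.integrable_bound)
  show "integrable M (\<lambda>x. (cmod (f x))\<^sup>2 + (cmod (g x))\<^sup>2)"
    using f g by (intro Bochner_Integration.integrable_add L2_space_integrable)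
  show "(\<lambda>x. cnj (f x) * g x) \<in> borel_measurable M"
    using f[THEN L2_space_measurable] g[THEN L2_space_measurable]
    by (intro borel_measurable_times borel_measurable_cnj)
  show "AE x in M. norm (cnj (f x) * g x) \<le> norm ((cmod (f x))\<^sup>2 + (cmod (g x))\<^sup>2)"
  proof (rule AE_I2)
    fix x
    have "2 * (cmod (f x) * cmod (g x)) \<le> (cmod (f x))\<^sup>2 + (cmod (g x))\<^sup>2"
      using sum_squares_bound[of "cmod (f x)" "cmod (g x)"] by simp
    moreover have "0 \<le> cmod (f x) * cmod (g x)" by simp
    ultimately show "norm (cnj (f x) * g x) \<le> norm ((cmod (f x))\<^sup>2 + (cmod (g x))\<^sup>2)"
      unfolding norm_mult complex_mod_cnj real_norm_def by linarith
  qed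
qed

lemma cmod_lin_power2_le: "(cmod (a + c * b))\<^sup>2 \<le> 2 * (cmod a)\<^sup>2 + 2 * (cmod c)\<^sup>2 * (cmod b)\<^sup>2"
proof -
  have "(cmod (a + c * b))\<^sup>2 \<le> (cmod a + cmod (c * b))\<^sup>2"
    by (intro power_mono norm_triangle_ineq) simp
  also have "\<dots> \<le> 2 * (cmod a)\<^sup>2 + 2 * (cmod (c * b))\<^sup>2"
    using sum_squares_bound[of "cmod a" "cmod (c * b)"] by (simp add: power2_sum)
  finally show ?thesis by (simp add: norm_mult power_mult_distrib)
qed

lemma L2_space_lin:
  assumes f: "f \<in> L2_space M" and g: "g \<in> L2_space M"
  shows "(\<lambda>x. f x + c * g x) \<in> L2_space M"
  unfolding L2_space_def
proof (safe)
  show m: "(\<lambda>x. f x + c * g x) \<in> borel_measurable M"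
    using f[THEN L2_space_measurable] g[THEN L2_space_measurable] by measurable
  show "integrable M (\<lambda>x. (cmod (f x + c * g x))\<^sup>2)"
  proof (rule Bochner_Integration.integrable_bound)
    show "integrable M (\<lambda>x. 2 * (cmod (f x))\<^sup>2 + 2 * (cmod c)\<^sup>2 * (cmod (g x))\<^sup>2)"
      using f g by (intro Bochner_Integration.integrable_add integrable_mult_right L2_space_integrable)
    show "(\<lambda>x. (cmod (f x + c * g x))\<^sup>2) \<in> borel_measurable M" using m by measurable
    show "AE x in M. norm ((cmod (f x + c * g x))\<^sup>2) \<le> norm (2 * (cmod (f x))\<^sup>2 + 2 * (cmod c)\<^sup>2 * (cmod (g x))\<^sup>2)"
    proof (rule AE_I2)
      fix x
      show "norm ((cmod (f x + c * g x))\<^sup>2) \<le> norm (2 * (cmod (f x))\<^sup>2 + 2 * (cmod c)\<^sup>2 * (cmod (g x))\<^sup>2)"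
        using cmod_lin_power2_le[of "f x" c "g x"] by simp
    qed
  qed
qed

lemma L2_inner_diag: "L2_inner M f f = complex_of_real (LINT x|M. (cmod (f x))\<^sup>2)"
  unfolding L2_inner_def by (simp only: cnj_mult_self integral_complex_of_real)

lemma semi_inner_L2: "semi_inner (L2_space M) (L2_inner M)"
proof
  show "(\<lambda>_. 0) \<in> L2_space M" by (simp add: L2_space_def)
  show "\<And>f g c. f \<in> L2_space M \<Longrightarrow> g \<in> L2_space M \<Longrightarrow> (\<lambda>x. f x + c * g x) \<in> L2_space M"
    by (rule L2_space_lin)
  show "L2_inner M f (\<lambda>x. g x + c * h x) = L2_inner M f g + c * L2_inner M f h"
    if "f \<in> L2_space M" "g \<in> L2_space M" "h \<in> L2_space M" for f g h c
  proof -
    have "(\<lambda>x. cnj (f x) * (g x + c * h x)) = (\<lambda>x. cnj (f x) * g x + c * (cnj (f x) * h x))"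
      by (simp add: algebra_simps)
    then show ?thesis
      using L2_inner_integrable[OF that(1,2)] L2_inner_integrable[OF that(1,3)]
      by (simp add: L2_inner_def)
  qed
  show "L2_inner M g f = cnj (L2_inner M f g)"
    if "f \<in> L2_space M" "g \<in> L2_space M" for f g
    unfolding L2_inner_def Bochner_Integration.integral_cnj[symmetric] by (simp add: mult.commute)
  show "0 \<le> Re (L2_inner M f f)" if "f \<in> L2_space M" for f
    by (simp add: L2_inner_diag)
qed

lemma L2_norm_nrm: "semi_inner.nrm (L2_inner M) = L2_norm M"
proof -
  interpret semi_inner "L2_space M" "L2_inner M" by (rule semi_inner_L2)
  show ?thesis by (rule ext) (simp add: nrm_def sq_def L2_norm_def L2_inner_diag)
qed

text \<open>The measure stays a parameter because the argument moves between
  \<open>dstar_on lam\<close> and \<open>lborel\<close>; the rewrite lets the seminorm facts speak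
  of \<open>L2_norm\<close> directly.\<close>

interpretation L2: semi_inner "L2_space M" "L2_inner M"
  rewrites "semi_inner.nrm (L2_inner M) = L2_norm M" for M
  by (rule semi_inner_L2) (rule L2_norm_nrm)

lemma L2_norm_power2: "(L2_norm M f)\<^sup>2 = (LINT x|M. (cmod (f x))\<^sup>2)"
  by (simp add: L2_norm_def)

lemma L2_inner_self: "L2_inner M f f = complex_of_real ((L2_norm M f)\<^sup>2)"
  by (simp add: L2_inner_diag L2_norm_power2 del: of_real_power)

lemma L2_norm_eq_0_iff:
  assumes "f \<in> L2_space M"
  shows "L2_norm M f = 0 \<longleftrightarrow> L2_eq M f (\<lambda>_. 0)"
  using integral_nonneg_eq_0_iff_AE[OF L2_space_integrable[OF assms]]
  by (simp add: L2_norm_def L2_eq_def)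

lemma L2_norm_diff_eq_0_iff:
  assumes "f \<in> L2_space M" "g \<in> L2_space M"
  shows "L2_norm M (\<lambda>x. f x - g x) = 0 \<longleftrightarrow> L2_eq M f g"
  using L2_norm_eq_0_iff[OF L2.diff_mem[OF assms]] by (simp add: L2_eq_def)

lemma L2_inner_cong_left:
  assumes "f \<in> L2_space M" "f' \<in> L2_space M" "g \<in> L2_space M" "L2_eq M f f'"
  shows "L2_inner M f g = L2_inner M f' g"
  using L2.Cauchy_Schwarz[OF L2.diff_mem[OF assms(1,2)] assms(3)] L2_norm_diff_eq_0_iff[OF assms(1,2)] assms
  by (simp add: L2.diff_left)

lemma nn_integral_L2_norm:
  assumes "f \<in> L2_space M"
  shows "(\<integral>\<^sup>+x. ennreal ((cmod (f x))\<^sup>2) \<partial>M) = ennreal ((L2_norm M f)\<^sup>2)"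
  unfolding L2_norm_power2 by (intro nn_integral_eq_integral L2_space_integrable assms) simp

lemma L2_norm_leI:
  assumes f: "f \<in> borel_measurable M" and le: "(\<integral>\<^sup>+x. ennreal ((cmod (f x))\<^sup>2) \<partial>M) \<le> ennreal (e\<^sup>2)" and "0 \<le> e"
  shows "f \<in> L2_space M" "L2_norm M f \<le> e"
proof -
  show L: "f \<in> L2_space M"
    unfolding L2_space_def using f le
    by (auto intro!: integrableI_bounded simp: le_less_trans[OF _ ennreal_less_top])
  have "ennreal ((L2_norm M f)\<^sup>2) \<le> ennreal (e\<^sup>2)"
    using le unfolding nn_integral_L2_norm[OF L] .
  then have "(L2_norm M f)\<^sup>2 \<le> e\<^sup>2" by simp
  then show "L2_norm M f \<le> e" using \<open>0 \<le> e\<close> by (rule power2_le_imp_le)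
qed

text \<open>Riesz-Fischer. A subsequence with geometrically small increments converges almost
  everywhere, and Fatou's lemma shows that its pointwise limit is the limit of the whole sequence in
  norm.\<close>

theorem L2_complete: "semi_inner.is_complete (L2_space M) (L2_inner M)"
  unfolding L2.is_complete_def
proof (intro allI impI)
  fix F :: "nat \<Rightarrow> 'a \<Rightarrow> complex"
  assume "\<forall>n. F n \<in> L2_space M" and cau: "L2.cauchy M F"
  then have F: "F n \<in> L2_space M" for n by blast
  have meas[measurable]: "F n \<in> borel_measurable M" for n using F[of n] by (rule L2_space_measurable)
  have "\<exists>N. \<forall>m\<ge>N. \<forall>n\<ge>N. L2_norm M (\<lambda>x. F m x - F n x) < (1/3)^k" for k
    using cau unfolding L2.cauchy_def by simp
  then obtain N where N: "\<And>k m n. m \<ge> N k \<Longrightarrow> n \<ge> N k \<Longrightarrow> L2_norm M (\<lambda>x. F m x - F n x) < (1/3)^k"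
    by metis
  \<comment> \<open>These partial sums are nondecreasing, at least \<open>N k\<close> and at least
    \<open>k\<close>, which is all that is asked of the indices.\<close>
  define r where "r k = (\<Sum>i\<le>k. Suc (N i))" for k
  have rN: "N k \<le> r k" for k
  proof -
    have "Suc (N k) \<le> r k" unfolding r_def by (rule member_le_sum) auto
    then show ?thesis by simp
  qed
  have rS: "r k \<le> r (Suc k)" for k by (simp add: r_def)
  have rk: "k \<le> r k" for k by (induction k) (auto simp: r_def)
  define d where "d k x = F (r (Suc k)) x - F (r k) x" for k x
  have d: "d k \<in> L2_space M" for k
    unfolding d_def[abs_def] by (intro L2.diff_mem F)
  have [measurable]: "d k \<in> borel_measurable M" for k using d[of k] by (rule L2_space_measurable)
  have dn: "(L2_norm M (d k))\<^sup>2 \<le> ((1/3)^k)\<^sup>2" for k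
    using N[of k "r (Suc k)" "r k"] rN[of k] rS[of k] L2.nrm_nonneg[OF d[of k]]
    by (intro power_mono) (auto simp: d_def[abs_def])
  \<comment> \<open>The squared norms decay like \<open>(1/9)^k\<close>, which leaves room for the
    weight \<open>4^k\<close>. Finiteness of the weighted sum at a point then bounds each increment
    there by a multiple of \<open>(1/2)^k\<close>, hence gives absolute convergence.\<close>
  have "(\<integral>\<^sup>+x. (\<Sum>k. ennreal (4^k * (cmod (d k x))\<^sup>2)) \<partial>M) = (\<Sum>k. \<integral>\<^sup>+x. ennreal (4^k * (cmod (d k x))\<^sup>2) \<partial>M)"
    by (rule nn_integral_suminf) measurable
  also have "\<dots> \<le> (\<Sum>k. ennreal ((4/9)^k))"
  proof (rule suminf_le)
    fix k
    have "(\<integral>\<^sup>+x. ennreal (4^k * (cmod (d k x))\<^sup>2) \<partial>M) = ennreal (4^k) * ennreal ((L2_norm M (d k))\<^sup>2)"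
      by (simp add: ennreal_mult nn_integral_cmult nn_integral_L2_norm[OF d])
    also have "\<dots> = ennreal (4^k * (L2_norm M (d k))\<^sup>2)" by (simp add: ennreal_mult)
    also have "\<dots> \<le> ennreal (4^k * ((1/3)^k)\<^sup>2)"
      using dn[of k] by (intro ennreal_leI mult_left_mono) auto
    also have "(4::real)^k * ((1/3)^k)\<^sup>2 = (4/9)^k"
      using power_mult_distrib[of "3::real" 3 k] by (simp add: power2_eq_square power_divide)
    finally show "(\<integral>\<^sup>+x. ennreal (4^k * (cmod (d k x))\<^sup>2) \<partial>M) \<le> ennreal ((4/9)^k)" .
  qed auto
  also have "\<dots> = ennreal (\<Sum>k. (4/9)^k)"
    by (rule suminf_ennreal2) (auto intro!: summable_geometric)
  also have "\<dots> < \<infinity>" by simp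
  finally have "AE x in M. (\<Sum>k. ennreal (4^k * (cmod (d k x))\<^sup>2)) \<noteq> \<infinity>"
    by (intro nn_integral_PInf_AE) auto
  then have conv: "AE x in M. convergent (\<lambda>k. F (r k) x)"
  proof (rule AE_mp, intro AE_I2 impI)
    fix x assume fin: "(\<Sum>k. ennreal (4^k * (cmod (d k x))\<^sup>2)) \<noteq> \<infinity>"
    define S where "S = enn2real (\<Sum>k. ennreal (4^k * (cmod (d k x))\<^sup>2))"
    have S: "ennreal S = (\<Sum>k. ennreal (4^k * (cmod (d k x))\<^sup>2))"
      using fin by (simp add: S_def less_top)
    have bound: "cmod (d k x) \<le> sqrt S * (1/2)^k" for k
    proof -
      have "(\<Sum>i\<in>{k}. ennreal (4^i * (cmod (d i x))\<^sup>2)) \<le> ennreal S"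
        unfolding S by (rule sum_le_suminf) (rule summableI, simp_all only: finite.intros zero_le)
      then have "ennreal (4^k * (cmod (d k x))\<^sup>2) \<le> ennreal S" 
        by (simp only: sum.insert finite.emptyI empty_iff not_False_eq_True sum.empty add_0_right)
      moreover have "0 \<le> S" unfolding S_def by (rule enn2real_nonneg)
      ultimately have "4^k * (cmod (d k x))\<^sup>2 \<le> S" by (simp only: ennreal_le_iff)
      moreover have "4^k * (cmod (d k x))\<^sup>2 = (2^k * cmod (d k x))\<^sup>2"
        using power_mult_distrib[of "2::real" 2 k] by (simp add: power2_eq_square mult_ac)
      ultimately have "sqrt ((2^k * cmod (d k x))\<^sup>2) \<le> sqrt S" by (simp del: real_sqrt_abs real_sqrt_pow2_iff)
      then have "2^k * cmod (d k x) \<le> sqrt S" by simp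
      then show ?thesis by (simp add: field_simps power_divide)
    qed
    have "summable (\<lambda>k. d k x)"
    proof (rule summable_comparison_test')
      show "summable (\<lambda>k. sqrt S * (1/2)^k)" by (intro summable_mult summable_geometric) simp
      show "norm (d k x) \<le> sqrt S * (1/2)^k" if "k \<ge> 0" for k by (rule bound)
    qed
    then have "convergent (\<lambda>n. \<Sum>k<n. d k x)" by (rule summable_iff_convergent[THEN iffD1])
    then have "convergent (\<lambda>n. F (r n) x - F (r 0) x)"
      unfolding d_def by (subst (asm) sum_lessThan_telescope)
    then have "convergent (\<lambda>n. (F (r n) x - F (r 0) x) + F (r 0) x)"
      by (intro convergent_add convergent_const)
    then show "convergent (\<lambda>k. F (r k) x)" by simp
  qed
  define f where "f x = lim (\<lambda>k. F (r k) x)" for x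
  have fm[measurable]: "f \<in> borel_measurable M"
    unfolding f_def[abs_def] by (rule borel_measurable_lim_metric) measurable
  have lim: "AE x in M. (\<lambda>k. F (r k) x) \<longlonglongrightarrow> f x"
    using conv by eventually_elim (simp add: f_def convergent_LIMSEQ_iff)
  \<comment> \<open>Fatou's lemma along \<open>r\<close> in the second slot turns the Cauchy
    estimate into a bound on the distance to the pointwise limit. Square integrability of the
    difference comes with it, and that of \<open>f\<close> follows afterwards.\<close>
  have close: "(\<lambda>x. F n x - f x) \<in> L2_space M \<and> L2_norm M (\<lambda>x. F n x - f x) \<le> e"
    if K: "\<And>m n. m \<ge> K \<Longrightarrow> n \<ge> K \<Longrightarrow> L2_norm M (\<lambda>x. F m x - F n x) < e" and n: "n \<ge> K" and e: "e > 0" for n K e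
  proof -
    have "(\<integral>\<^sup>+x. ennreal ((cmod (F n x - f x))\<^sup>2) \<partial>M)
        = (\<integral>\<^sup>+x. liminf (\<lambda>k. ennreal ((cmod (F n x - F (r k) x))\<^sup>2)) \<partial>M)"
    proof (rule nn_integral_cong_AE)
      show "AE x in M. ennreal ((cmod (F n x - f x))\<^sup>2) = liminf (\<lambda>k. ennreal ((cmod (F n x - F (r k) x))\<^sup>2))"
        using lim
      proof eventually_elim
        case (elim x)
        have "(\<lambda>k. ennreal ((cmod (F n x - F (r k) x))\<^sup>2)) \<longlonglongrightarrow> ennreal ((cmod (F n x - f x))\<^sup>2)"
          using elim by (intro tendsto_intros)
        then show ?case by (rule lim_imp_Liminf[OF sequentially_bot, symmetric])
      qed
    qed
    also have "\<dots> \<le> liminf (\<lambda>k. \<integral>\<^sup>+x. ennreal ((cmod (F n x - F (r k) x))\<^sup>2) \<partial>M)"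
      by (rule nn_integral_liminf) measurable
    also have "\<dots> \<le> ennreal (e\<^sup>2)"
    proof (rule Liminf_le)
      show "\<forall>\<^sub>F k in sequentially. (\<integral>\<^sup>+x. ennreal ((cmod (F n x - F (r k) x))\<^sup>2) \<partial>M) \<le> ennreal (e\<^sup>2)"
        using eventually_ge_at_top[of K]
      proof eventually_elim
        case (elim k)
        then have "K \<le> r k" using rk[of k] by simp
        then have "L2_norm M (\<lambda>x. F n x - F (r k) x) < e" using K n by simp
        then have "(L2_norm M (\<lambda>x. F n x - F (r k) x))\<^sup>2 \<le> e\<^sup>2"
          by (intro power_mono L2.nrm_nonneg L2.diff_mem F) simp
        then show ?case
          by (subst nn_integral_L2_norm[OF L2.diff_mem[OF F F]]) (rule ennreal_leI)
      qed
    qed simp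
    finally have le: "(\<integral>\<^sup>+x. ennreal ((cmod (F n x - f x))\<^sup>2) \<partial>M) \<le> ennreal (e\<^sup>2)" .
    have "(\<lambda>x. F n x - f x) \<in> borel_measurable M" by measurable
    from L2_norm_leI[OF this le] e show ?thesis by auto
  qed
  have cau': "\<exists>K. \<forall>m\<ge>K. \<forall>n\<ge>K. L2_norm M (\<lambda>x. F m x - F n x) < e" if "e > 0" for e
    using cau that unfolding L2.cauchy_def by blast
  obtain K where "\<And>m n. m \<ge> K \<Longrightarrow> n \<ge> K \<Longrightarrow> L2_norm M (\<lambda>x. F m x - F n x) < 1"
    using cau'[of 1] by auto
  then have "(\<lambda>x. F K x - f x) \<in> L2_space M" using close[of K 1 K] by simp
  then have "(\<lambda>x. F K x - (F K x - f x)) \<in> L2_space M" by (rule L2.diff_mem[OF F])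
  then have fL: "f \<in> L2_space M" by simp
  have "L2.converges M F f"
    unfolding L2.converges_def
  proof (rule LIMSEQ_I)
    fix e :: real assume "0 < e"
    then obtain K where "\<And>m n. m \<ge> K \<Longrightarrow> n \<ge> K \<Longrightarrow> L2_norm M (\<lambda>x. F m x - F n x) < e / 2"
      using cau'[of "e / 2"] by auto
    then have "L2_norm M (\<lambda>x. F n x - f x) \<le> e / 2" if "n \<ge> K" for n
      using close[of K "e / 2" n] that \<open>0 < e\<close> by simp
    then show "\<exists>no. \<forall>n\<ge>no. norm (L2_norm M (\<lambda>x. F n x - f x) - 0) < e"
      using \<open>0 < e\<close> L2.nrm_nonneg[OF L2.diff_mem[OF F fL]] by (intro exI[of _ K]) fastforce
  qed
  then show "\<exists>f\<in>L2_space M. L2.converges M F f" using fL by blast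
qed

section \<open>Operators of closed forms with compact embedding\<close>

text \<open>\<open>S\<close> is given as data and tied to \<open>q\<close> on the diagonal only;
  \<open>polar_form_eq\<close> shows that it is the polarization that \<open>form_operator\<close>
  uses. The clause \<open>compact\<close> is the compact embedding of the form domain into L2,
  phrased with Cauchy subsequences so that no limit has to be produced in the form domain.\<close>

locale closed_form =
  fixes M :: "'a measure" and q :: "('a \<Rightarrow> complex) \<Rightarrow> ereal"
    and S :: "('a \<Rightarrow> complex) \<Rightarrow> ('a \<Rightarrow> complex) \<Rightarrow> complex" and c :: real
  assumes lower: "\<And>f. f \<in> L2_space M \<Longrightarrow> ereal (c * (L2_norm M f)\<^sup>2) \<le> q f"
    and lsc: "form_lsc M q"
    and sesq: "sesquilinear (form_domain M q) S"
    and q_eq: "\<And>f. f \<in> form_domain M q \<Longrightarrow> q f = ereal (Re (S f f))"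
    and compact: "\<And>F K. (\<And>n. F n \<in> form_domain M q) \<Longrightarrow> (\<And>n. Re (S (F n) (F n)) \<le> K) \<Longrightarrow>
      (\<And>n. L2_norm M (F n) \<le> K) \<Longrightarrow> \<exists>r::nat \<Rightarrow> nat. strict_mono r \<and> semi_inner.cauchy (L2_inner M) (F \<circ> r)"
begin

abbreviation "D \<equiv> form_domain M q"
abbreviation "A \<equiv> form_operator M q"

sublocale S: sesquilinear D S by (rule sesq)

section \<open>The form norm and its completeness\<close>

lemma D_L2: "f \<in> D \<Longrightarrow> f \<in> L2_space M"
  by (simp add: form_domain_def)

lemma S_lower: "f \<in> D \<Longrightarrow> c * (L2_norm M f)\<^sup>2 \<le> Re (S f f)"
  using lower[OF D_L2, of f] q_eq[of f] by simp

text \<open>The usual form inner product: the shift by \<open>1 - c\<close> lifts the lower bound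
  from \<open>c\<close> to 1, so the resulting norm dominates the L2 norm.\<close>

definition Q :: "('a \<Rightarrow> complex) \<Rightarrow> ('a \<Rightarrow> complex) \<Rightarrow> complex" where
  "Q f g = S f g + complex_of_real (1 - c) * L2_inner M f g"

lemma Q_diag: "Re (Q f f) = Re (S f f) + (1 - c) * (L2_norm M f)\<^sup>2"
  by (simp add: Q_def L2_inner_self del: of_real_power of_real_diff)

lemma Q_lower: "f \<in> D \<Longrightarrow> (L2_norm M f)\<^sup>2 \<le> Re (Q f f)"
  using S_lower[of f] by (simp add: Q_diag algebra_simps)

sublocale Q: semi_inner D Q
proof
  show "(\<lambda>_. 0) \<in> D" by (rule S.zero_mem)
  show "\<And>f g c. f \<in> D \<Longrightarrow> g \<in> D \<Longrightarrow> (\<lambda>x. f x + c * g x) \<in> D" by (rule S.lin_mem)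
  show "Q f (\<lambda>x. g x + z * h x) = Q f g + z * Q f h" if "f \<in> D" "g \<in> D" "h \<in> D" for f g h z
    using that by (simp add: Q_def S.lin_right L2.lin_right D_L2 algebra_simps)
  show "Q g f = cnj (Q f g)" if "f \<in> D" "g \<in> D" for f g
    unfolding Q_def using S.hermitian[OF that] L2.hermitian[OF that[THEN D_L2]] by simp
  show "0 \<le> Re (Q f f)" if "f \<in> D" for f
    using Q_lower[OF that] zero_le_power2[of "L2_norm M f"] by linarith
qed

lemma norm_le_Q: "f \<in> D \<Longrightarrow> L2_norm M f \<le> Q.nrm f"
  unfolding Q.nrm_def Q.sq_def using Q_lower[of f] real_le_rsqrt by blast

lemma lsc_eventually:
  assumes g: "g \<in> L2_space M" and G: "\<And>n. G n \<in> L2_space M" and lim: "L2.converges M G g" and a: "a < q g"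
  shows "\<forall>\<^sub>F n in sequentially. a < q (G n)"
proof -
  obtain e where e: "e > 0" "\<And>h. h \<in> L2_space M \<Longrightarrow> L2_norm M (\<lambda>x. h x - g x) < e \<Longrightarrow> a < q h"
    using lsc g a unfolding form_lsc_def by blast
  have "\<forall>\<^sub>F n in sequentially. L2_norm M (\<lambda>x. G n x - g x) < e"
    using lim e(1) unfolding L2.converges_def by (rule order_tendstoD)
  then show ?thesis by eventually_elim (use e G in blast)
qed

text \<open>Closedness of the form. A limit \<open>f\<close> exists in L2 because the form norm
  dominates; lower semicontinuity along \<open>F n - F m\<close>, with \<open>m\<close> tending to
  infinity, then puts \<open>F n - f\<close> into the form domain with small form norm.\<close>

lemma Q_complete: "Q.is_complete"
  unfolding Q.is_complete_def
proof (intro allI impI)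
  fix F :: "nat \<Rightarrow> 'a \<Rightarrow> complex"
  assume "\<forall>n. F n \<in> D" and cau: "Q.cauchy F"
  then have F: "F n \<in> D" for n by blast
  note FL = F[THEN D_L2]
  have "L2.cauchy M F"
    unfolding L2.cauchy_def
  proof safe
    fix e :: real assume "e > 0"
    then obtain N where "\<And>m n. m \<ge> N \<Longrightarrow> n \<ge> N \<Longrightarrow> Q.nrm (\<lambda>x. F m x - F n x) < e"
      using cau unfolding Q.cauchy_def by blast
    then show "\<exists>N. \<forall>m\<ge>N. \<forall>n\<ge>N. L2_norm M (\<lambda>x. F m x - F n x) < e"
      using norm_le_Q[OF S.diff_mem[OF F F]] by (meson le_less_trans)
  qed
  then obtain f where f: "f \<in> L2_space M" and lim: "L2.converges M F f"
    using L2_complete[of M] FL unfolding L2.is_complete_def by blast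
  have key: "(\<lambda>x. F n x - f x) \<in> D \<and> Q.nrm (\<lambda>x. F n x - f x) \<le> 2 * e"
    if e: "e > 0" and N: "\<And>m n. m \<ge> N \<Longrightarrow> n \<ge> N \<Longrightarrow> Q.nrm (\<lambda>x. F m x - F n x) < e" and n: "n \<ge> N" for e N n
  proof -
    define g where "g x = F n x - f x" for x
    define G where "G m x = F n x - F m x" for m x
    have gL: "g \<in> L2_space M" unfolding g_def[abs_def] by (intro L2.diff_mem FL f)
    have GD: "G m \<in> D" for m unfolding G_def[abs_def] by (intro S.diff_mem F)
    have Glim: "L2.converges M G g"
      unfolding L2.converges_def G_def g_def using lim L2.nrm_minus_commute[OF f FL]
      by (simp add: L2.converges_def algebra_simps)
    \<comment> \<open>The bound uses \<open>2 * e\<^sup>2\<close> although \<open>Q\<close> stays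
      below \<open>e\<^sup>2\<close> along the sequence: the spare \<open>e\<^sup>2\<close> absorbs
      the variation of the L2 norms of \<open>G m\<close>, whose coefficient \<open>1 - c\<close>
      can have either sign.\<close>
    define a where "a = 2 * e\<^sup>2 - (1 - c) * (L2_norm M g)\<^sup>2"
    have "q g \<le> ereal a"
    proof (rule ccontr)
      assume "\<not> q g \<le> ereal a"
      then have ev: "\<forall>\<^sub>F m in sequentially. ereal a < q (G m)"
        by (intro lsc_eventually[OF gL D_L2[OF GD] Glim]) simp
      have "(\<lambda>m. 2 * e\<^sup>2 - (1 - c) * (L2_norm M (G m))\<^sup>2) \<longlonglongrightarrow> a"
        unfolding a_def by (intro tendsto_intros L2.converges_nrm[OF D_L2[OF GD] gL Glim])
      then have "\<forall>\<^sub>F m in sequentially. 2 * e\<^sup>2 - (1 - c) * (L2_norm M (G m))\<^sup>2 < a + e\<^sup>2"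
        using e by (intro order_tendstoD(2)[where y=a]) auto
      with ev eventually_ge_at_top[of N] have "\<forall>\<^sub>F m in sequentially. False"
      proof eventually_elim
        case (elim m)
        have "Q.nrm (G m) < e" unfolding G_def[abs_def] using N n elim(2) by blast
        then have "(Q.nrm (G m))\<^sup>2 < e\<^sup>2"
          by (intro power_strict_mono Q.nrm_nonneg GD) simp_all
        then have 1: "Re (S (G m) (G m)) + (1 - c) * (L2_norm M (G m))\<^sup>2 < e\<^sup>2"
          using Q.nrm_power2[OF GD] by (simp add: Q.sq_def Q_diag)
        have 2: "a < Re (S (G m) (G m))" using elim(1) q_eq[OF GD] by simp
        show False using 1 2 elim(3) by argo
      qed
      then show False by simp
    qed
    then have gD: "g \<in> D" using gL unfolding form_domain_def by auto
    have "Re (S g g) \<le> a" using \<open>q g \<le> ereal a\<close> q_eq[OF gD] by simp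
    then have "Q.sq g \<le> 2 * e\<^sup>2" by (simp add: Q.sq_def Q_diag a_def)
    also have "\<dots> \<le> (2 * e)\<^sup>2" by (simp add: power2_eq_square)
    finally have "Q.nrm g \<le> 2 * e"
      using e by (simp add: Q.nrm_def real_le_lsqrt)
    then show ?thesis using gD unfolding g_def[abs_def] by blast
  qed
  have cau': "\<exists>N. \<forall>m\<ge>N. \<forall>n\<ge>N. Q.nrm (\<lambda>x. F m x - F n x) < e" if "e > 0" for e
    using cau that unfolding Q.cauchy_def by blast
  obtain N where "\<And>m n. m \<ge> N \<Longrightarrow> n \<ge> N \<Longrightarrow> Q.nrm (\<lambda>x. F m x - F n x) < 1"
    using cau'[of 1] by auto
  then have "(\<lambda>x. F N x - f x) \<in> D" using key[of 1 N N] by simp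
  then have "(\<lambda>x. F N x - (F N x - f x)) \<in> D" by (rule S.diff_mem[OF F])
  then have fD: "f \<in> D" by simp
  have "Q.converges F f"
    unfolding Q.converges_def
  proof (rule LIMSEQ_I)
    fix e :: real assume "0 < e"
    then obtain N where "\<And>m n. m \<ge> N \<Longrightarrow> n \<ge> N \<Longrightarrow> Q.nrm (\<lambda>x. F m x - F n x) < e / 4"
      using cau'[of "e / 4"] by auto
    then have "Q.nrm (\<lambda>x. F n x - f x) \<le> 2 * (e / 4)" if "n \<ge> N" for n
      using key[of "e / 4" N n] that \<open>0 < e\<close> by simp
    then show "\<exists>no. \<forall>n\<ge>no. norm (Q.nrm (\<lambda>x. F n x - f x) - 0) < e"
      using \<open>0 < e\<close> Q.nrm_nonneg[OF S.diff_mem[OF F fD]] by (intro exI[of _ N]) fastforce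
  qed
  then show "\<exists>f\<in>D. Q.converges F f" using fD by blast
qed

text \<open>By \<open>sq_lin\<close> each summand is a constant plus
  \<open>2 * Re (\<i> ^ k * S f g)\<close>. Weighted with \<open>(- \<i>) ^ k\<close>, the constants
  and the conjugates of \<open>S f g\<close> cancel over the four roots of unity, and
  \<open>4 * S f g\<close> remains.\<close>

lemma polar_form_eq:
  assumes f: "f \<in> D" and g: "g \<in> D"
  shows "polar_form q f g = S f g"
proof -
  have "real_of_ereal (q (\<lambda>x. f x + \<i> ^ k * g x)) = S.sq f + 2 * Re (\<i> ^ k * S f g) + S.sq g" for k
    using q_eq[OF S.lin_mem[OF f g, of "\<i> ^ k"]] S.sq_lin[OF f g, of "\<i> ^ k"]
    by (simp add: S.sq_def norm_power)
  then show ?thesis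
    unfolding polar_form_def by (simp add: eval_nat_numeral complex_eq_iff)
qed

section \<open>The operator of the form: symmetry and a solvable point below the bound\<close>

lemma A_iff: "(f, g) \<in> A \<longleftrightarrow> f \<in> D \<and> g \<in> L2_space M \<and> (\<forall>h\<in>D. S f h = L2_inner M g h)"
  unfolding form_operator_def by (auto simp: polar_form_eq)

lemma A_D: "(f, g) \<in> A \<Longrightarrow> f \<in> D" by (simp add: A_iff)
lemma A_dom_L2: "(f, g) \<in> A \<Longrightarrow> f \<in> L2_space M" by (simp add: A_iff D_L2)
lemma A_range_L2: "(f, g) \<in> A \<Longrightarrow> g \<in> L2_space M" by (simp add: A_iff)
lemma A_S: "(f, g) \<in> A \<Longrightarrow> h \<in> D \<Longrightarrow> S f h = L2_inner M g h" by (simp add: A_iff)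

lemma A_lin:
  assumes "(f, g) \<in> A" "(f', g') \<in> A"
  shows "((\<lambda>x. f x + z * f' x), (\<lambda>x. g x + z * g' x)) \<in> A"
  using assms unfolding A_iff
  by (auto simp: S.lin_mem L2.lin_mem S.lin_left L2.lin_left D_L2)

lemma A_zero: "((\<lambda>_. 0), (\<lambda>_. 0)) \<in> A"
proof -
  have "S (\<lambda>_. 0) h = 0" if "h \<in> D" for h
    using S.scale_left[OF that that, of 0] by simp
  moreover have "L2_inner M (\<lambda>_. 0) h = 0" for h by (simp add: L2_inner_def)
  ultimately show ?thesis by (simp add: A_iff S.zero_mem L2.zero_mem)
qed

lemma A_scale: "(f, g) \<in> A \<Longrightarrow> ((\<lambda>x. z * f x), (\<lambda>x. z * g x)) \<in> A"
  using A_lin[OF A_zero, of f g z] by simp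

lemma A_diff: "(f, g) \<in> A \<Longrightarrow> (f', g') \<in> A \<Longrightarrow> ((\<lambda>x. f x - f' x), (\<lambda>x. g x - g' x)) \<in> A"
  using A_lin[of f g f' g' "-1"] by simp

lemma A_cong: "(f, g) \<in> A \<Longrightarrow> g' \<in> L2_space M \<Longrightarrow> L2_eq M g g' \<Longrightarrow> (f, g') \<in> A"
  unfolding A_iff using L2_inner_cong_left D_L2 by metis

lemma A_symmetric:
  assumes "(f, g) \<in> A" "(f', g') \<in> A"
  shows "L2_inner M g f' = L2_inner M f g'"
proof -
  have "L2_inner M g f' = S f f'" using A_S[OF assms(1) A_D[OF assms(2)]] by simp
  also have "\<dots> = cnj (S f' f)" by (rule S.hermitian) (use assms A_D in blast)+
  also have "\<dots> = cnj (L2_inner M g' f)" using A_S[OF assms(2) A_D[OF assms(1)]] by simp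
  also have "\<dots> = L2_inner M f g'"
    by (rule L2.hermitian[symmetric]) (use assms A_dom_L2 A_range_L2 in blast)+
  finally show ?thesis .
qed

text \<open>Riesz representation in the form norm, for the functional \<open>L2_inner M g\<close>,
  which is bounded there. \<open>Q f h = L2_inner M g h\<close> is the weak form of the equation for
  \<open>A - (c - 1)\<close>; choosing the second component as below makes it hold at every
  point.\<close>

lemma resolvent_at_lower_bound:
  assumes g: "g \<in> L2_space M"
  shows "\<exists>f h. (f, h) \<in> A \<and> (\<forall>x. h x - complex_of_real (c - 1) * f x = g x)"
proof -
  have "\<exists>f\<in>D. \<forall>h\<in>D. Q f h = L2_inner M g h"
  proof (rule Q.Riesz_representation[OF Q_complete])
    show "L2_inner M g (\<lambda>x. u x + z * v x) = L2_inner M g u + z * L2_inner M g v" if "u \<in> D" "v \<in> D" for u v z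
      using g that D_L2 by (intro L2.lin_right)
    show "cmod (L2_inner M g u) \<le> L2_norm M g * Q.nrm u" if "u \<in> D" for u
      using L2.Cauchy_Schwarz[OF g D_L2[OF that]] norm_le_Q[OF that] L2.nrm_nonneg[OF g]
      by (meson mult_left_mono order_trans)
  qed
  then obtain f where f: "f \<in> D" and eq: "\<And>h. h \<in> D \<Longrightarrow> Q f h = L2_inner M g h" by blast
  let ?h = "\<lambda>x. g x + complex_of_real (c - 1) * f x"
  have "S f h = L2_inner M ?h h" if "h \<in> D" for h
  proof -
    have "S f h = L2_inner M g h + complex_of_real (c - 1) * L2_inner M f h"
      using eq[OF that] by (simp add: Q_def algebra_simps)
    then show ?thesis
      unfolding L2.lin_left[OF g D_L2[OF f] D_L2[OF that]] complex_cnj_complex_of_real .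
  qed
  then have "(f, ?h) \<in> A" using f g by (simp add: A_iff L2.lin_mem D_L2)
  then show ?thesis by (intro exI[of _ f] exI[of _ ?h]) simp
qed

text \<open>The compactness assumption makes every bounded sequence of approximate solutions of
  \<open>(A - z) f = v\<close> converge, along a subsequence, in the form norm.\<close>

lemma approximate_solutions_converge:
  assumes FH: "\<And>n. (F n, H n) \<in> A" and bd: "\<And>n. L2_norm M (F n) \<le> K" and v: "v \<in> L2_space M"
    and lim: "L2.converges M (\<lambda>n x. H n x - z * F n x) v"
  shows "\<exists>f h r. (f, h) \<in> A \<and> (\<forall>x. h x - z * f x = v x) \<and> strict_mono r \<and> L2.converges M (F \<circ> r) f"
proof -
  have F: "F n \<in> D" and FL: "F n \<in> L2_space M" and HL: "H n \<in> L2_space M" for n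
    using FH[of n] A_D A_dom_L2 A_range_L2 by auto
  have VL: "(\<lambda>x. H n x - z * F n x) \<in> L2_space M" for n
    by (intro L2.diff_mem HL L2.scale_mem FL)
  obtain K1 where K1: "\<And>n. L2_norm M (\<lambda>x. H n x - z * F n x) \<le> K1"
    using L2.cauchy_bounded[OF VL L2.converges_cauchy[OF VL v lim]] by blast
  define K2 where "K2 = K1 + cmod z * K"
  have K2: "L2_norm M (H n) \<le> K2" for n
  proof -
    have "L2_norm M (\<lambda>x. (H n x - z * F n x) + z * F n x) \<le> L2_norm M (\<lambda>x. H n x - z * F n x) + L2_norm M (\<lambda>x. z * F n x)"
      by (rule L2.nrm_triangle[OF VL L2.scale_mem[OF FL]])
    also have "\<dots> \<le> K1 + cmod z * K"
      using K1[of n] bd[of n] by (simp add: L2.nrm_scale[OF FL] mult_left_mono add_mono)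
    finally show ?thesis by (simp add: K2_def)
  qed
  have K_nn: "0 \<le> K" using L2.nrm_nonneg[OF FL[of 0]] bd[of 0] by linarith
  have K2_nn: "0 \<le> K2" using L2.nrm_nonneg[OF HL[of 0]] K2[of 0] by linarith
  \<comment> \<open>On the domain of \<open>A\<close> the form value is an inner product with
    \<open>H n\<close>, so bounds on \<open>F n\<close> and \<open>H n\<close> bound the form and
    \<open>compact\<close> applies.\<close>
  have SF: "Re (S (F n) (F n)) \<le> K2 * K" for n
  proof -
    have "Re (S (F n) (F n)) \<le> cmod (L2_inner M (H n) (F n))"
      using A_S[OF FH F] complex_Re_le_cmod by metis
    also have "\<dots> \<le> L2_norm M (H n) * L2_norm M (F n)" by (rule L2.Cauchy_Schwarz[OF HL FL])
    also have "\<dots> \<le> K2 * K" using K2[of n] bd[of n] K2_nn L2.nrm_nonneg[OF FL] by (intro mult_mono) auto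
    finally show ?thesis .
  qed
  obtain r where r: "strict_mono r" and cau: "L2.cauchy M (F \<circ> r)"
    using compact[of F "max K (K2 * K)"] F SF bd by (metis le_max_iff_disj)
  have "Q.cauchy (F \<circ> r)"
    unfolding Q.cauchy_def
  proof safe
    fix e :: real assume e: "e > 0"
    \<comment> \<open>By Cauchy-Schwarz the form value of a difference is at most a constant times
      its L2 norm, and \<open>C\<close> collects the coefficients. So an L2-Cauchy subsequence is
      Cauchy in the form norm too; the \<open>+ 1\<close> makes \<open>C\<close> positive.\<close>
    define C where "C = 2 * K2 + \<bar>1 - c\<bar> * (2 * K) + 1"
    have C: "C > 0" using K2_nn K_nn by (simp add: C_def add_nonneg_pos)
    obtain N where N: "\<And>m n. m \<ge> N \<Longrightarrow> n \<ge> N \<Longrightarrow> L2_norm M (\<lambda>x. F (r m) x - F (r n) x) < e\<^sup>2 / C"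
      using cau e C unfolding L2.cauchy_def comp_def by (metis divide_pos_pos zero_less_power)
    have "Q.nrm (\<lambda>x. F (r m) x - F (r n) x) < e" if "m \<ge> N" "n \<ge> N" for m n
    proof -
      let ?d = "\<lambda>x. F (r m) x - F (r n) x" and ?h = "\<lambda>x. H (r m) x - H (r n) x"
      have dA: "(?d, ?h) \<in> A" by (intro A_diff FH)
      have dD: "?d \<in> D" and dL: "?d \<in> L2_space M" and hL: "?h \<in> L2_space M"
        using dA A_D A_dom_L2 A_range_L2 by blast+
      have h2: "L2_norm M ?h \<le> 2 * K2" using L2.nrm_diff_le[OF HL HL, of "r m" "r n"] K2[of "r m"] K2[of "r n"] by linarith
      have d2: "L2_norm M ?d \<le> 2 * K" using L2.nrm_diff_le[OF FL FL, of "r m" "r n"] bd[of "r m"] bd[of "r n"] by linarith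
      have "Re (S ?d ?d) \<le> cmod (L2_inner M ?h ?d)"
        using A_S[OF dA dD] complex_Re_le_cmod by metis
      also have "\<dots> \<le> L2_norm M ?h * L2_norm M ?d" by (rule L2.Cauchy_Schwarz[OF hL dL])
      also have "\<dots> \<le> 2 * K2 * L2_norm M ?d" using h2 L2.nrm_nonneg[OF dL] by (rule mult_right_mono)
      finally have 1: "Re (S ?d ?d) \<le> 2 * K2 * L2_norm M ?d" .
      have "(1 - c) * (L2_norm M ?d)\<^sup>2 \<le> \<bar>1 - c\<bar> * (L2_norm M ?d)\<^sup>2" by (intro mult_right_mono) auto
      also have "\<dots> \<le> \<bar>1 - c\<bar> * (2 * K * L2_norm M ?d)"
        using d2 L2.nrm_nonneg[OF dL] by (intro mult_left_mono) (auto simp: power2_eq_square intro: mult_right_mono)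
      finally have "Q.sq ?d \<le> 2 * K2 * L2_norm M ?d + \<bar>1 - c\<bar> * (2 * K * L2_norm M ?d)"
        using 1 by (simp add: Q.sq_def Q_diag)
      also have "\<dots> \<le> C * L2_norm M ?d"
        using L2.nrm_nonneg[OF dL] by (simp add: C_def algebra_simps)
      also have "\<dots> < C * (e\<^sup>2 / C)" using N[OF that] C by (intro mult_strict_left_mono) auto
      also have "\<dots> = e\<^sup>2" using C by simp
      finally show ?thesis using e real_sqrt_less_mono[of "Q.sq ?d" "e\<^sup>2"] by (simp add: Q.nrm_def)
    qed
    then show "\<exists>N. \<forall>m\<ge>N. \<forall>n\<ge>N. Q.nrm (\<lambda>x. (F \<circ> r) m x - (F \<circ> r) n x) < e" by auto
  qed
  then obtain f where f: "f \<in> D" and Qlim: "Q.converges (F \<circ> r) f"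
    using Q_complete F unfolding Q.is_complete_def by (metis comp_apply)
  have fL: "f \<in> L2_space M" by (rule D_L2[OF f])
  have Flim: "L2.converges M (F \<circ> r) f"
    unfolding L2.converges_def
  proof (rule Lim_null_comparison)
    show "(\<lambda>n. Q.nrm (\<lambda>x. (F \<circ> r) n x - f x)) \<longlonglongrightarrow> 0" using Qlim unfolding Q.converges_def .
    show "\<forall>\<^sub>F n in sequentially. norm (L2_norm M (\<lambda>x. (F \<circ> r) n x - f x)) \<le> Q.nrm (\<lambda>x. (F \<circ> r) n x - f x)"
      using norm_le_Q[OF S.diff_mem[OF F f]] L2.nrm_nonneg[OF L2.diff_mem[OF FL fL]] by simp
  qed
  \<comment> \<open>The only candidate for the image of \<open>f\<close>, fixed pointwise so that
    the equation is exact. The weak equation follows by computing the limit of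
    \<open>S (F (r n)) k\<close> in two ways.\<close>
  define h where "h x = v x + z * f x" for x
  have hL: "h \<in> L2_space M" unfolding h_def[abs_def] by (intro L2.lin_mem v fL)
  have "S f k = L2_inner M h k" if k: "k \<in> D" for k
  proof -
    have kL: "k \<in> L2_space M" by (rule D_L2[OF k])
    have "(\<lambda>n. Q ((F \<circ> r) n) k) \<longlonglongrightarrow> Q f k"
      by (rule Q.converges_left[OF _ f Qlim k]) (simp add: F)
    moreover have LF: "(\<lambda>n. L2_inner M ((F \<circ> r) n) k) \<longlonglongrightarrow> L2_inner M f k"
      by (rule L2.converges_left[OF _ fL Flim kL]) (simp add: FL)
    ultimately have "(\<lambda>n. Q ((F \<circ> r) n) k - complex_of_real (1 - c) * L2_inner M ((F \<circ> r) n) k)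
        \<longlonglongrightarrow> Q f k - complex_of_real (1 - c) * L2_inner M f k"
      by (intro tendsto_intros)
    then have 1: "(\<lambda>n. S (F (r n)) k) \<longlonglongrightarrow> S f k" by (simp add: Q_def)
    have "(\<lambda>n. L2_inner M (\<lambda>x. H n x - z * F n x) k) \<longlonglongrightarrow> L2_inner M v k"
      by (rule L2.converges_left[OF VL v lim kL])
    then have "(\<lambda>n. L2_inner M (\<lambda>x. H (r n) x - z * F (r n) x) k) \<longlonglongrightarrow> L2_inner M v k"
      using LIMSEQ_subseq_LIMSEQ[OF _ r] by (auto simp: comp_def)
    then have "(\<lambda>n. L2_inner M (\<lambda>x. H (r n) x - z * F (r n) x) k + cnj z * L2_inner M ((F \<circ> r) n) k)
        \<longlonglongrightarrow> L2_inner M v k + cnj z * L2_inner M f k"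
      using LF by (intro tendsto_intros)
    moreover have "L2_inner M (\<lambda>x. H (r n) x - z * F (r n) x) k + cnj z * L2_inner M ((F \<circ> r) n) k = S (F (r n)) k" for n
      using A_S[OF FH k, of "r n"] L2.diff_left[OF HL L2.scale_mem[OF FL] kL] L2.scale_left[OF FL kL] by simp
    ultimately have "(\<lambda>n. S (F (r n)) k) \<longlonglongrightarrow> L2_inner M v k + cnj z * L2_inner M f k" by simp
    then have "S f k = L2_inner M v k + cnj z * L2_inner M f k" using 1 LIMSEQ_unique by blast
    then show ?thesis unfolding h_def[abs_def] by (simp add: L2.lin_left v fL kL)
  qed
  then have "(f, h) \<in> A" using f hL by (simp add: A_iff)
  then show ?thesis using r Flim by (intro exI[of _ f] exI[of _ h] exI[of _ r]) (simp add: h_def)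
qed

section \<open>Eigenvalues and eigenspaces\<close>

lemma eigenspace_iff: "f \<in> eigenspace M A z \<longleftrightarrow> (f, \<lambda>x. z * f x) \<in> A"
proof
  assume "f \<in> eigenspace M A z"
  then obtain g where "(f, g) \<in> A" "L2_eq M g (\<lambda>x. z * f x)" unfolding eigenspace_def by blast
  then show "(f, \<lambda>x. z * f x) \<in> A" using A_cong L2.scale_mem A_dom_L2 by blast
next
  assume "(f, \<lambda>x. z * f x) \<in> A"
  then show "f \<in> eigenspace M A z" unfolding eigenspace_def by (auto simp: L2_eq_def)
qed

lemma is_eigenvalue_iff:
  "is_eigenvalue M A z \<longleftrightarrow> (\<exists>f. (f, \<lambda>x. z * f x) \<in> A \<and> L2_norm M f = 1)"
proof
  assume "is_eigenvalue M A z"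
  then obtain f where f: "(f, \<lambda>x. z * f x) \<in> A" and "\<not> L2_eq M f (\<lambda>_. 0)"
    unfolding is_eigenvalue_def Bex_def eigenspace_iff by blast
  moreover have fL: "f \<in> L2_space M" by (rule A_dom_L2[OF f])
  ultimately have n: "L2_norm M f > 0"
    using L2_norm_eq_0_iff[OF fL] L2.nrm_nonneg[OF fL] by force
  let ?k = "complex_of_real (1 / L2_norm M f)"
  have "((\<lambda>x. ?k * f x), (\<lambda>x. ?k * (z * f x))) \<in> A" by (rule A_scale[OF f])
  then have "((\<lambda>x. ?k * f x), (\<lambda>x. z * (?k * f x))) \<in> A" by (simp only: mult.left_commute)
  moreover have "L2_norm M (\<lambda>x. ?k * f x) = 1"
    unfolding L2.nrm_scale[OF fL] using n by (simp only: norm_of_real) simp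
  ultimately show "\<exists>f. (f, \<lambda>x. z * f x) \<in> A \<and> L2_norm M f = 1" by blast
next
  assume "\<exists>f. (f, \<lambda>x. z * f x) \<in> A \<and> L2_norm M f = 1"
  then obtain f where f: "(f, \<lambda>x. z * f x) \<in> A" "L2_norm M f = 1" by blast
  then have "\<not> L2_eq M f (\<lambda>_. 0)" using L2_norm_eq_0_iff[OF A_dom_L2[OF f(1)]] by simp
  then show "is_eigenvalue M A z"
    unfolding is_eigenvalue_def Bex_def eigenspace_iff using f(1) by blast
qed

lemma eigen_S:
  assumes "(f, \<lambda>x. z * f x) \<in> A" "L2_norm M f = 1"
  shows "S f f = cnj z"
  using A_S[OF assms(1) A_D[OF assms(1)]] L2.scale_left[OF A_dom_L2[OF assms(1)] A_dom_L2[OF assms(1)]] assms(2)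
  by (simp add: L2_inner_self)

lemma eigenvalue_real:
  assumes "is_eigenvalue M A z"
  shows "Im z = 0" "c \<le> Re z"
proof -
  obtain f where f: "(f, \<lambda>x. z * f x) \<in> A" "L2_norm M f = 1" using assms is_eigenvalue_iff by blast
  show "Im z = 0" using S.Im_diag[OF A_D[OF f(1)]] eigen_S[OF f] by simp
  show "c \<le> Re z" using S_lower[OF A_D[OF f(1)]] eigen_S[OF f] f(2) by simp
qed

lemma eigen_orthogonal:
  assumes f: "(f, \<lambda>x. z * f x) \<in> A" and g: "(g, \<lambda>x. w * g x) \<in> A" and "Im z = 0" "z \<noteq> w"
  shows "L2_inner M f g = 0"
proof -
  have fL: "f \<in> L2_space M" and gL: "g \<in> L2_space M" using f g A_dom_L2 by blast+
  have "cnj z * L2_inner M f g = w * L2_inner M f g"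
    using A_symmetric[OF f g] L2.scale_left[OF fL gL] L2.scale_right[OF fL gL] by simp
  moreover have "cnj z = z" using assms(3) by (simp add: complex_eq_iff)
  ultimately show ?thesis using assms(4) by auto
qed

text \<open>Orthonormal vectors lie at distance \<open>sqrt 2\<close> from each other, so no
  subsequence is Cauchy, contrary to \<open>compact\<close>.\<close>

lemma no_orthonormal_sequence:
  fixes F :: "nat \<Rightarrow> 'a \<Rightarrow> complex"
  assumes F: "\<And>n. F n \<in> D" and bd: "\<And>n. Re (S (F n) (F n)) \<le> K"
    and n1: "\<And>n. L2_norm M (F n) = 1" and orth: "\<And>m n. m \<noteq> n \<Longrightarrow> L2_inner M (F m) (F n) = 0"
  shows False
proof -
  obtain r :: "nat \<Rightarrow> nat" where r: "strict_mono r" and cau: "L2.cauchy M (F \<circ> r)"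
    using compact[of F "max K 1"] F bd n1 by (metis le_max_iff_disj order_refl)
  obtain N where "\<And>m n. m \<ge> N \<Longrightarrow> n \<ge> N \<Longrightarrow> L2_norm M (\<lambda>x. (F \<circ> r) m x - (F \<circ> r) n x) < 1"
    using cau unfolding L2.cauchy_def by (metis zero_less_one)
  then have lt: "L2_norm M (\<lambda>x. F (r N) x - F (r (Suc N)) x) < 1" by (simp add: comp_def)
  have "r N \<noteq> r (Suc N)" using strict_monoD[OF r, of N "Suc N"] by simp
  then have "L2.sq M (\<lambda>x. F (r N) x + (-1) * F (r (Suc N)) x) = 2"
    unfolding L2.sq_lin[OF D_L2[OF F] D_L2[OF F]]
    using orth n1 L2.nrm_power2[OF D_L2[OF F], symmetric] by simp
  then have "(L2_norm M (\<lambda>x. F (r N) x - F (r (Suc N)) x))\<^sup>2 = 2"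
    using L2.nrm_power2[OF L2.diff_mem[OF D_L2[OF F] D_L2[OF F]]] by simp
  moreover have "(L2_norm M (\<lambda>x. F (r N) x - F (r (Suc N)) x))\<^sup>2 \<le> 1\<^sup>2"
    using lt L2.nrm_nonneg[OF L2.diff_mem[OF D_L2[OF F] D_L2[OF F]]] by (intro power_mono) auto
  ultimately show False by simp
qed

text \<open>Unit eigenvectors of distinct eigenvalues are orthonormal, and their form values are the
  eigenvalues themselves, hence bounded.\<close>

lemma finitely_many_eigenvalues: "finite {z. is_eigenvalue M A z \<and> cmod z \<le> K}"
proof (rule ccontr)
  assume "infinite {z. is_eigenvalue M A z \<and> cmod z \<le> K}"
  from infinite_countable_subset[OF this] obtain Z :: "nat \<Rightarrow> complex"
    where inj: "inj Z" and "range Z \<subseteq> {z. is_eigenvalue M A z \<and> cmod z \<le> K}" by blast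
  then have Z: "is_eigenvalue M A (Z n)" "cmod (Z n) \<le> K" for n by auto
  have "\<exists>f. (f, \<lambda>x. Z n * f x) \<in> A \<and> L2_norm M f = 1" for n using Z(1) is_eigenvalue_iff by blast
  then obtain F where F: "\<And>n. (F n, \<lambda>x. Z n * F n x) \<in> A" and n1: "\<And>n. L2_norm M (F n) = 1" by metis
  show False
  proof (rule no_orthonormal_sequence)
    show "F n \<in> D" for n by (rule A_D[OF F])
    show "Re (S (F n) (F n)) \<le> K" for n
      using eigen_S[OF F n1] Z(2)[of n] complex_Re_le_cmod[of "Z n"] by simp
    show "L2_norm M (F n) = 1" for n by (rule n1)
    show "L2_inner M (F m) (F n) = 0" if "m \<noteq> n" for m n
      using eigen_orthogonal[OF F F eigenvalue_real(1)[OF Z(1)]] inj that by (auto simp: inj_def)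
  qed
qed

text \<open>Zorn's lemma gives a maximal orthonormal subset \<open>B\<close> of the eigenspace,
  finite by \<open>no_orthonormal_sequence\<close>. The residual of any eigenvector after projection
  to the span of \<open>B\<close> is null, as its normalisation would otherwise enlarge
  \<open>B\<close>. Orthonormality keeps members of \<open>B\<close> apart almost everywhere, so
  working with functions instead of classes does no harm.\<close>

lemma eigenspace_finite_dim: "L2_finite_dim M (eigenspace M A z)"
proof -
  define E where "E = eigenspace M A z"
  define \<O> where "\<O> = {B. B \<subseteq> E \<and> (\<forall>a\<in>B. \<forall>b\<in>B. L2_inner M a b = (if a = b then 1 else 0))}"
  have EL: "f \<in> L2_space M" if "f \<in> E" for f
    using that A_dom_L2 unfolding E_def eigenspace_iff by blast
  have "\<exists>B\<in>\<O>. \<forall>X\<in>\<O>. B \<subseteq> X \<longrightarrow> X = B"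
  proof (rule subset_Zorn')
    fix C assume C: "subset.chain \<O> C"
    have "L2_inner M a b = (if a = b then 1 else 0)" if "a \<in> X" "b \<in> Y" "X \<in> C" "Y \<in> C" for a b X Y
    proof -
      have "X \<subseteq> Y \<or> Y \<subseteq> X" using C that unfolding subset.chain_def by blast
      moreover have "X \<in> \<O>" "Y \<in> \<O>" using C that unfolding subset.chain_def by blast+
      ultimately show ?thesis using that unfolding \<O>_def by blast
    qed
    moreover have "\<Union>C \<subseteq> E" using C unfolding subset.chain_def \<O>_def by blast
    ultimately show "\<Union>C \<in> \<O>" unfolding \<O>_def by blast
  qed
  then obtain B where B: "B \<in> \<O>" and max: "\<And>X. X \<in> \<O> \<Longrightarrow> B \<subseteq> X \<Longrightarrow> X = B" by blast
  have BE: "b \<in> E" if "b \<in> B" for b using B that unfolding \<O>_def by blast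
  have BL: "b \<in> L2_space M" if "b \<in> B" for b using BE[OF that] by (rule EL)
  have on: "L2_inner M a b = (if a = b then 1 else 0)" if "a \<in> B" "b \<in> B" for a b
    using B that unfolding \<O>_def by blast
  have norm1: "L2_norm M a = 1" if "L2_inner M a a = 1" "a \<in> L2_space M" for a
  proof -
    have "(L2_norm M a)\<^sup>2 = 1" using that(1) unfolding L2_inner_self of_real_eq_1_iff .
    then show ?thesis using L2.nrm_nonneg[OF that(2)] by (simp add: power2_eq_1_iff)
  qed
  have "finite B"
  proof (rule ccontr)
    assume "infinite B"
    from infinite_countable_subset[OF this] obtain F :: "nat \<Rightarrow> 'a \<Rightarrow> complex"
      where inj: "inj F" and "range F \<subseteq> B" by blast
    then have FB: "F n \<in> B" for n by blast
    have FA: "(F n, \<lambda>x. z * F n x) \<in> A" for n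
      using BE[OF FB[of n]] unfolding E_def eigenspace_iff .
    have n1: "L2_norm M (F n) = 1" for n using norm1[OF _ BL[OF FB]] on[OF FB FB] by simp
    show False
    proof (rule no_orthonormal_sequence)
      show "F n \<in> D" for n by (rule A_D[OF FA])
      show "Re (S (F n) (F n)) \<le> Re z" for n using eigen_S[OF FA n1] by simp
      show "L2_norm M (F n) = 1" for n by (rule n1)
      show "L2_inner M (F m) (F n) = 0" if "m \<noteq> n" for m n
        using on[OF FB FB, of m n] inj that by (simp add: inj_eq)
    qed
  qed
  have E_lin: "(\<lambda>x. f x + k * g x) \<in> E" if "f \<in> E" "g \<in> E" for f g k
    using A_lin[of f "\<lambda>x. z * f x" g "\<lambda>x. z * g x" k] that unfolding E_def eigenspace_iff
    by (simp add: algebra_simps)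
  have E_zero: "(\<lambda>_. 0) \<in> E" using A_zero unfolding E_def eigenspace_iff by simp
  have E_sum: "(\<lambda>x. \<Sum>b\<in>B. k b * b x) \<in> E" for k
    using \<open>finite B\<close> BE
  proof (induction B)
    case (insert b B)
    then show ?case using E_lin[of "\<lambda>x. \<Sum>b\<in>B. k b * b x" b "k b"] by (simp add: add.commute)
  qed (simp add: E_zero)
  have "L2_eq M f (\<lambda>x. \<Sum>b\<in>B. L2_inner M b f * b x)" if f: "f \<in> E" for f
  proof -
    define p where "p x = (\<Sum>b\<in>B. L2_inner M b f * b x)" for x
    define g where "g x = f x + (-1) * p x" for x
    have pE: "p \<in> E" unfolding p_def[abs_def] by (rule E_sum)
    have gE: "g \<in> E" unfolding g_def[abs_def] by (rule E_lin[OF f pE])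
    have gL: "g \<in> L2_space M" by (rule EL[OF gE])
    have orth: "L2_inner M b g = 0" if b: "b \<in> B" for b
    proof -
      have "L2_inner M b p = (\<Sum>a\<in>B. L2_inner M a f * L2_inner M b a)"
        unfolding p_def[abs_def] by (rule L2.sum_right) (use BL b in auto)
      also have "\<dots> = (\<Sum>a\<in>B. if b = a then L2_inner M a f else 0)"
        using on[OF b] by (intro sum.cong) auto
      also have "\<dots> = L2_inner M b f" using \<open>finite B\<close> b by simp
      finally show ?thesis
        unfolding g_def[abs_def] using L2.lin_right[OF BL[OF b] EL[OF f] EL[OF pE], of "-1"] by simp
    qed
    have "L2_norm M g = 0"
    proof (rule ccontr)
      assume ne: "L2_norm M g \<noteq> 0"
      define k where "k = complex_of_real (1 / L2_norm M g)"
      define u where "u x = k * g x" for x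
      have uE: "u \<in> E" unfolding u_def[abs_def] using E_lin[OF E_zero gE, of k] by simp
      have uu: "L2_inner M u u = 1"
      proof -
        have "L2_norm M u = 1"
          unfolding u_def[abs_def] L2.nrm_scale[OF gL] k_def norm_of_real
          using ne L2.nrm_nonneg[OF gL] by simp
        then show ?thesis by (simp add: L2_inner_self)
      qed
      have bu: "L2_inner M b u = 0" if "b \<in> B" for b
        unfolding u_def[abs_def] using L2.scale_right[OF BL[OF that] gL] orth[OF that] by simp
      have ub: "L2_inner M u b = 0" if "b \<in> B" for b
        using L2.hermitian[OF BL[OF that] EL[OF uE]] bu[OF that] by simp
      have "u \<notin> B" using bu[of u] uu by auto
      have "insert u B \<in> \<O>"
        unfolding \<O>_def using uE BE uu bu ub on \<open>u \<notin> B\<close> by auto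
      then show False using max[of "insert u B"] \<open>u \<notin> B\<close> by blast
    qed
    then have "L2_eq M g (\<lambda>_. 0)" using L2_norm_eq_0_iff[OF gL] by simp
    then show ?thesis unfolding L2_eq_def g_def p_def by simp
  qed
  then show ?thesis
    unfolding L2_finite_dim_def E_def[symmetric] using \<open>finite B\<close> BL
    by (intro exI[of _ B]) (auto intro!: exI)
qed

section \<open>Points that are not eigenvalues belong to the resolvent set\<close>

lemma bounded_below_if_not_eigenvalue:
  assumes nz: "\<not> is_eigenvalue M A z"
  shows "\<exists>C. \<forall>f h. (f, h) \<in> A \<longrightarrow> L2_norm M f \<le> C * L2_norm M (\<lambda>x. h x - z * f x)"
proof (rule ccontr)
  assume "\<not> ?thesis"
  \<comment> \<open>Taking \<open>C = n + 1\<close> for every \<open>n\<close> and normalising gives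
    unit vectors whose images under \<open>A - z\<close> tend to 0. A subsequence converges to a
    vector of norm 1 that solves the homogeneous equation, an eigenvector.\<close>
  then have "\<exists>f h. (f, h) \<in> A \<and> real (Suc n) * L2_norm M (\<lambda>x. h x - z * f x) < L2_norm M f" for n
    by (meson not_le)
  then obtain F0 H0 where FH0: "\<And>n. (F0 n, H0 n) \<in> A"
    and lt: "\<And>n. real (Suc n) * L2_norm M (\<lambda>x. H0 n x - z * F0 n x) < L2_norm M (F0 n)" by metis
  have F0L: "F0 n \<in> L2_space M" and H0L: "H0 n \<in> L2_space M" for n
    using FH0 A_dom_L2 A_range_L2 by blast+
  have V0L: "(\<lambda>x. H0 n x - z * F0 n x) \<in> L2_space M" for n
    by (intro L2.diff_mem L2.scale_mem F0L H0L)
  have pos: "L2_norm M (F0 n) > 0" for n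
    using lt[of n] L2.nrm_nonneg[OF V0L[of n]] by (meson le_less_trans mult_nonneg_nonneg of_nat_0_le_iff)
  define k where "k n = complex_of_real (1 / L2_norm M (F0 n))" for n
  have kn: "cmod (k n) = 1 / L2_norm M (F0 n)" for n
    unfolding k_def norm_of_real using pos[of n] by simp
  define F where "F n x = k n * F0 n x" for n x
  define H where "H n x = k n * H0 n x" for n x
  have FH: "(F n, H n) \<in> A" for n unfolding F_def[abs_def] H_def[abs_def] by (rule A_scale[OF FH0])
  have F1: "L2_norm M (F n) = 1" for n
    unfolding F_def[abs_def] L2.nrm_scale[OF F0L] kn using pos[of n] by simp
  have small: "L2_norm M (\<lambda>x. H n x - z * F n x) \<le> 1 / real (Suc n)" for n
  proof -
    have "(\<lambda>x. H n x - z * F n x) = (\<lambda>x. k n * (H0 n x - z * F0 n x))"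
      by (simp add: F_def H_def algebra_simps)
    then have "L2_norm M (\<lambda>x. H n x - z * F n x) = L2_norm M (\<lambda>x. H0 n x - z * F0 n x) / L2_norm M (F0 n)"
      using L2.nrm_scale[OF V0L[of n], of "k n"] kn by simp
    also have "\<dots> \<le> 1 / real (Suc n)"
      using lt[of n] pos[of n] by (simp add: field_simps)
    finally show ?thesis .
  qed
  have "L2.converges M (\<lambda>n x. H n x - z * F n x) (\<lambda>_. 0)"
    unfolding L2.converges_def
  proof (rule Lim_null_comparison)
    show "(\<lambda>n. 1 / real (Suc n)) \<longlonglongrightarrow> 0" by (intro LIMSEQ_Suc lim_1_over_n)
    have "(\<lambda>x. H n x - z * F n x) \<in> L2_space M" for n
      using A_dom_L2[OF FH] A_range_L2[OF FH] by (intro L2.diff_mem L2.scale_mem)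
    then have "norm (L2_norm M (\<lambda>x. H n x - z * F n x)) \<le> 1 / real (Suc n)" for n
      using small[of n] L2.nrm_nonneg[of "\<lambda>x. H n x - z * F n x" M] by simp
    then show "\<forall>\<^sub>F n in sequentially. norm (L2_norm M (\<lambda>x. H n x - z * F n x - 0)) \<le> 1 / real (Suc n)"
      by simp
  qed
  then obtain f h r where fh: "(f, h) \<in> A" and eq: "\<forall>x. h x - z * f x = 0" and lim: "L2.converges M (F \<circ> r) f"
    using approximate_solutions_converge[where F = F and H = H and K = 1 and z = z, OF FH _ L2.zero_mem] F1 by auto
  have "h = (\<lambda>x. z * f x)" using eq by auto
  then have fA: "(f, \<lambda>x. z * f x) \<in> A" using fh by simp
  have "(\<lambda>n. L2_norm M ((F \<circ> r) n)) \<longlonglongrightarrow> L2_norm M f"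
    by (rule L2.converges_nrm[OF _ A_dom_L2[OF fh] lim]) (use FH A_dom_L2 in auto)
  then have "L2_norm M f = 1" using F1 by (simp add: comp_def LIMSEQ_const_iff)
  then show False using nz fA is_eigenvalue_iff by blast
qed

text \<open>Nothing places \<open>p\<close> in the domain at first. With the real point
  \<open>z0 = c - 1\<close>, let \<open>w\<close> in the domain solve the equation for
  \<open>A - z0\<close> with right side \<open>(cnj z - z0) * p\<close>, the equation that an
  eigenvector for \<open>cnj z\<close> satisfies. By symmetry \<open>p - w\<close> is orthogonal to
  the range of \<open>A - z0\<close>, which is everything, so \<open>p\<close> equals
  \<open>w\<close> almost everywhere and \<open>w\<close> lies in the eigenspace of
  \<open>cnj z\<close>. As eigenvalues are real, this forces \<open>w\<close> to be null.\<close>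

lemma orthogonal_to_range:
  assumes p: "p \<in> L2_space M" and orth: "\<And>f h. (f, h) \<in> A \<Longrightarrow> L2_inner M p (\<lambda>x. h x - z * f x) = 0"
    and nz: "\<not> is_eigenvalue M A z"
  shows "L2_eq M p (\<lambda>_. 0)"
proof -
  define z0 where "z0 = complex_of_real (c - 1)"
  have cz0: "cnj z0 = z0" by (simp add: z0_def)
  have "(\<lambda>x. (cnj z - z0) * p x) \<in> L2_space M" by (rule L2.scale_mem[OF p])
  from resolvent_at_lower_bound[OF this] obtain w k where wk: "(w, k) \<in> A"
    and eq: "\<And>x. k x - z0 * w x = (cnj z - z0) * p x" unfolding z0_def by blast
  have wL: "w \<in> L2_space M" and kL: "k \<in> L2_space M" using wk A_dom_L2 A_range_L2 by blast+
  have key: "L2_inner M p (\<lambda>x. h x - z0 * f x) = L2_inner M w (\<lambda>x. h x - z0 * f x)" if fh: "(f, h) \<in> A" for f h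
  proof -
    have fL: "f \<in> L2_space M" and hL: "h \<in> L2_space M" using fh A_dom_L2 A_range_L2 by blast+
    have expand: "L2_inner M u (\<lambda>x. h x - y * f x) = L2_inner M u h - y * L2_inner M u f" if "u \<in> L2_space M" for u y
      using L2.diff_right[OF that hL L2.scale_mem[OF fL]] L2.scale_right[OF that fL] by simp
    have "L2_inner M p h = z * L2_inner M p f" using orth[OF fh] expand[OF p] by simp
    then have "L2_inner M p (\<lambda>x. h x - z0 * f x) = (z - z0) * L2_inner M p f"
      using expand[OF p, of z0] by (simp add: algebra_simps)
    also have "\<dots> = L2_inner M (\<lambda>x. (cnj z - z0) * p x) f"
      using L2.scale_left[OF p fL, of "cnj z - z0"] cz0 by simp
    also have "\<dots> = L2_inner M (\<lambda>x. k x - z0 * w x) f" by (simp only: eq)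
    also have "\<dots> = L2_inner M k f - z0 * L2_inner M w f"
      using L2.diff_left[OF kL L2.scale_mem[OF wL] fL] L2.scale_left[OF wL fL] cz0 by simp
    also have "\<dots> = L2_inner M w (\<lambda>x. h x - z0 * f x)"
      using A_symmetric[OF wk fh] expand[OF wL] by simp
    finally show ?thesis .
  qed
  \<comment> \<open>Since \<open>A - z0\<close> is onto, \<open>u\<close> itself can be written as a
    vector of its range and serve as the test vector.\<close>
  define u where "u x = p x - w x" for x
  have uL: "u \<in> L2_space M" unfolding u_def[abs_def] by (intro L2.diff_mem p wL)
  obtain f h where fh: "(f, h) \<in> A" and "\<And>x. h x - z0 * f x = u x"
    using resolvent_at_lower_bound[OF uL] unfolding z0_def by blast
  then have "L2_inner M p u = L2_inner M w u" using key[OF fh] by simp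
  then have "L2_inner M u u = 0" using L2.diff_left[OF p wL uL] by (simp add: u_def[abs_def])
  then have "L2_norm M u = 0" by (simp add: L2_inner_self)
  then have pw: "L2_eq M p w" unfolding u_def[abs_def] using L2_norm_diff_eq_0_iff[OF p wL] by simp
  have "L2_eq M k (\<lambda>x. cnj z * w x)"
    using pw unfolding L2_eq_def
  proof eventually_elim
    case (elim x)
    have "k x = (cnj z - z0) * p x + z0 * w x" using eq[of x] by (simp add: algebra_simps)
    then show ?case using elim by (simp add: algebra_simps)
  qed
  then have "w \<in> eigenspace M A (cnj z)" unfolding eigenspace_def using wk by blast
  moreover have "\<not> is_eigenvalue M A (cnj z)"
  proof
    assume "is_eigenvalue M A (cnj z)"
    moreover from eigenvalue_real(1)[OF this] have "cnj z = z" by (simp add: complex_eq_iff)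
    ultimately show False using nz by simp
  qed
  ultimately have "L2_eq M w (\<lambda>_. 0)" unfolding is_eigenvalue_def by blast
  then show ?thesis using pw unfolding L2_eq_def by eventually_elim simp
qed

text \<open>The lower estimate and \<open>approximate_solutions_converge\<close> make the range
  \<open>R\<close> of \<open>A - z\<close> complete, so \<open>R\<close> is a semi-inner space to
  which Riesz representation applies. Used on the functional of \<open>g\<close>, it yields the
  orthogonal projection of \<open>g\<close> to \<open>R\<close>, and the remainder is null by
  \<open>orthogonal_to_range\<close>.\<close>

lemma resolvent_if_not_eigenvalue:
  assumes nz: "\<not> is_eigenvalue M A z"
  shows "z \<in> resolvent_set M A"
proof -
  obtain C where C: "\<And>f h. (f, h) \<in> A \<Longrightarrow> L2_norm M f \<le> C * L2_norm M (\<lambda>x. h x - z * f x)"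
    using bounded_below_if_not_eigenvalue[OF nz] by blast
  define R where "R = {v. \<exists>f h. (f, h) \<in> A \<and> v = (\<lambda>x. h x - z * f x)}"
  have R_L2: "v \<in> L2_space M" if "v \<in> R" for v
    using that A_dom_L2 A_range_L2 unfolding R_def by (auto intro!: L2.diff_mem L2.scale_mem)
  interpret R: semi_inner R "L2_inner M" rewrites "semi_inner.nrm (L2_inner M) = L2_norm M"
  proof -
    show "semi_inner R (L2_inner M)"
    proof
      show "(\<lambda>_. 0) \<in> R" unfolding R_def using A_zero by force
      show "(\<lambda>x. f x + k * g x) \<in> R" if fg: "f \<in> R" "g \<in> R" for f g k
      proof -
        obtain a b a' b' where ab: "(a, b) \<in> A" "f = (\<lambda>x. b x - z * a x)" "(a', b') \<in> A" "g = (\<lambda>x. b' x - z * a' x)"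
          using fg unfolding R_def by blast
        have "(\<lambda>x. f x + k * g x) = (\<lambda>x. (b x + k * b' x) - z * (a x + k * a' x))"
          unfolding ab by (simp add: algebra_simps)
        then show ?thesis unfolding R_def using A_lin[OF ab(1,3), of k] by blast
      qed
      show "L2_inner M f (\<lambda>x. g x + k * h x) = L2_inner M f g + k * L2_inner M f h" if "f \<in> R" "g \<in> R" "h \<in> R" for f g h k
        using that R_L2 by (intro L2.lin_right)
      show "L2_inner M g f = cnj (L2_inner M f g)" if "f \<in> R" "g \<in> R" for f g
        using that R_L2 by (intro L2.hermitian)
      show "0 \<le> Re (L2_inner M f f)" if "f \<in> R" for f
        using that R_L2 by (intro L2.nonneg)
    qed
  qed (rule L2_norm_nrm)
  have "R.is_complete"
    unfolding R.is_complete_def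
  proof (intro allI impI)
    fix G :: "nat \<Rightarrow> 'a \<Rightarrow> complex"
    assume G: "\<forall>n. G n \<in> R" and cau: "L2.cauchy M G"
    then have GL: "G n \<in> L2_space M" for n using R_L2 by blast
    have "\<exists>f h. (f, h) \<in> A \<and> G n = (\<lambda>x. h x - z * f x)" for n using G unfolding R_def by blast
    then obtain F H where FH: "\<And>n. (F n, H n) \<in> A" and Geq: "\<And>n. G n = (\<lambda>x. H n x - z * F n x)" by metis
    obtain v where v: "v \<in> L2_space M" and lim: "L2.converges M G v"
      using L2_complete[of M] cau GL unfolding L2.is_complete_def by blast
    obtain K where K: "\<And>n. L2_norm M (G n) \<le> K" using L2.cauchy_bounded[OF GL cau] by blast
    have "L2_norm M (F n) \<le> \<bar>C\<bar> * K" for n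
    proof -
      have "L2_norm M (F n) \<le> C * L2_norm M (G n)" using C[OF FH] by (simp add: Geq)
      also have "\<dots> \<le> \<bar>C\<bar> * L2_norm M (G n)" by (intro mult_right_mono L2.nrm_nonneg GL) simp
      also have "\<dots> \<le> \<bar>C\<bar> * K" by (intro mult_left_mono K) simp
      finally show ?thesis .
    qed
    moreover have "L2.converges M (\<lambda>n x. H n x - z * F n x) v"
      using lim Geq by (metis (no_types, lifting) ext)
    ultimately obtain f h where "(f, h) \<in> A" "\<forall>x. h x - z * f x = v x"
      using approximate_solutions_converge[where F = F and H = H and K = "\<bar>C\<bar> * K" and z = z, OF FH _ v] by blast
    then have "v \<in> R" unfolding R_def by (intro CollectI exI[of _ f] exI[of _ h]) (simp add: fun_eq_iff)
    then show "\<exists>f\<in>R. L2.converges M G f" using lim by blast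
  qed
  have "\<exists>(f, h)\<in>A. L2_eq M (\<lambda>x. h x - z * f x) g" if g: "g \<in> L2_space M" for g
  proof -
    have "\<exists>v\<in>R. \<forall>h\<in>R. L2_inner M v h = L2_inner M g h"
    proof (rule R.Riesz_representation[OF \<open>R.is_complete\<close>])
      show "L2_inner M g (\<lambda>x. u x + k * v x) = L2_inner M g u + k * L2_inner M g v" if "u \<in> R" "v \<in> R" for u v k
        using g that R_L2 by (intro L2.lin_right)
      show "cmod (L2_inner M g u) \<le> L2_norm M g * L2_norm M u" if "u \<in> R" for u
        using g that R_L2 by (intro L2.Cauchy_Schwarz)
    qed
    then obtain v where v: "v \<in> R" and veq: "\<And>h. h \<in> R \<Longrightarrow> L2_inner M v h = L2_inner M g h" by blast
    define p where "p x = g x - v x" for x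
    have pL: "p \<in> L2_space M" unfolding p_def[abs_def] by (intro L2.diff_mem g R_L2 v)
    have "L2_eq M p (\<lambda>_. 0)"
    proof (rule orthogonal_to_range[OF pL _ nz])
      fix f h assume "(f, h) \<in> A"
      then have "(\<lambda>x. h x - z * f x) \<in> R" unfolding R_def by blast
      then show "L2_inner M p (\<lambda>x. h x - z * f x) = 0"
        unfolding p_def[abs_def] using veq L2.diff_left[OF g R_L2[OF v] R_L2] by simp
    qed
    then have "L2_eq M v g" unfolding L2_eq_def p_def by eventually_elim simp
    moreover obtain f h where "(f, h) \<in> A" "v = (\<lambda>x. h x - z * f x)" using v unfolding R_def by blast
    ultimately show ?thesis by blast
  qed
  then show ?thesis unfolding resolvent_set_def using C by blast
qed

theorem discrete_spectrum:
  "purely_discrete_spectrum M A \<and> spectrum_bounded_below M A"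
proof
  have sp: "is_eigenvalue M A z" if "z \<in> op_spectrum M A" for z
    using that resolvent_if_not_eigenvalue unfolding op_spectrum_def by blast
  have "\<not> z islimpt op_spectrum M A" for z
  proof
    assume "z islimpt op_spectrum M A"
    \<comment> \<open>A limit point would put infinitely many points of the spectrum, all of them
      eigenvalues, into a bounded set.\<close>
    then have "infinite (op_spectrum M A \<inter> ball z 1)"
      by (simp add: islimpt_eq_infinite_ball)
    moreover have "op_spectrum M A \<inter> ball z 1 \<subseteq> {w. is_eigenvalue M A w \<and> cmod w \<le> cmod z + 1}"
    proof (intro subsetI CollectI conjI)
      fix w assume w: "w \<in> op_spectrum M A \<inter> ball z 1"
      then show "is_eigenvalue M A w" using sp by blast
      have "cmod (w - z) < 1" using w by (simp add: dist_norm norm_minus_commute)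
      then show "cmod w \<le> cmod z + 1" using norm_triangle_sub[of w z] by linarith
    qed
    ultimately show False using finitely_many_eigenvalues finite_subset by blast
  qed
  then show "purely_discrete_spectrum M A"
    unfolding purely_discrete_spectrum_def using sp eigenspace_finite_dim by blast
  have "z \<in> complex_of_real ` {c..}" if "z \<in> op_spectrum M A" for z
    using eigenvalue_real[OF sp[OF that]] by (intro image_eqI[of _ _ "Re z"]) (auto simp: complex_eq_iff)
  then show "spectrum_bounded_below M A" unfolding spectrum_bounded_below_def by blast
qed

end

section \<open>Fourier transforms of functions with bounded support\<close>

definition L2_on :: "real \<Rightarrow> (real \<Rightarrow> complex) set" where
  "L2_on L = {g \<in> L2_space lborel. \<forall>x. L < \<bar>x\<bar> \<longrightarrow> g x = 0}"

lemma L2_onD: "g \<in> L2_on L \<Longrightarrow> g \<in> L2_space lborel" "g \<in> L2_on L \<Longrightarrow> L < \<bar>x\<bar> \<Longrightarrow> g x = 0"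
  by (auto simp: L2_on_def)

lemma L2_on_measurable: "g \<in> L2_on L \<Longrightarrow> g \<in> borel_measurable borel"
  using L2_space_measurable[OF L2_onD(1)] by simp

lemma integrable_indicator_Icc: "integrable lborel (indicator {a..b::real} :: real \<Rightarrow> real)"
  by (intro integrable_real_indicator) (auto simp: emeasure_lborel_Icc_eq)

text \<open>Cauchy-Schwarz against the indicator of [-L, L], whose norm is
  \<open>sqrt (2 * L)\<close>.\<close>

lemma L2_on_integrable:
  assumes g: "g \<in> L2_on L" and L: "0 \<le> L"
  shows "integrable lborel g" "(LINT x|lborel. cmod (g x)) \<le> sqrt (2 * L) * L2_norm lborel g"
proof -
  note [measurable] = L2_on_measurable[OF g]
  define u :: "real \<Rightarrow> complex" where "u x = complex_of_real (indicator {-L..L} x)" for x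
  define v :: "real \<Rightarrow> complex" where "v x = complex_of_real (cmod (g x))" for x
  have u2: "(\<lambda>x. (cmod (u x))\<^sup>2) = indicator {-L..L}"
    by (auto simp: u_def indicator_def)
  have u: "u \<in> L2_space lborel"
    unfolding L2_space_def mem_Collect_eq u2
    by (auto simp: u_def[abs_def] intro!: integrable_indicator_Icc)
  have v2: "(\<lambda>x. (cmod (v x))\<^sup>2) = (\<lambda>x. (cmod (g x))\<^sup>2)" by (simp add: v_def)
  have v: "v \<in> L2_space lborel"
    unfolding L2_space_def mem_Collect_eq v2 using L2_space_integrable[OF L2_onD(1)[OF g]] by (simp add: v_def[abs_def])
  have uv: "(\<lambda>x. cnj (u x) * v x) = (\<lambda>x. complex_of_real (cmod (g x)))"
  proof
    fix x
    show "cnj (u x) * v x = complex_of_real (cmod (g x))"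
      using L2_onD(2)[OF g, of x] by (cases "x \<in> {-L..L}") (auto simp: u_def v_def)
  qed
  have "integrable lborel (\<lambda>x. complex_of_real (cmod (g x)))"
    using L2_inner_integrable[OF u v] unfolding uv .
  from integrable_norm[OF this] have i: "integrable lborel (\<lambda>x. cmod (g x))" by simp
  then show "integrable lborel g" using integrable_norm_iff[of g lborel] by simp
  have "L2_norm lborel u = sqrt (2 * L)" unfolding L2_norm_def u2 using L by simp
  moreover have "L2_norm lborel v = L2_norm lborel g" unfolding L2_norm_def v2 ..
  moreover have "L2_inner lborel u v = complex_of_real (LINT x|lborel. cmod (g x))"
    unfolding L2_inner_def uv by simp
  ultimately show "(LINT x|lborel. cmod (g x)) \<le> sqrt (2 * L) * L2_norm lborel g"
    using L2.Cauchy_Schwarz[OF u v] by simp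
qed

definition ft :: "(real \<Rightarrow> complex) \<Rightarrow> complex \<Rightarrow> complex" where
  "ft g s = (LINT x|lborel. g x * exp (- (\<i> * s * complex_of_real x)))"

lemma ft_integrand_bound:
  assumes g: "g \<in> L2_on L" and L: "0 \<le> L"
  shows "cmod (g x * exp (- (\<i> * s * complex_of_real x))) \<le> exp (\<bar>Im s\<bar> * L) * cmod (g x)"
proof (cases "\<bar>x\<bar> \<le> L")
  case True
  have "Im s * x \<le> \<bar>Im s\<bar> * \<bar>x\<bar>" by (metis abs_ge_self abs_mult)
  also have "\<dots> \<le> \<bar>Im s\<bar> * L" using True by (intro mult_left_mono) auto
  finally have "cmod (exp (- (\<i> * s * complex_of_real x))) \<le> exp (\<bar>Im s\<bar> * L)" by simp
  then show ?thesis by (simp add: norm_mult mult.commute mult_left_mono del: norm_exp_eq_Re)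
next
  case False
  then show ?thesis using L2_onD(2)[OF g, of x] by simp
qed

lemma ft_integrable:
  assumes g: "g \<in> L2_on L" and L: "0 \<le> L"
  shows "integrable lborel (\<lambda>x. g x * exp (- (\<i> * s * complex_of_real x)))"
proof (rule Bochner_Integration.integrable_bound)
  note [measurable] = L2_on_measurable[OF g]
  show "integrable lborel (\<lambda>x. exp (\<bar>Im s\<bar> * L) * cmod (g x))"
    using L2_on_integrable(1)[OF g L] by simp
  show "(\<lambda>x. g x * exp (- (\<i> * s * complex_of_real x))) \<in> borel_measurable lborel" by measurable
  show "AE x in lborel. norm (g x * exp (- (\<i> * s * complex_of_real x))) \<le> norm (exp (\<bar>Im s\<bar> * L) * cmod (g x))"
  proof (rule AE_I2)
    fix x
    show "norm (g x * exp (- (\<i> * s * complex_of_real x))) \<le> norm (exp (\<bar>Im s\<bar> * L) * cmod (g x))"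
      using ft_integrand_bound[OF g L, of x s] by simp
  qed
qed

lemma ft_bound:
  assumes g: "g \<in> L2_on L" and L: "0 \<le> L"
  shows "cmod (ft g s) \<le> exp (\<bar>Im s\<bar> * L) * (sqrt (2 * L) * L2_norm lborel g)"
proof -
  have "cmod (ft g s) \<le> (LINT x|lborel. exp (\<bar>Im s\<bar> * L) * cmod (g x))"
    unfolding ft_def
    using L2_on_integrable(1)[OF g L] ft_integrable[OF g L] ft_integrand_bound[OF g L]
    by (intro Bochner_Integration.integral_norm_bound_integral) auto
  also have "\<dots> = exp (\<bar>Im s\<bar> * L) * (LINT x|lborel. cmod (g x))" by simp
  also have "\<dots> \<le> exp (\<bar>Im s\<bar> * L) * (sqrt (2 * L) * L2_norm lborel g)"
    by (intro mult_left_mono L2_on_integrable(2)[OF g L]) simp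
  finally show ?thesis .
qed

lemma ft_lin:
  assumes "f \<in> L2_on L" "g \<in> L2_on L" "0 \<le> L"
  shows "ft (\<lambda>x. f x + c * g x) s = ft f s + c * ft g s"
proof -
  have "(\<lambda>x. (f x + c * g x) * exp (- (\<i> * s * complex_of_real x)))
      = (\<lambda>x. f x * exp (- (\<i> * s * complex_of_real x)) + c * (g x * exp (- (\<i> * s * complex_of_real x))))"
    by (simp add: algebra_simps)
  then show ?thesis
    using ft_integrable[OF assms(1,3), of s] ft_integrable[OF assms(2,3), of s] by (simp add: ft_def)
qed

lemma iexp_diff_le: "cmod (exp (- (\<i> * complex_of_real s * complex_of_real x)) - exp (- (\<i> * complex_of_real t * complex_of_real x))) \<le> \<bar>s - t\<bar> * \<bar>x\<bar>"
proof -
  have "exp (- (\<i> * complex_of_real s * complex_of_real x)) - exp (- (\<i> * complex_of_real t * complex_of_real x))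
     = exp (- (\<i> * complex_of_real t * complex_of_real x)) * (iexp ((t - s) * x) - 1)"
    by (simp add: algebra_simps flip: exp_add)
  then have "cmod (exp (- (\<i> * complex_of_real s * complex_of_real x)) - exp (- (\<i> * complex_of_real t * complex_of_real x)))
     = cmod (iexp ((t - s) * x) - 1)"
    by (simp add: norm_mult)
  also have "\<dots> \<le> \<bar>(t - s) * x\<bar>"
    using iexp_approx1[of "(t - s) * x" 0] by simp
  finally show ?thesis by (simp add: abs_mult abs_minus_commute)
qed

text \<open>Varying the frequency brings out a factor \<open>x\<close>, bounded by \<open>L\<close>
  on the support; hence the Lipschitz constant is uniform over norm-bounded sets of
  \<open>L2_on L\<close>.\<close>

lemma ft_lipschitz:
  assumes g: "g \<in> L2_on L" and L: "0 \<le> L"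
  shows "cmod (ft g (complex_of_real s) - ft g (complex_of_real t)) \<le> \<bar>s - t\<bar> * (L * (sqrt (2 * L) * L2_norm lborel g))"
proof -
  let ?e = "\<lambda>s x. exp (- (\<i> * complex_of_real s * complex_of_real x))"
  have "ft g (complex_of_real s) - ft g (complex_of_real t) = (LINT x|lborel. g x * ?e s x - g x * ?e t x)"
    unfolding ft_def using ft_integrable[OF g L] by (intro Bochner_Integration.integral_diff[symmetric])
  also have "cmod \<dots> \<le> (LINT x|lborel. \<bar>s - t\<bar> * L * cmod (g x))"
  proof (rule Bochner_Integration.integral_norm_bound_integral)
    show "integrable lborel (\<lambda>x. g x * ?e s x - g x * ?e t x)"
      using ft_integrable[OF g L] by (intro Bochner_Integration.integrable_diff)
    show "integrable lborel (\<lambda>x. \<bar>s - t\<bar> * L * cmod (g x))"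
      using L2_on_integrable(1)[OF g L] by simp
    fix x
    show "norm (g x * ?e s x - g x * ?e t x) \<le> \<bar>s - t\<bar> * L * cmod (g x)"
    proof (cases "\<bar>x\<bar> \<le> L")
      case True
      have "norm (g x * ?e s x - g x * ?e t x) = cmod (g x) * cmod (?e s x - ?e t x)"
        by (simp only: right_diff_distrib[symmetric] norm_mult)
      also have "\<dots> \<le> cmod (g x) * (\<bar>s - t\<bar> * \<bar>x\<bar>)" by (intro mult_left_mono iexp_diff_le) simp
      also have "\<dots> \<le> cmod (g x) * (\<bar>s - t\<bar> * L)" using True by (intro mult_left_mono) auto
      finally show ?thesis by (simp add: mult_ac)
    next
      case False
      then show ?thesis using L2_onD(2)[OF g, of x] by simp
    qed
  qed
  also have "\<dots> = \<bar>s - t\<bar> * L * (LINT x|lborel. cmod (g x))" by simp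
  also have "\<dots> \<le> \<bar>s - t\<bar> * L * (sqrt (2 * L) * L2_norm lborel g)"
    using L by (intro mult_left_mono L2_on_integrable(2)[OF g L]) simp
  finally show ?thesis by (simp add: mult_ac)
qed

lemma ft_continuous:
  assumes g: "g \<in> L2_on L" and L: "0 \<le> L"
  shows "continuous_on UNIV (\<lambda>t. ft g (complex_of_real t))"
proof -
  define C where "C = L * (sqrt (2 * L) * L2_norm lborel g)"
  have "0 \<le> C" using L L2.nrm_nonneg[OF L2_onD(1)[OF g]] by (simp add: C_def)
  then have "C-lipschitz_on UNIV (\<lambda>t. ft g (complex_of_real t))"
    using ft_lipschitz[OF g L] by (intro lipschitz_onI) (auto simp: dist_norm C_def mult_ac)
  then show ?thesis by (rule lipschitz_on_continuous_on)
qed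

lemma ft_measurable:
  assumes g: "g \<in> L2_on L" and L: "0 \<le> L"
  shows "(\<lambda>t. ft g (complex_of_real t)) \<in> borel_measurable borel"
  using ft_continuous[OF g L] by (rule borel_measurable_continuous_onI)

section \<open>Approximation by continuous functions and continuity of translations\<close>

lemma L2_approx_bounded_support:
  fixes u :: "real \<Rightarrow> complex"
  assumes u[measurable]: "u \<in> borel_measurable borel" and bd: "\<And>x. cmod (u x) \<le> N" and supp: "\<And>x. L < \<bar>x\<bar> \<Longrightarrow> u x = 0"
    and e: "e > 0"
  shows "\<exists>p. continuous_on UNIV p \<and> (\<forall>x. cmod (p x) \<le> N) \<and> p \<in> L2_space lborel \<and> L2_norm lborel (\<lambda>x. u x - p x) < e"
proof -
  have N: "0 \<le> N" using bd[of 0] norm_ge_zero order_trans by blast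
  have "u \<in> borel_measurable lebesgue" by (rule measurable_completion) simp
  then have "u measurable_on UNIV" by (rule lebesgue_measurable_imp_measurable_on) simp
  \<comment> \<open>A Lebesgue measurable function is a limit of continuous ones off a null set.
    These carry no bounds, so dominated convergence is not yet available.\<close>
  then obtain Z p0 where Z: "negligible Z" and p0: "\<And>n::nat. continuous_on UNIV (p0 n)"
    and lim0: "\<And>x. x \<notin> Z \<Longrightarrow> (\<lambda>n. p0 n x) \<longlonglongrightarrow> u x"
    unfolding measurable_on_def by auto
  define cut :: "real \<Rightarrow> real" where "cut x = max 0 (min 1 (L + 1 - \<bar>x\<bar>))" for x
  have cut: "0 \<le> cut x" "cut x \<le> 1" "\<bar>x\<bar> \<le> L \<Longrightarrow> cut x = 1" "L + 1 < \<bar>x\<bar> \<Longrightarrow> cut x = 0" for x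
    by (auto simp: cut_def)
  \<comment> \<open>Projection to the ball of radius \<open>N\<close> caps the values and
    \<open>cut\<close> the support, both continuously. Neither alters the limit, since
    \<open>u\<close> is bounded by \<open>N\<close> and vanishes outside the interval where
    \<open>cut\<close> is 1.\<close>
  define p where "p n x = complex_of_real (cut x) * closest_point (cball 0 N) (p0 n x)" for n x
  have cpN: "cmod (closest_point (cball 0 N) y) \<le> N" for y :: complex
    using closest_point_in_set[of "cball 0 N" y] N by (simp add: dist_norm)
  have cp_cont: "continuous_on UNIV (closest_point (cball 0 N :: complex set))"
    using N by (intro continuous_on_closest_point) auto
  have cont: "continuous_on UNIV (p n)" for n
    unfolding p_def[abs_def] cut_def
    by (intro continuous_intros continuous_on_compose2[OF cp_cont p0]) auto
  have [measurable]: "p n \<in> borel_measurable borel" for n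
    using cont by (rule borel_measurable_continuous_onI)
  have pN: "cmod (p n x) \<le> N * cut x" for n x
    unfolding p_def norm_mult norm_of_real using mult_left_mono[OF cpN[of "p0 n x"] cut(1)[of x]] cut(1)[of x]
    by (simp add: mult.commute)
  have pN1: "cmod (p n x) \<le> N" for n x
    using pN[of n x] cut(2)[of x] N mult_left_le[of "cut x" N] by linarith
  have pN2: "cmod (p n x) \<le> N * indicator {-L-1..L+1} x" for n x
  proof (cases "x \<in> {-L-1..L+1}")
    case True then show ?thesis using pN1 by simp
  next
    case False
    then have "L + 1 < \<bar>x\<bar>" by auto
    then show ?thesis using pN[of n x] cut(4)[of x] False by simp
  qed
  have uN2: "cmod (u x) \<le> N * indicator {-L-1..L+1} x" for x
  proof (cases "x \<in> {-L-1..L+1}")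
    case True then show ?thesis using bd by simp
  next
    case False
    then have "L < \<bar>x\<bar>" by auto
    then show ?thesis using supp[of x] N by simp
  qed
  have diff: "(cmod (u x - p n x))\<^sup>2 \<le> (2 * N)\<^sup>2 * indicator {-L-1..L+1} x" for n x
  proof -
    have "cmod (u x - p n x) \<le> 2 * N * indicator {-L-1..L+1} x"
      using norm_triangle_ineq4[of "u x" "p n x"] uN2[of x] pN2[of n x] by linarith
    then have "(cmod (u x - p n x))\<^sup>2 \<le> (2 * N * indicator {-L-1..L+1} x)\<^sup>2"
      by (intro power_mono) auto
    then show ?thesis by (cases "x \<in> {-L-1..L+1}") simp_all
  qed
  have pL: "p n \<in> L2_space lborel" for n
    unfolding L2_space_def
  proof safe
    show "p n \<in> borel_measurable lborel" by simp
    show "integrable lborel (\<lambda>x. (cmod (p n x))\<^sup>2)"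
    proof (rule Bochner_Integration.integrable_bound)
      show "integrable lborel (\<lambda>x. N\<^sup>2 * indicator {-L-1..L+1} x)"
      by (intro integrable_mult_right integrable_indicator_Icc)
      show "AE x in lborel. norm ((cmod (p n x))\<^sup>2) \<le> norm (N\<^sup>2 * indicator {-L-1..L+1} x)"
      proof (rule AE_I2)
        fix x
        have "(cmod (p n x))\<^sup>2 \<le> (N * indicator {-L-1..L+1} x)\<^sup>2" using pN2 by (intro power_mono) auto
        then show "norm ((cmod (p n x))\<^sup>2) \<le> norm (N\<^sup>2 * indicator {-L-1..L+1} x)"
          by (cases "x \<in> {-L-1..L+1}") simp_all
      qed
    qed measurable
  qed
  have "AE x in lebesgue. x \<notin> Z"
    using Z by (auto simp: negligible_iff_null_sets intro: AE_not_in)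
  then have "AE x in lborel. x \<notin> Z" by (simp add: AE_completion_iff)
  then have ae: "AE x in lborel. (\<lambda>n. (cmod (u x - p n x))\<^sup>2) \<longlonglongrightarrow> 0"
  proof eventually_elim
    case (elim x)
    have "(\<lambda>n. closest_point (cball 0 N) (p0 n x)) \<longlonglongrightarrow> closest_point (cball 0 N) (u x)"
      by (rule continuous_on_tendsto_compose[OF cp_cont lim0[OF elim]]) auto
    moreover have "closest_point (cball 0 N) (u x) = u x"
      using bd[of x] by (intro closest_point_self) (simp add: dist_norm)
    ultimately have "(\<lambda>n. p n x) \<longlonglongrightarrow> complex_of_real (cut x) * u x"
      unfolding p_def by (intro tendsto_intros) simp
    moreover have "complex_of_real (cut x) * u x = u x"
      using cut(3)[of x] supp[of x] by (cases "\<bar>x\<bar> \<le> L") auto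
    ultimately have "(\<lambda>n. (cmod (u x - p n x))\<^sup>2) \<longlonglongrightarrow> (cmod (u x - u x))\<^sup>2"
      by (intro tendsto_intros) simp
    then show ?case by simp
  qed
  have "(\<lambda>n. LINT x|lborel. (cmod (u x - p n x))\<^sup>2) \<longlonglongrightarrow> integral\<^sup>L lborel (\<lambda>x::real. 0::real)"
  proof (rule Bochner_Integration.integral_dominated_convergence[where f = "\<lambda>x. 0"
      and s = "\<lambda>n x. (cmod (u x - p n x))\<^sup>2" and w = "\<lambda>x. (2 * N)\<^sup>2 * indicator {-L-1..L+1} x"])
    show "integrable lborel (\<lambda>x. (2 * N)\<^sup>2 * indicator {-L-1..L+1} x)"
      by (intro integrable_mult_right integrable_indicator_Icc)
    show "AE x in lborel. norm ((cmod (u x - p n x))\<^sup>2) \<le> (2 * N)\<^sup>2 * indicator {-L-1..L+1} x" for n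
      using diff by simp
  qed (use ae in simp_all)
  then have "(\<lambda>n. sqrt (LINT x|lborel. (cmod (u x - p n x))\<^sup>2)) \<longlonglongrightarrow> sqrt 0"
    by (intro tendsto_real_sqrt) simp
  then have "(\<lambda>n. L2_norm lborel (\<lambda>x. u x - p n x)) \<longlonglongrightarrow> 0" by (simp add: L2_norm_def)
  then have "\<forall>\<^sub>F n in sequentially. L2_norm lborel (\<lambda>x. u x - p n x) < e" using e by (rule order_tendstoD)
  then obtain n where "L2_norm lborel (\<lambda>x. u x - p n x) < e"
    by (auto simp: eventually_sequentially)
  then show ?thesis using cont pN1 pL by (intro exI[of _ "p n"]) blast
qed

text \<open>Setting \<open>g\<close> to zero where its modulus exceeds \<open>n\<close> costs an L2
  error tending to 0 and reduces to the bounded case.\<close>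

lemma L2_on_approx:
  assumes g: "g \<in> L2_on L" and e: "e > 0"
  shows "\<exists>p N. continuous_on UNIV p \<and> (\<forall>x. cmod (p x) \<le> N) \<and> p \<in> L2_space lborel \<and> L2_norm lborel (\<lambda>x. g x - p x) < e"
proof -
  note [measurable] = L2_on_measurable[OF g]
  define u where "u n x = (if cmod (g x) \<le> real n then g x else 0)" for n x
  have [measurable]: "u n \<in> borel_measurable borel" for n unfolding u_def[abs_def] by measurable
  have "(\<lambda>n. LINT x|lborel. (cmod (g x - u n x))\<^sup>2) \<longlonglongrightarrow> integral\<^sup>L lborel (\<lambda>x::real. 0::real)"
  proof (rule Bochner_Integration.integral_dominated_convergence[where f = "\<lambda>x. 0"
      and s = "\<lambda>n x. (cmod (g x - u n x))\<^sup>2" and w = "\<lambda>x. (cmod (g x))\<^sup>2"])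
    show "integrable lborel (\<lambda>x. (cmod (g x))\<^sup>2)" by (rule L2_space_integrable[OF L2_onD(1)[OF g]])
    show "AE x in lborel. norm ((cmod (g x - u n x))\<^sup>2) \<le> (cmod (g x))\<^sup>2" for n by (simp add: u_def)
    show "AE x in lborel. (\<lambda>n. (cmod (g x - u n x))\<^sup>2) \<longlonglongrightarrow> 0"
    proof (rule AE_I2)
      fix x
      obtain m where m: "cmod (g x) \<le> real m" using real_arch_simple by blast
      have "\<forall>\<^sub>F n in sequentially. (cmod (g x - u n x))\<^sup>2 = 0"
        using eventually_ge_at_top[of m] by eventually_elim (use m in \<open>simp add: u_def\<close>)
      then show "(\<lambda>n. (cmod (g x - u n x))\<^sup>2) \<longlonglongrightarrow> 0" by (rule tendsto_eventually)
    qed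
  qed simp_all
  then have "(\<lambda>n. sqrt (LINT x|lborel. (cmod (g x - u n x))\<^sup>2)) \<longlonglongrightarrow> sqrt 0"
    by (intro tendsto_real_sqrt) simp
  then have "(\<lambda>n. L2_norm lborel (\<lambda>x. g x - u n x)) \<longlonglongrightarrow> 0" by (simp add: L2_norm_def)
  then have "\<forall>\<^sub>F n in sequentially. L2_norm lborel (\<lambda>x. g x - u n x) < e / 2" using e by (intro order_tendstoD(2)[where y=0]) auto
  then obtain n where n: "L2_norm lborel (\<lambda>x. g x - u n x) < e / 2"
    by (auto simp: eventually_sequentially)
  have "\<exists>p. continuous_on UNIV p \<and> (\<forall>x. cmod (p x) \<le> real n) \<and> p \<in> L2_space lborel \<and> L2_norm lborel (\<lambda>x. u n x - p x) < e / 2"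
    using e L2_onD(2)[OF g] by (intro L2_approx_bounded_support[where L=L]) (auto simp: u_def[abs_def])
  then obtain p where p: "continuous_on UNIV p" "\<forall>x. cmod (p x) \<le> real n" "p \<in> L2_space lborel" "L2_norm lborel (\<lambda>x. u n x - p x) < e / 2"
    by blast
  have "(cmod (u n x))\<^sup>2 \<le> (cmod (g x))\<^sup>2" for x by (simp add: u_def)
  then have uL: "u n \<in> L2_space lborel"
    unfolding L2_space_def using L2_space_integrable[OF L2_onD(1)[OF g]]
    by (auto intro!: Bochner_Integration.integrable_bound[where f="\<lambda>x. (cmod (g x))\<^sup>2"])
  have "L2_norm lborel (\<lambda>x. g x - p x) < e"
    using L2.nrm_triangle_diff[OF L2_onD(1)[OF g] uL p(3)] n p(4) by linarith
  then show ?thesis using p by blast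
qed

lemma L2_translate:
  fixes h :: real
  assumes g: "g \<in> L2_space lborel"
  shows "(\<lambda>x. g (x + h)) \<in> L2_space lborel" "L2_norm lborel (\<lambda>x. g (x + h)) = L2_norm lborel g"
proof -
  have [measurable]: "g \<in> borel_measurable borel" using L2_space_measurable[OF g] by simp
  have eq: "(\<lambda>x. (cmod (g (x + h)))\<^sup>2) = (\<lambda>x. (cmod (g (h + 1 * x)))\<^sup>2)" by (simp add: add.commute)
  show "(\<lambda>x. g (x + h)) \<in> L2_space lborel"
    unfolding L2_space_def mem_Collect_eq eq
    using lborel_integrable_real_affine[OF L2_space_integrable[OF g], of 1 h] by simp
  show "L2_norm lborel (\<lambda>x. g (x + h)) = L2_norm lborel g"
    unfolding L2_norm_def eq
    using lborel_integral_real_affine[of 1 "\<lambda>x. (cmod (g x))\<^sup>2" h] by simp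
qed

text \<open>For a bounded continuous \<open>p\<close> the translates converge under the integral by
  domination, \<open>g\<close> being integrable. Replacing \<open>g\<close> by \<open>p\<close> in
  the translated factor costs equally little at every shift, as translation preserves the
  norm.\<close>

lemma autocorrelation_tendsto:
  assumes g: "g \<in> L2_on L" and L: "0 \<le> L" and h: "(h :: nat \<Rightarrow> real) \<longlonglongrightarrow> 0"
  shows "(\<lambda>n. L2_inner lborel g (\<lambda>x. g (x + h n))) \<longlonglongrightarrow> L2_inner lborel g g"
proof (rule LIMSEQ_I)
  fix e :: real assume e: "e > 0"
  note gL = L2_onD(1)[OF g]
  note [measurable] = L2_on_measurable[OF g]
  \<comment> \<open>Two errors of at most the norm of \<open>g\<close> times \<open>d\<close>, hence
    \<open>e / 4\<close>, and a third below \<open>e / 4\<close> stay below \<open>e\<close>. The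
    \<open>+ 1\<close> covers \<open>g\<close> of norm 0.\<close>
  define d where "d = e / (4 * (L2_norm lborel g + 1))"
  have gn: "0 \<le> L2_norm lborel g" by (rule L2.nrm_nonneg[OF gL])
  have d: "d > 0" "L2_norm lborel g * d \<le> e / 4" using e gn by (auto simp: d_def field_simps)
  obtain p N where p: "continuous_on UNIV p" "\<And>x. cmod (p x) \<le> N" and pL: "p \<in> L2_space lborel"
    and pd: "L2_norm lborel (\<lambda>x. g x - p x) < d"
    using L2_on_approx[OF g d(1)] by blast
  have [measurable]: "p \<in> borel_measurable borel" using p(1) by (rule borel_measurable_continuous_onI)
  have "(\<lambda>n. LINT x|lborel. cnj (g x) * (p (x + h n) - p x)) \<longlonglongrightarrow> integral\<^sup>L lborel (\<lambda>x::real. 0::complex)"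
  proof (rule Bochner_Integration.integral_dominated_convergence[where w = "\<lambda>x. 2 * N * cmod (g x)"])
    show "integrable lborel (\<lambda>x. 2 * N * cmod (g x))" using L2_on_integrable(1)[OF g L] by simp
    show "AE x in lborel. (\<lambda>n. cnj (g x) * (p (x + h n) - p x)) \<longlonglongrightarrow> 0"
    proof (rule AE_I2)
      fix x
      have "(\<lambda>n. x + h n) \<longlonglongrightarrow> x + 0" by (intro tendsto_intros h)
      then have "(\<lambda>n. p (x + h n)) \<longlonglongrightarrow> p x"
        using continuous_on_tendsto_compose[OF p(1), of "\<lambda>n. x + h n" x sequentially] by simp
      then have "(\<lambda>n. cnj (g x) * (p (x + h n) - p x)) \<longlonglongrightarrow> cnj (g x) * (p x - p x)"
        by (intro tendsto_intros)
      then show "(\<lambda>n. cnj (g x) * (p (x + h n) - p x)) \<longlonglongrightarrow> 0" by simp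
    qed
    show "AE x in lborel. norm (cnj (g x) * (p (x + h n) - p x)) \<le> 2 * N * cmod (g x)" for n
    proof (rule AE_I2)
      fix x
      have "cmod (p (x + h n) - p x) \<le> 2 * N"
        using norm_triangle_ineq4[of "p (x + h n)" "p x"] p(2)[of "x + h n"] p(2)[of x] by linarith
      from mult_left_mono[OF this, of "cmod (g x)"]
      show "norm (cnj (g x) * (p (x + h n) - p x)) \<le> 2 * N * cmod (g x)"
        by (simp add: norm_mult mult_ac)
    qed
  qed measurable
  then have "(\<lambda>n. LINT x|lborel. cnj (g x) * (p (x + h n) - p x)) \<longlonglongrightarrow> 0" by simp
  from LIMSEQ_D[OF this, of "e / 4"] e obtain n0
    where n0: "\<And>n. n \<ge> n0 \<Longrightarrow> cmod (LINT x|lborel. cnj (g x) * (p (x + h n) - p x)) < e / 4" by auto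
  have "cmod (L2_inner lborel g (\<lambda>x. g (x + h n)) - L2_inner lborel g g) < e" if "n \<ge> n0" for n
  proof -
    define r where "r x = g x - p x" for x
    have rL: "r \<in> L2_space lborel" unfolding r_def[abs_def] by (rule L2.diff_mem[OF gL pL])
    have eq1: "L2_inner lborel g (\<lambda>x. g (x + h n)) = L2_inner lborel g (\<lambda>x. r (x + h n)) + L2_inner lborel g (\<lambda>x. p (x + h n))"
      using L2.add_right[OF gL L2_translate(1)[OF rL, of "h n"] L2_translate(1)[OF pL, of "h n"]]
      by (simp add: r_def)
    have eq2: "L2_inner lborel g g = L2_inner lborel g r + L2_inner lborel g p"
      using L2.add_right[OF gL rL pL] by (simp add: r_def)
    have eq3: "(LINT x|lborel. cnj (g x) * (p (x + h n) - p x)) = L2_inner lborel g (\<lambda>x. p (x + h n)) - L2_inner lborel g p"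
      using L2.diff_right[OF gL L2_translate(1)[OF pL, of "h n"] pL] by (simp add: L2_inner_def)
    have rd: "L2_norm lborel g * L2_norm lborel r \<le> e / 4"
      using mult_left_mono[of "L2_norm lborel r" d "L2_norm lborel g"] pd d(2) gn
      unfolding r_def[abs_def] by linarith
    have 1: "cmod (L2_inner lborel g (\<lambda>x. r (x + h n))) \<le> e / 4"
      using L2.Cauchy_Schwarz[OF gL L2_translate(1)[OF rL, of "h n"]] rd
      unfolding L2_translate(2)[OF rL] by linarith
    have 2: "cmod (L2_inner lborel g r) \<le> e / 4"
      using L2.Cauchy_Schwarz[OF gL rL] rd by linarith
    have "L2_inner lborel g (\<lambda>x. g (x + h n)) - L2_inner lborel g g
       = L2_inner lborel g (\<lambda>x. r (x + h n)) + (LINT x|lborel. cnj (g x) * (p (x + h n) - p x)) - L2_inner lborel g r"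
      unfolding eq3 eq1 eq2 by simp
    then have "cmod (L2_inner lborel g (\<lambda>x. g (x + h n)) - L2_inner lborel g g)
       \<le> cmod (L2_inner lborel g (\<lambda>x. r (x + h n))) + cmod (LINT x|lborel. cnj (g x) * (p (x + h n) - p x)) + cmod (L2_inner lborel g r)"
      using norm_triangle_ineq4[of "L2_inner lborel g (\<lambda>x. r (x + h n)) + (LINT x|lborel. cnj (g x) * (p (x + h n) - p x))" "L2_inner lborel g r"]
        norm_triangle_ineq[of "L2_inner lborel g (\<lambda>x. r (x + h n))" "LINT x|lborel. cnj (g x) * (p (x + h n) - p x)"]
      by simp
    then show ?thesis using 1 2 n0[OF that] e by argo
  qed
  then show "\<exists>no. \<forall>n\<ge>no. norm (L2_inner lborel g (\<lambda>x. g (x + h n)) - L2_inner lborel g g) < e" by blast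
qed

section \<open>Autocorrelation and the Plancherel inequality\<close>

definition autocorr :: "(real \<Rightarrow> complex) \<Rightarrow> real \<Rightarrow> complex" where
  "autocorr g h = L2_inner lborel g (\<lambda>x. g (x + h))"

text \<open>Fubini for \<open>f t x h\<close>: integrating over \<open>x\<close> first produces the
  autocorrelation, while over \<open>h\<close> first a translation produces the transform of
  \<open>g\<close> times the conjugate of its integrand at \<open>x\<close>. The double integral
  converges absolutely, to the square of the L1 norm of \<open>g\<close>.\<close>

lemma Wiener_Khinchin:
  assumes g: "g \<in> L2_on L" and L: "0 \<le> L"
  shows "integrable lborel (autocorr g)"
    and "complex_of_real ((cmod (ft g (complex_of_real t)))\<^sup>2) = (LINT h|lborel. autocorr g h * iexp (- (t * h)))"
proof -
  note [measurable] = L2_on_measurable[OF g]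
  have gi: "integrable lborel g" by (rule L2_on_integrable(1)[OF g L])
  define f where "f t x h = cnj (g x) * g (x + h) * iexp (- (t * h))" for t x h
  have shift: "integrable lborel (\<lambda>h. u (x + h))" "(LINT h|lborel. u (x + h)) = (LINT h|lborel. u h)"
    if "integrable lborel u" for u :: "real \<Rightarrow> 'b::{banach, second_countable_topology}" and x
    using lborel_integrable_real_affine[OF that, of 1 x] lborel_integral_real_affine[of 1 u x] by simp_all
  have fx: "integrable lborel (f t x)" for t x
  proof (rule Bochner_Integration.integrable_bound)
    show "integrable lborel (\<lambda>h. cmod (g x) * cmod (g (x + h)))"
      using shift(1)[OF gi, of x] by simp
    show "f t x \<in> borel_measurable lborel" unfolding f_def[abs_def] by measurable
    show "AE h in lborel. norm (f t x h) \<le> norm (cmod (g x) * cmod (g (x + h)))"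
      by (simp add: f_def norm_mult)
  qed
  have int: "integrable (lborel \<Otimes>\<^sub>M lborel) (case_prod (f t))" for t
  proof (rule lborel_pair.Fubini_integrable)
    show "case_prod (f t) \<in> borel_measurable (lborel \<Otimes>\<^sub>M lborel)"
      unfolding f_def[abs_def] by measurable
    have "(LINT h|lborel. norm (case_prod (f t) (x, h))) = cmod (g x) * (LINT h|lborel. cmod (g h))" for x
      using shift(2)[of "\<lambda>h. cmod (g h)" x] gi by (simp add: f_def norm_mult)
    then show "integrable lborel (\<lambda>x. LINT h|lborel. norm (case_prod (f t) (x, h)))"
      using gi by simp
    show "AE x in lborel. integrable lborel (\<lambda>h. case_prod (f t) (x, h))" using fx by simp
  qed
  have inner: "(LINT x|lborel. f t x h) = autocorr g h * iexp (- (t * h))" for t h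
    by (simp add: f_def autocorr_def L2_inner_def)
  have "integrable lborel (\<lambda>h. LINT x|lborel. f 0 x h)" by (rule lborel_pair.integrable_snd[OF int])
  then show "integrable lborel (autocorr g)" by (simp add: inner)
  have "(LINT h|lborel. autocorr g h * iexp (- (t * h))) = (LINT h|lborel. LINT x|lborel. f t x h)"
    by (simp add: inner)
  also have "\<dots> = (LINT x|lborel. LINT h|lborel. f t x h)" by (rule lborel_pair.Fubini_integral[OF int])
  also have "\<dots> = (LINT x|lborel. cnj (g x * exp (- (\<i> * complex_of_real t * complex_of_real x))) * ft g (complex_of_real t))"
  proof (rule Bochner_Integration.integral_cong[OF refl])
    fix x
    have "f t x h = cnj (g x * exp (- (\<i> * complex_of_real t * complex_of_real x)))
        * (g (x + h) * exp (- (\<i> * complex_of_real t * complex_of_real (x + h))))" for h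
      by (simp add: f_def exp_cnj algebra_simps flip: exp_add)
    then have "(LINT h|lborel. f t x h) = cnj (g x * exp (- (\<i> * complex_of_real t * complex_of_real x)))
        * (LINT h|lborel. g (x + h) * exp (- (\<i> * complex_of_real t * complex_of_real (x + h))))" by simp
    also have "(LINT h|lborel. g (x + h) * exp (- (\<i> * complex_of_real t * complex_of_real (x + h)))) = ft g (complex_of_real t)"
      unfolding ft_def by (rule shift(2)[OF ft_integrable[OF g L, of "complex_of_real t"]])
    finally show "(LINT h|lborel. f t x h)
      = cnj (g x * exp (- (\<i> * complex_of_real t * complex_of_real x))) * ft g (complex_of_real t)" .
  qed
  also have "\<dots> = cnj (ft g (complex_of_real t)) * ft g (complex_of_real t)"
    unfolding ft_def by (simp only: Bochner_Integration.integral_mult_left_zero Bochner_Integration.integral_cnj)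
  finally show "complex_of_real ((cmod (ft g (complex_of_real t)))\<^sup>2) = (LINT h|lborel. autocorr g h * iexp (- (t * h)))"
    by (simp only: cnj_mult_self)
qed

text \<open>The average over frequencies with Gaussian weight of width \<open>1 / e\<close> becomes
  an average of the autocorrelation over shifts of width \<open>e\<close>: the characteristic
  function of the normal law is again Gaussian, and after rescaling it is
  \<open>sqrt (2 * pi)\<close> times the normal density.\<close>

lemma Gaussian_average:
  assumes g: "g \<in> L2_on L" and L: "0 \<le> L" and e: "e > 0"
  shows "complex_of_real (LINT s|std_normal_distribution. (cmod (ft g (complex_of_real (s / e))))\<^sup>2)
    = e * sqrt (2 * pi) * (LINT s|std_normal_distribution. autocorr g (e * s))"
    (is "?lhs = _")
proof -
  interpret N: real_distribution std_normal_distribution by (rule real_dist_normal_dist)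
  interpret P: pair_sigma_finite std_normal_distribution lborel ..
  note R = Wiener_Khinchin(1)[OF g L]
  then have [measurable]: "autocorr g \<in> borel_measurable borel" by simp
  define f where "f s h = autocorr g h * iexp (- (s / e * h))" for s h
  have int: "integrable (std_normal_distribution \<Otimes>\<^sub>M lborel) (case_prod f)"
  proof (rule P.Fubini_integrable)
    show "case_prod f \<in> borel_measurable (std_normal_distribution \<Otimes>\<^sub>M lborel)"
      unfolding f_def[abs_def] by measurable
    show "integrable std_normal_distribution (\<lambda>s. LINT h|lborel. norm (case_prod f (s, h)))"
      by (simp add: f_def norm_mult)
    show "AE s in std_normal_distribution. integrable lborel (\<lambda>h. case_prod f (s, h))"
    proof (rule AE_I2)
      fix s
      show "integrable lborel (\<lambda>h. case_prod f (s, h))"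
        unfolding prod.case by (rule Bochner_Integration.integrable_bound[OF R])
          (auto simp: f_def[abs_def] norm_mult)
    qed
  qed
  have "?lhs = (LINT s|std_normal_distribution. LINT h|lborel. f s h)"
    by (simp only: f_def Wiener_Khinchin(2)[OF g L, symmetric] integral_complex_of_real)
  also have "\<dots> = (LINT h|lborel. LINT s|std_normal_distribution. f s h)"
    by (rule P.Fubini_integral[OF int, symmetric])
  also have "\<dots> = (LINT h|lborel. autocorr g h * complex_of_real (exp (- ((h / e)\<^sup>2) / 2)))"
  proof (rule Bochner_Integration.integral_cong[OF refl])
    fix h
    have "(LINT s|std_normal_distribution. f s h) = autocorr g h * char std_normal_distribution (- h / e)"
      by (simp add: f_def char_def mult_ac)
    then show "(LINT s|std_normal_distribution. f s h) = autocorr g h * complex_of_real (exp (- ((h / e)\<^sup>2) / 2))"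
      by (simp add: char_std_normal_distribution power_divide)
  qed
  also have "\<dots> = \<bar>e\<bar> *\<^sub>R (LINT s|lborel. autocorr g (0 + e * s) * complex_of_real (exp (- (((0 + e * s) / e)\<^sup>2) / 2)))"
    using e by (intro lborel_integral_real_affine) simp
  also have "(LINT s|lborel. autocorr g (0 + e * s) * complex_of_real (exp (- (((0 + e * s) / e)\<^sup>2) / 2)))
     = (LINT s|lborel. sqrt (2 * pi) * (std_normal_density s *\<^sub>R autocorr g (e * s)))"
    using e by (intro Bochner_Integration.integral_cong)
      (auto simp: std_normal_density_def scaleR_conv_of_real real_sqrt_mult)
  also have "\<dots> = sqrt (2 * pi) * (LINT s|std_normal_distribution. autocorr g (e * s))"
  proof -
    have "(LINT s|std_normal_distribution. autocorr g (e * s)) = (LINT s|lborel. std_normal_density s *\<^sub>R autocorr g (e * s))"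
      by (rule integral_density) auto
    then show ?thesis by (simp only: integral_mult_right_zero)
  qed
  finally show ?thesis using e by (simp add: scaleR_conv_of_real mult_ac)
qed

text \<open>In \<open>Gaussian_average\<close> the density is bounded by its maximum
  \<open>1 / sqrt (2 * pi)\<close>, which gives an estimate uniform in \<open>e\<close>. As
  \<open>e\<close> tends to 0 the shifts shrink and the average of the autocorrelation tends to its
  value at 0, the squared norm; Cauchy-Schwarz supplies the dominating constant.\<close>

theorem Plancherel_le:
  assumes g: "g \<in> L2_on L" and L: "0 \<le> L" and int: "integrable lborel (\<lambda>t. (cmod (ft g (complex_of_real t)))\<^sup>2)"
  shows "2 * pi * (L2_norm lborel g)\<^sup>2 \<le> (LINT t|lborel. (cmod (ft g (complex_of_real t)))\<^sup>2)"
proof -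
  interpret N: real_distribution std_normal_distribution by (rule real_dist_normal_dist)
  note [measurable] = ft_measurable[OF g L]
  have [measurable]: "autocorr g \<in> borel_measurable borel" using Wiener_Khinchin(1)[OF g L] by simp
  let ?I = "LINT t|lborel. (cmod (ft g (complex_of_real t)))\<^sup>2"
  have le: "Re (LINT s|std_normal_distribution. autocorr g (e * s)) \<le> ?I / (2 * pi)" if e: "e > 0" for e
  proof -
    have "(LINT s|std_normal_distribution. (cmod (ft g (complex_of_real (s / e))))\<^sup>2)
       = (LINT s|lborel. std_normal_density s *\<^sub>R (cmod (ft g (complex_of_real (s / e))))\<^sup>2)"
    proof (rule integral_density)
      show "(\<lambda>s. (cmod (ft g (complex_of_real (s / e))))\<^sup>2) \<in> borel_measurable lborel"
        using measurable_compose[of "\<lambda>s. s / e" borel borel, OF _ ft_measurable[OF g L]]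
        by (intro borel_measurable_power borel_measurable_norm) (simp del: of_real_divide)
    qed auto
    also have "\<dots> \<le> (LINT s|lborel. 1 / sqrt (2 * pi) * (cmod (ft g (complex_of_real (0 + 1 / e * s))))\<^sup>2)"
    proof (rule integral_mono')
      show "integrable lborel (\<lambda>s. 1 / sqrt (2 * pi) * (cmod (ft g (complex_of_real (0 + 1 / e * s))))\<^sup>2)"
        using e by (intro integrable_mult_right lborel_integrable_real_affine[OF int]) simp
      fix s
      have "std_normal_density s \<le> 1 / sqrt (2 * pi)"
        by (simp add: std_normal_density_def divide_right_mono)
      then show "std_normal_density s *\<^sub>R (cmod (ft g (complex_of_real (s / e))))\<^sup>2
        \<le> 1 / sqrt (2 * pi) * (cmod (ft g (complex_of_real (0 + 1 / e * s))))\<^sup>2"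
        using mult_right_mono[of "std_normal_density s" "1 / sqrt (2 * pi)" "(cmod (ft g (complex_of_real (s / e))))\<^sup>2"]
        by simp
    qed simp
    also have "\<dots> = 1 / sqrt (2 * pi) * (LINT s|lborel. (cmod (ft g (complex_of_real (0 + 1 / e * s))))\<^sup>2)"
      by simp
    also have "(LINT s|lborel. (cmod (ft g (complex_of_real (0 + 1 / e * s))))\<^sup>2) = e * ?I"
      using lborel_integral_real_affine[of "1 / e" "\<lambda>t. (cmod (ft g (complex_of_real t)))\<^sup>2" 0] e
      by (simp add: field_simps)
    finally have "(LINT s|std_normal_distribution. (cmod (ft g (complex_of_real (s / e))))\<^sup>2) \<le> 1 / sqrt (2 * pi) * (e * ?I)" .
    moreover have "(LINT s|std_normal_distribution. (cmod (ft g (complex_of_real (s / e))))\<^sup>2)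
       = e * sqrt (2 * pi) * Re (LINT s|std_normal_distribution. autocorr g (e * s))"
      using arg_cong[OF Gaussian_average[OF g L e], of Re] by simp
    ultimately have "e * sqrt (2 * pi) * Re (LINT s|std_normal_distribution. autocorr g (e * s)) \<le> 1 / sqrt (2 * pi) * (e * ?I)"
      by simp
    moreover have "r * r * X \<le> Y" if "r > 0" "e * r * X \<le> 1 / r * (e * Y)" for r X Y :: real
      using that e by (simp add: field_simps)
    ultimately have "sqrt (2 * pi) * sqrt (2 * pi) * Re (LINT s|std_normal_distribution. autocorr g (e * s)) \<le> ?I"
      by (metis real_sqrt_gt_zero pi_gt_zero zero_less_mult_iff zero_less_numeral)
    then have "2 * pi * Re (LINT s|std_normal_distribution. autocorr g (e * s)) \<le> ?I" by simp
    then show ?thesis by (simp add: field_simps)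
  qed
  have bound: "cmod (autocorr g h) \<le> (L2_norm lborel g)\<^sup>2" for h
    unfolding autocorr_def using L2.Cauchy_Schwarz[OF L2_onD(1)[OF g] L2_translate(1)[OF L2_onD(1)[OF g], of h]]
    by (simp add: L2_translate(2)[OF L2_onD(1)[OF g]] power2_eq_square)
  have "(\<lambda>n. LINT s|std_normal_distribution. autocorr g (1 / real (Suc n) * s))
      \<longlonglongrightarrow> (LINT s|std_normal_distribution. L2_inner lborel g g)"
  proof (rule Bochner_Integration.integral_dominated_convergence[where w = "\<lambda>_. (L2_norm lborel g)\<^sup>2"])
    show "AE s in std_normal_distribution. (\<lambda>n. autocorr g (1 / real (Suc n) * s)) \<longlonglongrightarrow> L2_inner lborel g g"
    proof (rule AE_I2)
      fix s :: real
      have "(\<lambda>n. 1 / real (Suc n) * s) \<longlonglongrightarrow> 0 * s"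
        by (intro tendsto_intros LIMSEQ_Suc lim_1_over_n)
      then show "(\<lambda>n. autocorr g (1 / real (Suc n) * s)) \<longlonglongrightarrow> L2_inner lborel g g"
        unfolding autocorr_def by (intro autocorrelation_tendsto[OF g L]) simp
    qed
    show "AE s in std_normal_distribution. norm (autocorr g (1 / real (Suc n) * s)) \<le> (L2_norm lborel g)\<^sup>2" for n
      using bound by simp
  qed simp_all
  then have "(\<lambda>n. Re (LINT s|std_normal_distribution. autocorr g (1 / real (Suc n) * s))) \<longlonglongrightarrow> (L2_norm lborel g)\<^sup>2"
    using tendsto_Re N.prob_space by (fastforce simp: L2_inner_self)
  then have "(L2_norm lborel g)\<^sup>2 \<le> ?I / (2 * pi)"
    by (rule LIMSEQ_le_const2) (intro exI[of _ 0] allI impI le, simp)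
  then show ?thesis by (simp add: field_simps)
qed

section \<open>Logarithmic coordinates and the Riemann--Siegel theta function\<close>

text \<open>The substitution rule works on compact intervals. The two measures are therefore
  compared on the sets \<open>I n\<close>, which exhaust the positive half-line, and continuity from
  below does the rest; neither measure charges nonpositive numbers.\<close>

lemma dstar_eq_distr: "dstar = distr lborel borel exp"
proof (rule measure_eqI)
  show "sets dstar = sets (distr lborel borel exp)" by (simp add: dstar_def)
  fix A assume "A \<in> sets dstar"
  then have A[measurable]: "A \<in> sets borel" by (simp add: dstar_def)
  define I where "I n = {exp (- real n)..exp (real n)}" for n
  have eq: "emeasure dstar (A \<inter> I n) = emeasure (distr lborel borel exp) (A \<inter> I n)" for n
  proof -
    have "emeasure dstar (A \<inter> I n) = (\<integral>\<^sup>+u. ennreal (indicator A u * (1 / u) * indicator {exp (- real n)..exp (real n)} u) \<partial>lborel)"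
      unfolding dstar_def I_def
    proof (subst emeasure_density)
      have pos: "0 < u" if "exp (- real n) \<le> u" for u :: real using that by (meson exp_gt_zero less_le_trans)
      show "(\<integral>\<^sup>+u. indicator {0<..} u * ennreal (1 / u) * indicator (A \<inter> {exp (- real n)..exp (real n)}) u \<partial>lborel)
        = (\<integral>\<^sup>+u. ennreal (indicator A u * (1 / u) * indicator {exp (- real n)..exp (real n)} u) \<partial>lborel)"
        by (intro nn_integral_cong) (auto simp: indicator_def pos)
    qed auto
    also have "\<dots> = (\<integral>\<^sup>+x. ennreal (indicator A (exp x) * (1 / exp x) * exp x * indicator {- real n..real n} x) \<partial>lborel)"
    proof (rule nn_integral_substitution)
      show "set_borel_measurable borel {exp (- real n)..exp (real n)} (\<lambda>u. indicator A u * (1 / u))"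
        unfolding set_borel_measurable_def by measurable
      show "(exp has_real_derivative exp x) (at x)" for x :: real by (rule DERIV_exp)
      show "continuous_on {- real n..real n} exp" by (intro continuous_intros)
    qed auto
    also have "\<dots> = (\<integral>\<^sup>+x. indicator (exp -` (A \<inter> I n)) x \<partial>lborel)"
      by (intro nn_integral_cong) (auto simp: indicator_def I_def)
    also have "\<dots> = emeasure (distr lborel borel exp) (A \<inter> I n)"
      using measurable_sets[of exp borel borel "A \<inter> I n"] by (simp add: emeasure_distr I_def)
    finally show ?thesis .
  qed
  have inc: "incseq (\<lambda>n. A \<inter> I n)"
  proof (rule incseq_SucI)
    fix n
    have "I n \<subseteq> I (Suc n)"
      unfolding I_def atLeastatMost_subset_iff by (intro disjI2 conjI) simp_all
    then show "A \<inter> I n \<subseteq> A \<inter> I (Suc n)" by blast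
  qed
  have Un: "(\<Union>n. A \<inter> I n) = A \<inter> {0<..}"
  proof
    show "(\<Union>n. A \<inter> I n) \<subseteq> A \<inter> {0<..}"
      by (auto simp: I_def intro: less_le_trans[OF exp_gt_zero])
    show "A \<inter> {0<..} \<subseteq> (\<Union>n. A \<inter> I n)"
    proof
      fix u assume u: "u \<in> A \<inter> {0<..}"
      obtain n where "\<bar>ln u\<bar> \<le> real n" using real_arch_simple by blast
      then have "exp (- real n) \<le> exp (ln u)" "exp (ln u) \<le> exp (real n)" by auto
      moreover have "exp (ln u) = u" using u by simp
      ultimately have "u \<in> I n" unfolding I_def atLeastAtMost_iff by metis
      then show "u \<in> (\<Union>n. A \<inter> I n)" using u by blast
    qed
  qed
  have "emeasure dstar (A \<inter> {0<..}) = (SUP n. emeasure dstar (A \<inter> I n))"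
    unfolding Un[symmetric] by (rule SUP_emeasure_incseq[symmetric]) (auto simp: I_def dstar_def inc[unfolded I_def])
  also have "\<dots> = (SUP n. emeasure (distr lborel borel exp) (A \<inter> I n))" by (simp only: eq)
  also have "\<dots> = emeasure (distr lborel borel exp) (A \<inter> {0<..})"
    unfolding Un[symmetric] by (rule SUP_emeasure_incseq) (auto simp: I_def inc[unfolded I_def])
  also have "\<dots> = emeasure (distr lborel borel exp) A"
    by (simp add: emeasure_distr vimage_Int) (metis (mono_tags, lifting) Int_UNIV_right UNIV_eq_I exp_gt_zero greaterThan_iff vimage_eq)
  finally have 1: "emeasure dstar (A \<inter> {0<..}) = emeasure (distr lborel borel exp) A" .
  have "emeasure dstar A = emeasure dstar (A \<inter> {0<..})"
    unfolding dstar_def by (subst (1 2) emeasure_density) (auto intro!: nn_integral_cong simp: indicator_def)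
  then show "emeasure dstar A = emeasure (distr lborel borel exp) A" using 1 by simp
qed

lemma dstar_integral:
  fixes f :: "real \<Rightarrow> 'b::{banach, second_countable_topology}"
  assumes "f \<in> borel_measurable borel"
  shows "(LINT u|dstar. f u) = (LINT x|lborel. f (exp x))"
    "integrable dstar f \<longleftrightarrow> integrable lborel (\<lambda>x. f (exp x))"
  unfolding dstar_eq_distr using assms by (auto simp: integral_distr integrable_distr_eq)

definition logf :: "real \<Rightarrow> (real \<Rightarrow> complex) \<Rightarrow> real \<Rightarrow> complex" where
  "logf lam f x = extend_zero lam f (exp x)"

lemma logf_lin: "logf lam (\<lambda>x. f x + c * g x) = (\<lambda>x. logf lam f x + c * logf lam g x)"
  by (auto simp: logf_def extend_zero_def)

lemma extend_zero_indicator: "extend_zero lam f = (\<lambda>u. indicator {1 / lam..lam} u *\<^sub>R f u)"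
  by (auto simp: extend_zero_def indicator_def)

lemma extend_zero_measurable:
  assumes "f \<in> L2_space (dstar_on lam)"
  shows "extend_zero lam f \<in> borel_measurable borel"
proof -
  have "f \<in> borel_measurable (restrict_space dstar {1 / lam..lam})"
    using L2_space_measurable[OF assms] by (simp add: dstar_on_def)
  then have "extend_zero lam f \<in> borel_measurable dstar"
    unfolding extend_zero_indicator by (subst (asm) borel_measurable_restrict_space_iff) (auto simp: dstar_def)
  then show ?thesis by (simp add: dstar_def)
qed

lemma logf_mem:
  assumes f: "f \<in> L2_space (dstar_on lam)" and lam: "lam > 1"
  shows "logf lam f \<in> L2_on (ln lam)" "L2_norm lborel (logf lam f) = L2_norm (dstar_on lam) f"
proof -
  note [measurable] = extend_zero_measurable[OF f]
  have sq: "(\<lambda>u. (cmod (extend_zero lam f u))\<^sup>2) = (\<lambda>u. indicator {1 / lam..lam} u *\<^sub>R (cmod (f u))\<^sup>2)"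
    by (auto simp: extend_zero_def indicator_def)
  have I: "{1 / lam..lam} \<inter> space dstar \<in> sets dstar" by (simp add: dstar_def)
  have "integrable (restrict_space dstar {1 / lam..lam}) (\<lambda>u. (cmod (f u))\<^sup>2)"
    using L2_space_integrable[OF f] by (simp add: dstar_on_def)
  then have "integrable dstar (\<lambda>u. (cmod (extend_zero lam f u))\<^sup>2)"
    unfolding sq by (subst (asm) integrable_restrict_space[OF I])
  then have i: "integrable lborel (\<lambda>x. (cmod (logf lam f x))\<^sup>2)"
    by (subst (asm) dstar_integral(2)) (auto simp: logf_def)
  have m: "logf lam f \<in> borel_measurable borel" unfolding logf_def[abs_def] by measurable
  have supp: "logf lam f x = 0" if "ln lam < \<bar>x\<bar>" for x
  proof -
    have "exp x \<notin> {1 / lam..lam}"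
    proof
      assume "exp x \<in> {1 / lam..lam}"
      then have "ln (1 / lam) \<le> ln (exp x)" "ln (exp x) \<le> ln lam"
        using lam by (auto simp: ln_le_cancel_iff simp del: ln_exp)
      then show False using that lam by (simp add: ln_div)
    qed
    then show ?thesis by (auto simp: logf_def extend_zero_def)
  qed
  show "logf lam f \<in> L2_on (ln lam)" unfolding L2_on_def L2_space_def using i m supp by auto
  have "(LINT x|lborel. (cmod (logf lam f x))\<^sup>2) = (LINT u|dstar. (cmod (extend_zero lam f u))\<^sup>2)"
    by (subst dstar_integral(1)) (auto simp: logf_def)
  also have "\<dots> = (LINT u|dstar_on lam. (cmod (f u))\<^sup>2)"
    unfolding sq dstar_on_def by (rule integral_restrict_space[OF I, symmetric])
  finally show "L2_norm lborel (logf lam f) = L2_norm (dstar_on lam) f" by (simp add: L2_norm_def)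
qed

lemma mult_fourier_eq:
  assumes f: "f \<in> L2_space (dstar_on lam)" and lam: "lam > 1"
  shows "mult_fourier (extend_zero lam f) s = ft (logf lam f) s"
proof -
  note [measurable] = extend_zero_measurable[OF f]
  \<comment> \<open>For \<open>u \<le> 0\<close> the two exponentials need not agree, but there
    \<open>extend_zero\<close> vanishes because \<open>1 / lam\<close> is positive.\<close>
  have "extend_zero lam f u * complex_of_real u powr (- \<i> * s) = extend_zero lam f u * exp (- (\<i> * s * complex_of_real (ln u)))" for u
  proof (cases "u > 0")
    case True
    then show ?thesis by (simp add: powr_def Ln_of_real)
  next
    case False
    moreover have "0 < 1 / lam" using lam by simp
    ultimately have "u \<notin> {1 / lam..lam}" unfolding atLeastAtMost_iff by linarith
    then show ?thesis by (auto simp: extend_zero_def)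
  qed
  then have "mult_fourier (extend_zero lam f) s = (LINT u|dstar. extend_zero lam f u * exp (- (\<i> * s * complex_of_real (ln u))))"
    unfolding mult_fourier_def by (simp only:)
  also have "\<dots> = (LINT x|lborel. extend_zero lam f (exp x) * exp (- (\<i> * s * complex_of_real (ln (exp x)))))"
    by (rule dstar_integral(1)) measurable
  finally show ?thesis by (simp add: ft_def logf_def)
qed

text \<open>In logarithmic coordinates the convolution is a correlation at lag \<open>a\<close>; the
  inversion inside \<open>mult_star\<close> is undone by the reflection of the integration
  variable.\<close>

lemma mult_conv_star_eq:
  assumes f: "f \<in> L2_space (dstar_on lam)" and g: "g \<in> L2_space (dstar_on lam)"
  shows "mult_conv (mult_star (extend_zero lam f)) (extend_zero lam g) (exp a)
    = L2_inner lborel (logf lam f) (\<lambda>x. logf lam g (x + a))"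
proof -
  note [measurable] = extend_zero_measurable[OF f] extend_zero_measurable[OF g]
  have "mult_conv (mult_star (extend_zero lam f)) (extend_zero lam g) (exp a)
     = (LINT x|lborel. cnj (extend_zero lam f (1 / exp x)) * extend_zero lam g (exp a / exp x))"
    unfolding mult_conv_def mult_star_def by (rule dstar_integral(1)) measurable
  also have "\<dots> = (LINT x|lborel. cnj (logf lam f (0 + (-1) * x)) * logf lam g ((0 + (-1) * x) + a))"
    by (intro Bochner_Integration.integral_cong) (auto simp: logf_def exp_minus exp_diff field_simps)
  also have "\<dots> = L2_inner lborel (logf lam f) (\<lambda>x. logf lam g (x + a))"
    unfolding L2_inner_def
    using lborel_integral_real_affine[of "-1" "\<lambda>x. cnj (logf lam f x) * logf lam g (x + a)" 0] by simp
  finally show ?thesis .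
qed

section \<open>The derivative of theta and its growth\<close>

lemma deriv_theta: "deriv theta t = - (ln pi / 2) + Re (Digamma (1 / 4 + \<i> * complex_of_real t / 2)) / 2"
proof -
  have nz: "1 / 4 + \<i> * complex_of_real t / 2 \<notin> \<real>\<^sub>\<le>\<^sub>0"
    by (auto simp: complex_nonpos_Reals_iff)
  have "((\<lambda>z. ln_Gamma (1 / 4 + \<i> * z / 2)) has_field_derivative Digamma (1 / 4 + \<i> * complex_of_real t / 2) * (\<i> / 2)) (at (complex_of_real t))"
    using nz by (auto intro!: derivative_eq_intros)
  then have "((\<lambda>t. ln_Gamma (1 / 4 + \<i> * complex_of_real t / 2)) has_vector_derivative Digamma (1 / 4 + \<i> * complex_of_real t / 2) * (\<i> / 2)) (at t)"
    by (rule has_vector_derivative_real_field)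
  then have "((\<lambda>t. Im (ln_Gamma (1 / 4 + \<i> * complex_of_real t / 2))) has_vector_derivative Im (Digamma (1 / 4 + \<i> * complex_of_real t / 2) * (\<i> / 2))) (at t)"
    by (rule bounded_linear.has_vector_derivative[OF bounded_linear_Im])
  then have 1: "((\<lambda>t. Im (ln_Gamma (1 / 4 + \<i> * complex_of_real t / 2))) has_real_derivative Re (Digamma (1 / 4 + \<i> * complex_of_real t / 2)) / 2) (at t)"
    by (simp add: has_real_derivative_iff_has_vector_derivative)
  have "(theta has_real_derivative - (ln pi / 2) + Re (Digamma (1 / 4 + \<i> * complex_of_real t / 2)) / 2) (at t)"
    unfolding theta_def[abs_def] by (rule derivative_eq_intros 1 refl | simp)+
  then show ?thesis by (rule DERIV_imp_deriv)
qed

lemma continuous_deriv_theta: "continuous_on UNIV (deriv theta)"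
proof -
  have "1 / 4 + \<i> * complex_of_real t / 2 \<notin> \<int>\<^sub>\<le>\<^sub>0" for t
  proof
    assume "1 / 4 + \<i> * complex_of_real t / 2 \<in> \<int>\<^sub>\<le>\<^sub>0"
    then obtain n where "1 / 4 + \<i> * complex_of_real t / 2 = - of_nat n" by (rule nonpos_Ints_cases')
    from arg_cong[OF this, of Re] show False by simp
  qed
  then show ?thesis
    unfolding deriv_theta[abs_def] by (intro continuous_at_imp_continuous_on ballI continuous_intros) auto
qed

text \<open>In the limit formula for the digamma function the logarithms cancel between
  \<open>t\<close> and 0, which leaves a series with nonnegative terms \<open>a 0 n - a t n\<close>.
  Any partial sum is a lower bound. For fixed \<open>N\<close> it tends to the sum of the
  \<open>a 0 n\<close> as \<open>t\<close> grows, and that sum exceeds the harmonic number of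
  \<open>N\<close>, so the bound can be made arbitrarily large without an asymptotic
  expansion.\<close>

lemma deriv_theta_unbounded: "\<exists>T. \<forall>t. T \<le> \<bar>t\<bar> \<longrightarrow> R \<le> deriv theta t"
proof -
  define a where "a t n = (real n + 1/4) / ((real n + 1/4)\<^sup>2 + t\<^sup>2 / 4)" for t :: real and n
  have Re_inv: "Re (inverse (1 / 4 + \<i> * complex_of_real t / 2 + of_nat n)) = a t n" for t n
    by (simp add: a_def power_divide add.commute)
  have lim: "(\<lambda>m. ln (real m) - (\<Sum>n<m. a t n)) \<longlonglongrightarrow> Re (Digamma (1 / 4 + \<i> * complex_of_real t / 2))" for t
  proof -
    have "1 / 4 + \<i> * complex_of_real t / 2 \<noteq> 0" by (simp add: complex_eq_iff)
    from tendsto_Re[OF Digamma_LIMSEQ[OF this]] show ?thesis by (simp only: minus_complex.sel Re_sum Re_inv Re_complex_of_real)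
  qed
  have diff: "(\<Sum>n<N. a 0 n - a t n) \<le> Re (Digamma (1 / 4 + \<i> * complex_of_real t / 2)) - Re (Digamma (1 / 4 + \<i> * complex_of_real 0 / 2))" for t N
  proof -
    have nn: "0 \<le> a 0 n - a t n" for n
      unfolding a_def by (simp add: divide_left_mono add_pos_nonneg)
    have "(\<lambda>m. (ln (real m) - (\<Sum>n<m. a t n)) - (ln (real m) - (\<Sum>n<m. a 0 n)))
       \<longlonglongrightarrow> Re (Digamma (1 / 4 + \<i> * complex_of_real t / 2)) - Re (Digamma (1 / 4 + \<i> * complex_of_real 0 / 2))"
      by (intro tendsto_diff lim)
    then have l: "(\<lambda>m. \<Sum>n<m. a 0 n - a t n)
       \<longlonglongrightarrow> Re (Digamma (1 / 4 + \<i> * complex_of_real t / 2)) - Re (Digamma (1 / 4 + \<i> * complex_of_real 0 / 2))"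
      by (simp add: sum_subtractf)
    have "(\<Sum>n<N. a 0 n - a t n) \<le> (\<Sum>n<m. a 0 n - a t n)" if "N \<le> m" for m
      using that nn by (intro sum_mono2) auto
    then show ?thesis by (intro LIMSEQ_le_const[OF l]) blast
  qed
  \<comment> \<open>Solved from \<open>deriv_theta\<close>: a partial sum above \<open>K\<close>
    makes the derivative exceed \<open>R\<close>, with \<open>1 / 2\<close> to spare.\<close>
  define K where "K = 2 * R + ln pi - Re (Digamma (1 / 4 + \<i> * complex_of_real 0 / 2)) + 1"
  have "filterlim (\<lambda>n. harm n :: real) at_top sequentially" by (rule harm_at_top)
  then obtain N where N: "harm N > K"
    unfolding filterlim_at_top_dense eventually_sequentially by blast
  have "harm N \<le> (\<Sum>n<N. a 0 n)"
  proof -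
    have "harm N = (\<Sum>n<N. inverse (real (Suc n)))"
      unfolding harm_def by (rule sum.reindex_bij_witness[of _ Suc "\<lambda>n. n - 1"]) auto
    also have "\<dots> \<le> (\<Sum>n<N. a 0 n)"
    proof (rule sum_mono)
      fix n
      have "a 0 n = 1 / (real n + 1/4)" by (simp add: a_def power2_eq_square)
      also have "\<dots> \<ge> 1 / real (Suc n)" by (rule divide_left_mono) auto
      finally show "inverse (real (Suc n)) \<le> a 0 n" by (simp only: inverse_eq_divide)
    qed
    finally show ?thesis .
  qed
  then have K: "K < (\<Sum>n<N. a 0 n)" using N by linarith
  have "((\<lambda>t. \<Sum>n<N. a 0 n - a t n) \<longlongrightarrow> (\<Sum>n<N. a 0 n - 0)) at_infinity"
  proof (intro tendsto_sum tendsto_diff tendsto_const)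
    fix n
    show "((\<lambda>t. a t n) \<longlongrightarrow> 0) at_infinity"
    proof (rule Lim_null_comparison)
      have "((\<lambda>t::real. inverse t) \<longlongrightarrow> 0) at_infinity" by (rule tendsto_inverse_0)
      then have "((\<lambda>t::real. (inverse t)\<^sup>2) \<longlongrightarrow> 0\<^sup>2) at_infinity" by (rule tendsto_power)
      then have "((\<lambda>t::real. (4 * (real n + 1/4)) * (inverse t)\<^sup>2) \<longlongrightarrow> (4 * (real n + 1/4)) * 0\<^sup>2) at_infinity"
        by (rule tendsto_mult_left)
      then show "((\<lambda>t::real. (4 * (real n + 1/4)) * (inverse t)\<^sup>2) \<longlongrightarrow> 0) at_infinity" by simp
      show "\<forall>\<^sub>F t in at_infinity. norm (a t n) \<le> (4 * (real n + 1/4)) * (inverse t)\<^sup>2"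
        unfolding eventually_at_infinity
      proof (intro exI[of _ 1] allI impI)
        fix t :: real assume "1 \<le> norm t"
        then have t: "0 < t\<^sup>2" by auto
        have "a t n \<le> (real n + 1/4) / (t\<^sup>2 / 4)"
          unfolding a_def using t by (intro divide_left_mono) (auto intro!: mult_pos_pos add_nonneg_pos)
        then show "norm (a t n) \<le> (4 * (real n + 1/4)) * (inverse t)\<^sup>2"
          using t by (simp add: a_def field_simps)
      qed
    qed
  qed
  then have "\<forall>\<^sub>F t in at_infinity. K < (\<Sum>n<N. a 0 n - a t n)"
    using K by (intro order_tendstoD(1)) auto
  then obtain T where T: "\<And>t. T \<le> \<bar>t\<bar> \<Longrightarrow> K < (\<Sum>n<N. a 0 n - a t n)"
    unfolding eventually_at_infinity by auto
  have "R \<le> deriv theta t" if "T \<le> \<bar>t\<bar>" for t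
    using T[OF that] diff[where N = N and t = t] unfolding deriv_theta K_def by argo
  then show ?thesis by blast
qed

section \<open>The semilocal Weil form\<close>

lemma enn2ereal_finite: "x < \<infinity> \<Longrightarrow> enn2ereal x = ereal (enn2real x)"
  by (cases x) auto

definition arch_weight :: "real \<Rightarrow> real" where
  "arch_weight t = 2 * deriv theta t / (2 * pi)"

lemma arch_weight_continuous: "continuous_on UNIV arch_weight"
  unfolding arch_weight_def[abs_def] by (intro continuous_intros continuous_deriv_theta) auto

lemma arch_weight_measurable [measurable]: "arch_weight \<in> borel_measurable borel"
  using arch_weight_continuous by (rule borel_measurable_continuous_onI)

lemma arch_weight_unbounded: "\<exists>T\<ge>0. \<forall>t. T \<le> \<bar>t\<bar> \<longrightarrow> R \<le> arch_weight t"
proof -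
  obtain T where T: "\<And>t. T \<le> \<bar>t\<bar> \<Longrightarrow> pi * R \<le> deriv theta t" using deriv_theta_unbounded by blast
  have "R \<le> arch_weight t" if "max T 0 \<le> \<bar>t\<bar>" for t
    using T[of t] that by (simp add: arch_weight_def field_simps)
  then show ?thesis by (intro exI[of _ "max T 0"]) auto
qed

text \<open>Growth at infinity confines the negative part to a bounded interval, where continuity
  bounds it. With the uniform bound on the transforms, its contribution to the form is at most a
  multiple of the squared norm.\<close>

lemma arch_weight_neg_part:
  obtains T W where "0 \<le> T" "0 \<le> W" "\<And>t. max 0 (- arch_weight t) \<le> W * indicator {-T..T} t"
proof -
  obtain T where T: "0 \<le> T" "\<And>t. T \<le> \<bar>t\<bar> \<Longrightarrow> 0 \<le> arch_weight t" using arch_weight_unbounded[of 0] by blast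
  have "compact (arch_weight ` {-T..T})"
    by (rule compact_continuous_image[OF continuous_on_subset[OF arch_weight_continuous]]) auto
  then obtain W where W: "\<And>t. t \<in> {-T..T} \<Longrightarrow> \<bar>arch_weight t\<bar> \<le> W"
    using compact_imp_bounded bounded_iff by (metis image_eqI real_norm_def)
  have "max 0 (- arch_weight t) \<le> max W 0 * indicator {-T..T} t" for t
  proof (cases "t \<in> {-T..T}")
    case True then show ?thesis using W[OF True] by auto
  next
    case False
    then have "T \<le> \<bar>t\<bar>" by auto
    then show ?thesis using T(2)[of t] False by simp
  qed
  then show ?thesis using that[of T "max W 0"] T(1) by auto
qed

locale Weil_form =
  fixes lam :: real
  assumes lam: "lam > 1"
begin

abbreviation "H \<equiv> L2_space (dstar_on lam)"
abbreviation "nm \<equiv> L2_norm (dstar_on lam)"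
abbreviation "L \<equiv> ln lam"

definition four :: "(real \<Rightarrow> complex) \<Rightarrow> complex \<Rightarrow> complex" where
  "four f s = ft (logf lam f) s"

lemma L_nonneg: "0 \<le> L" using lam by simp

lemma logf_on: "f \<in> H \<Longrightarrow> logf lam f \<in> L2_on L" using logf_mem(1)[OF _ lam] by simp

lemma four_lin: "f \<in> H \<Longrightarrow> g \<in> H \<Longrightarrow> four (\<lambda>x. f x + c * g x) s = four f s + c * four g s"
  unfolding four_def logf_lin by (rule ft_lin[OF logf_on logf_on L_nonneg])

lemma four_bound: "f \<in> H \<Longrightarrow> cmod (four f s) \<le> exp (\<bar>Im s\<bar> * L) * (sqrt (2 * L) * nm f)"
  unfolding four_def using ft_bound[OF logf_on L_nonneg] logf_mem(2)[OF _ lam] by simp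

lemma four_measurable: "f \<in> H \<Longrightarrow> (\<lambda>t. four f (complex_of_real t)) \<in> borel_measurable borel"
  unfolding four_def by (rule ft_measurable[OF logf_on L_nonneg])

section \<open>Pole and prime power terms as a bounded hermitian form\<close>

definition Tf :: "nat \<Rightarrow> (real \<Rightarrow> complex) \<Rightarrow> (real \<Rightarrow> complex) \<Rightarrow> complex" where
  "Tf n f g = T_form n (extend_zero lam f) (extend_zero lam g)"

lemma Tf_eq:
  assumes "f \<in> H" "g \<in> H" "1 < n"
  shows "Tf n f g = complex_of_real (real n powr (- 1 / 2)) *
    (L2_inner lborel (logf lam f) (\<lambda>x. logf lam g (x + ln (real n))) + L2_inner lborel (logf lam f) (\<lambda>x. logf lam g (x + - ln (real n))))"
proof -
  have n: "real n = exp (ln (real n))" "1 / real n = exp (- ln (real n))"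
    using assms(3) by (auto simp: exp_minus field_simps)
  show ?thesis
    unfolding Tf_def T_form_def
    unfolding mult_conv_star_eq[OF assms(1,2), of "ln (real n)", folded n(1)]
      mult_conv_star_eq[OF assms(1,2), of "- ln (real n)", folded n(2)] ..
qed

lemma Tf_lin:
  assumes "f \<in> H" "g \<in> H" "h \<in> H" "1 < n"
  shows "Tf n f (\<lambda>x. g x + c * h x) = Tf n f g + c * Tf n f h"
    "Tf n (\<lambda>x. g x + c * h x) f = Tf n g f + cnj c * Tf n h f"
proof -
  note m = L2_onD(1)[OF logf_on]
  have gh: "(\<lambda>x. g x + c * h x) \<in> H" using assms by (intro L2.lin_mem)
  show "Tf n f (\<lambda>x. g x + c * h x) = Tf n f g + c * Tf n f h"
    unfolding Tf_eq[OF assms(1) gh assms(4)] Tf_eq[OF assms(1,2,4)] Tf_eq[OF assms(1,3,4)] logf_lin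
      L2.lin_right[OF m[OF assms(1)] L2_translate(1)[OF m[OF assms(2)]] L2_translate(1)[OF m[OF assms(3)]]]
    by (simp add: algebra_simps)
  show "Tf n (\<lambda>x. g x + c * h x) f = Tf n g f + cnj c * Tf n h f"
    unfolding Tf_eq[OF gh assms(1,4)] Tf_eq[OF assms(2,1,4)] Tf_eq[OF assms(3,1,4)] logf_lin
      L2.lin_left[OF m[OF assms(2)] m[OF assms(3)] L2_translate(1)[OF m[OF assms(1)]]]
    by (simp add: algebra_simps)
qed

lemma Tf_bound:
  assumes f: "f \<in> H" and n: "1 < n"
  shows "cmod (Tf n f f) \<le> 2 * (nm f)\<^sup>2"
proof -
  note m = L2_onD(1)[OF logf_on[OF f]]
  have le: "cmod (L2_inner lborel (logf lam f) (\<lambda>x. logf lam f (x + a))) \<le> (nm f)\<^sup>2" for a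
    using L2.Cauchy_Schwarz[OF m L2_translate(1)[OF m, of a]]
    unfolding L2_translate(2)[OF m] logf_mem(2)[OF f lam] by (simp add: power2_eq_square)
  have p: "real n powr (- 1 / 2) \<le> 1"
    using powr_mono[of "- 1 / 2" 0 "real n"] n by simp
  have "cmod (Tf n f f) = real n powr (- 1 / 2) * cmod (L2_inner lborel (logf lam f) (\<lambda>x. logf lam f (x + ln (real n))) + L2_inner lborel (logf lam f) (\<lambda>x. logf lam f (x + - ln (real n))))"
    unfolding Tf_eq[OF f f n] norm_mult norm_of_real by simp
  also have "\<dots> \<le> 1 * ((nm f)\<^sup>2 + (nm f)\<^sup>2)"
    by (intro mult_mono p order_trans[OF norm_triangle_ineq] add_mono le) auto
  finally show ?thesis by simp
qed

definition weil_range :: "nat set" where "weil_range = {n. 1 < n \<and> real n \<le> lam\<^sup>2}"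

text \<open>\<open>QW\<close> involves only real parts on the diagonal. Both terms are symmetrised
  so that hermitian symmetry is built in and the diagonal still has the required real part: the pole
  term becomes two mirrored products, and \<open>Tf\<close> is averaged with its adjoint.\<close>

definition bounded_part :: "(real \<Rightarrow> complex) \<Rightarrow> (real \<Rightarrow> complex) \<Rightarrow> complex" where
  "bounded_part f g = cnj (four f (- \<i> / 2)) * four g (\<i> / 2) + cnj (four f (\<i> / 2)) * four g (- \<i> / 2)
    - (\<Sum>n\<in>weil_range. complex_of_real (mangoldt n) * ((Tf n f g + cnj (Tf n g f)) / 2))"

lemma sesquilinear_bounded_part: "sesquilinear H bounded_part"
proof
  show "(\<lambda>_. 0) \<in> H" by (rule L2.zero_mem)
  show "\<And>f g c. f \<in> H \<Longrightarrow> g \<in> H \<Longrightarrow> (\<lambda>x. f x + c * g x) \<in> H" by (rule L2.lin_mem)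
  show "bounded_part f (\<lambda>x. g x + c * h x) = bounded_part f g + c * bounded_part f h"
    if "f \<in> H" "g \<in> H" "h \<in> H" for f g h c
  proof -
    have "(\<Sum>n\<in>weil_range. complex_of_real (mangoldt n) * ((Tf n f (\<lambda>x. g x + c * h x) + cnj (Tf n (\<lambda>x. g x + c * h x) f)) / 2))
      = (\<Sum>n\<in>weil_range. complex_of_real (mangoldt n) * ((Tf n f g + cnj (Tf n g f)) / 2)
          + c * (complex_of_real (mangoldt n) * ((Tf n f h + cnj (Tf n h f)) / 2)))"
      by (intro sum.cong) (auto simp: weil_range_def Tf_lin[OF that] field_simps)
    then show ?thesis
      using that by (simp add: bounded_part_def four_lin sum.distrib sum_distrib_left algebra_simps)
  qed
  show "bounded_part g f = cnj (bounded_part f g)" if "f \<in> H" "g \<in> H" for f g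
    by (simp add: bounded_part_def algebra_simps del: of_real_mangoldt)
qed

lemma bounded_part_diag:
  "Re (bounded_part f f) = 2 * Re (four f (\<i> / 2) * cnj (four f (- \<i> / 2))) - (\<Sum>n\<in>weil_range. mangoldt n * Re (Tf n f f))"
  by (simp add: bounded_part_def algebra_simps)

lemma bounded_part_bound: "\<exists>C\<ge>0. \<forall>f\<in>H. \<bar>Re (bounded_part f f)\<bar> \<le> C * (nm f)\<^sup>2"
proof -
  \<comment> \<open>At \<open>\<i> / 2\<close> and \<open>- \<i> / 2\<close> the exponential factor
    in \<open>four_bound\<close> is \<open>exp (1 / 2 * L)\<close>, so \<open>E\<close> bounds both
    transforms relative to the norm.\<close>
  define E where "E = exp (1 / 2 * L) * sqrt (2 * L)"
  define C where "C = 2 * (E * E) + (\<Sum>n\<in>weil_range. mangoldt n * 2)"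
  have E: "0 \<le> E" using L_nonneg by (simp add: E_def)
  have "0 \<le> C" unfolding C_def using E by (intro add_nonneg_nonneg sum_nonneg mult_nonneg_nonneg mangoldt_nonneg) auto
  moreover have "\<bar>Re (bounded_part f f)\<bar> \<le> C * (nm f)\<^sup>2" if f: "f \<in> H" for f
  proof -
    have nn: "0 \<le> nm f" by (rule L2.nrm_nonneg[OF f])
    have "cmod (four f (\<i> / 2)) \<le> E * nm f" "cmod (four f (- \<i> / 2)) \<le> E * nm f"
      using four_bound[OF f, of "\<i> / 2"] four_bound[OF f, of "- \<i> / 2"] by (auto simp: E_def mult_ac)
    then have "cmod (four f (\<i> / 2)) * cmod (four f (- \<i> / 2)) \<le> (E * nm f) * (E * nm f)"
      using E nn by (intro mult_mono) auto
    then have 1: "\<bar>Re (four f (\<i> / 2) * cnj (four f (- \<i> / 2)))\<bar> \<le> E * E * (nm f)\<^sup>2"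
      using abs_Re_le_cmod[of "four f (\<i> / 2) * cnj (four f (- \<i> / 2))"]
      by (simp add: norm_mult power2_eq_square mult_ac)
    have "\<bar>\<Sum>n\<in>weil_range. mangoldt n * Re (Tf n f f)\<bar> \<le> (\<Sum>n\<in>weil_range. \<bar>mangoldt n * Re (Tf n f f)\<bar>)"
      by (rule sum_abs)
    also have "\<dots> \<le> (\<Sum>n\<in>weil_range. mangoldt n * (2 * (nm f)\<^sup>2))"
    proof (rule sum_mono)
      fix n assume "n \<in> weil_range"
      then have "\<bar>Re (Tf n f f)\<bar> \<le> 2 * (nm f)\<^sup>2"
        using Tf_bound[OF f, of n] abs_Re_le_cmod[of "Tf n f f"] by (simp add: weil_range_def)
      then show "\<bar>mangoldt n * Re (Tf n f f)\<bar> \<le> mangoldt n * (2 * (nm f)\<^sup>2)"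
        by (simp add: abs_mult mangoldt_nonneg mult_left_mono)
    qed
    also have "\<dots> = (\<Sum>n\<in>weil_range. mangoldt n * 2) * (nm f)\<^sup>2"
      by (simp add: sum_distrib_right mult.assoc)
    finally show ?thesis
      using 1 unfolding bounded_part_diag C_def by (simp add: algebra_simps)
  qed
  ultimately show ?thesis by blast
qed

section \<open>The archimedean term and the form domain\<close>

abbreviation dens :: "(real \<Rightarrow> complex) \<Rightarrow> real \<Rightarrow> real" where
  "dens f t \<equiv> (cmod (four f (complex_of_real t)))\<^sup>2 * arch_weight t"

lemma arch_density_eq: "f \<in> H \<Longrightarrow> arch_density (extend_zero lam f) = dens f"
  by (rule ext) (simp add: arch_density_def arch_weight_def four_def mult_fourier_eq[OF _ lam])

lemma four_real_bound: "f \<in> H \<Longrightarrow> (cmod (four f (complex_of_real t)))\<^sup>2 \<le> 2 * L * (nm f)\<^sup>2"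
proof -
  assume f: "f \<in> H"
  have "(cmod (four f (complex_of_real t)))\<^sup>2 \<le> (sqrt (2 * L) * nm f)\<^sup>2"
    using four_bound[OF f, of "complex_of_real t"] by (intro power_mono) auto
  then show ?thesis using L_nonneg by (simp add: power_mult_distrib)
qed

lemma neg_part_finite:
  assumes f: "f \<in> H"
  shows "(\<integral>\<^sup>+t. ennreal (- dens f t) \<partial>lborel) < \<infinity>"
proof -
  obtain T W where TW: "0 \<le> T" "0 \<le> W" "\<And>t. max 0 (- arch_weight t) \<le> W * indicator {-T..T} t"
    using arch_weight_neg_part by blast
  have "(\<integral>\<^sup>+t. ennreal (- dens f t) \<partial>lborel) \<le> (\<integral>\<^sup>+t. ennreal (2 * L * (nm f)\<^sup>2 * W) * indicator {-T..T} t \<partial>lborel)"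
  proof (rule nn_integral_mono)
    fix t
    have "- dens f t \<le> (cmod (four f (complex_of_real t)))\<^sup>2 * max 0 (- arch_weight t)"
      using mult_left_mono[of "- arch_weight t" "max 0 (- arch_weight t)" "(cmod (four f (complex_of_real t)))\<^sup>2"] by simp
    also have "\<dots> \<le> (2 * L * (nm f)\<^sup>2) * (W * indicator {-T..T} t)"
      using L_nonneg by (intro mult_mono four_real_bound f TW(3)) auto
    finally have "ennreal (- dens f t) \<le> ennreal ((2 * L * (nm f)\<^sup>2) * (W * indicator {-T..T} t))" by (rule ennreal_leI)
    also have "\<dots> = ennreal (2 * L * (nm f)\<^sup>2 * W) * indicator {-T..T} t"
      by (cases "t \<in> {-T..T}") auto
    finally show "ennreal (- dens f t) \<le> ennreal (2 * L * (nm f)\<^sup>2 * W) * indicator {-T..T} t" .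
  qed
  also have "\<dots> = ennreal (2 * L * (nm f)\<^sup>2 * W) * emeasure lborel {-T..T}"
    by (rule nn_integral_cmult_indicator) simp
  also have "\<dots> < \<infinity>" by (simp add: emeasure_lborel_Icc_eq ennreal_mult_less_top)
  finally show ?thesis .
qed

lemma dens_measurable: "f \<in> H \<Longrightarrow> dens f \<in> borel_measurable lborel"
  using four_measurable by measurable

text \<open>The negative part always has a finite integral, so integrability of the density is the
  same as a finite positive part, and the difference in \<open>arch_term\<close> never has the shape
  infinity minus infinity.\<close>

lemma QW_cases:
  assumes f: "f \<in> H"
  shows "integrable lborel (dens f) \<Longrightarrow> QW lam f = ereal ((LINT t|lborel. dens f t) + Re (bounded_part f f))"
    and "\<not> integrable lborel (dens f) \<Longrightarrow> QW lam f = \<infinity>"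
proof -
  have eq: "QW lam f = arch_term (extend_zero lam f) + ereal (Re (bounded_part f f))"
    unfolding QW_def Let_def bounded_part_diag weil_range_def Tf_def four_def mult_fourier_eq[OF f lam] ..
  let ?P = "\<integral>\<^sup>+t. ennreal (dens f t) \<partial>lborel" and ?N = "\<integral>\<^sup>+t. ennreal (- dens f t) \<partial>lborel"
  have at: "arch_term (extend_zero lam f) = enn2ereal ?P - enn2ereal ?N"
    unfolding arch_term_def arch_density_eq[OF f] ..
  have N: "?N < \<infinity>" by (rule neg_part_finite[OF f])
  have iff: "integrable lborel (dens f) \<longleftrightarrow> ?P < \<infinity>"
    unfolding real_integrable_def using dens_measurable[OF f] N by (auto simp: less_top)
  have Ne: "enn2ereal ?N = ereal (enn2real ?N)" using N by (rule enn2ereal_finite)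
  {
    assume i: "integrable lborel (dens f)"
    then have "enn2ereal ?P = ereal (enn2real ?P)" using iff by (intro enn2ereal_finite) simp
    then have "arch_term (extend_zero lam f) = ereal (LINT t|lborel. dens f t)"
      unfolding at Ne real_lebesgue_integral_def[OF i] by simp
    then show "QW lam f = ereal ((LINT t|lborel. dens f t) + Re (bounded_part f f))" unfolding eq by simp
  next
    assume "\<not> integrable lborel (dens f)"
    then have "?P = \<infinity>" using iff by (metis infinity_ennreal_def top.not_eq_extremum)
    then have "arch_term (extend_zero lam f) = \<infinity>" unfolding at Ne by simp
    then show "QW lam f = \<infinity>" unfolding eq by simp
  }
qed

lemma domain_iff: "f \<in> form_domain (dstar_on lam) (QW lam) \<longleftrightarrow> f \<in> H \<and> integrable lborel (dens f)"
  unfolding form_domain_def using QW_cases[of f] by auto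

definition S :: "(real \<Rightarrow> complex) \<Rightarrow> (real \<Rightarrow> complex) \<Rightarrow> complex" where
  "S f g = (LINT t|lborel. cnj (four f (complex_of_real t)) * four g (complex_of_real t) * complex_of_real (arch_weight t)) + bounded_part f g"

abbreviation "Dom \<equiv> form_domain (dstar_on lam) (QW lam)"

lemma cross_integrable:
  assumes f: "f \<in> Dom" and g: "g \<in> Dom"
  shows "integrable lborel (\<lambda>t. cnj (four f (complex_of_real t)) * four g (complex_of_real t) * complex_of_real (arch_weight t))"
proof (rule Bochner_Integration.integrable_bound)
  have fH: "f \<in> H" and gH: "g \<in> H" using f g domain_iff by auto
  note [measurable] = four_measurable[OF fH] four_measurable[OF gH]
  show "integrable lborel (\<lambda>t. \<bar>dens f t\<bar> + \<bar>dens g t\<bar>)"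
    using f g domain_iff by (intro Bochner_Integration.integrable_add integrable_abs) auto
  show "(\<lambda>t. cnj (four f (complex_of_real t)) * four g (complex_of_real t) * complex_of_real (arch_weight t)) \<in> borel_measurable lborel"
    by measurable
  show "AE t in lborel. norm (cnj (four f (complex_of_real t)) * four g (complex_of_real t) * complex_of_real (arch_weight t))
      \<le> norm (\<bar>dens f t\<bar> + \<bar>dens g t\<bar>)"
  proof (rule AE_I2)
    fix t
    let ?a = "cmod (four f (complex_of_real t))" and ?b = "cmod (four g (complex_of_real t))"
    have "?a * ?b \<le> ?a\<^sup>2 + ?b\<^sup>2"
      using sum_squares_bound[of ?a ?b] mult_nonneg_nonneg[OF norm_ge_zero norm_ge_zero, of "four f (complex_of_real t)" "four g (complex_of_real t)"]
      by linarith
    then have "?a * ?b * \<bar>arch_weight t\<bar> \<le> (?a\<^sup>2 + ?b\<^sup>2) * \<bar>arch_weight t\<bar>" by (rule mult_right_mono) simp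
    then show "norm (cnj (four f (complex_of_real t)) * four g (complex_of_real t) * complex_of_real (arch_weight t))
      \<le> norm (\<bar>dens f t\<bar> + \<bar>dens g t\<bar>)"
      by (simp add: norm_mult abs_mult algebra_simps)
  qed
qed

lemma Dom_lin:
  assumes f: "f \<in> Dom" and g: "g \<in> Dom"
  shows "(\<lambda>x. f x + c * g x) \<in> Dom"
proof -
  have fH: "f \<in> H" and gH: "g \<in> H" using f g domain_iff by auto
  have lH: "(\<lambda>x. f x + c * g x) \<in> H" by (rule L2.lin_mem[OF fH gH])
  have "integrable lborel (dens (\<lambda>x. f x + c * g x))"
  proof (rule Bochner_Integration.integrable_bound)
    show "integrable lborel (\<lambda>t. 2 * \<bar>dens f t\<bar> + 2 * (cmod c)\<^sup>2 * \<bar>dens g t\<bar>)"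
      using f g domain_iff by (intro Bochner_Integration.integrable_add integrable_mult_right integrable_abs) auto
    show "dens (\<lambda>x. f x + c * g x) \<in> borel_measurable lborel" by (rule dens_measurable[OF lH])
    show "AE t in lborel. norm (dens (\<lambda>x. f x + c * g x) t) \<le> norm (2 * \<bar>dens f t\<bar> + 2 * (cmod c)\<^sup>2 * \<bar>dens g t\<bar>)"
    proof (rule AE_I2)
      fix t
      show "norm (dens (\<lambda>x. f x + c * g x) t) \<le> norm (2 * \<bar>dens f t\<bar> + 2 * (cmod c)\<^sup>2 * \<bar>dens g t\<bar>)"
        using mult_right_mono[OF cmod_lin_power2_le[of "four f (complex_of_real t)" c "four g (complex_of_real t)"], of "\<bar>arch_weight t\<bar>"]
        unfolding four_lin[OF fH gH] by (simp add: abs_mult algebra_simps)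
    qed
  qed
  then show ?thesis using lH domain_iff by blast
qed

lemma sesquilinear_S: "sesquilinear Dom S"
proof
  interpret BP: sesquilinear H bounded_part by (rule sesquilinear_bounded_part)
  have four0: "four (\<lambda>_. 0) s = 0" for s
    using four_lin[OF L2.zero_mem L2.zero_mem, of "-1" s] by simp
  show "(\<lambda>_. 0) \<in> Dom" unfolding domain_iff four0 by (simp add: L2.zero_mem)
  show "\<And>f g c. f \<in> Dom \<Longrightarrow> g \<in> Dom \<Longrightarrow> (\<lambda>x. f x + c * g x) \<in> Dom" by (rule Dom_lin)
  show "S f (\<lambda>x. g x + c * h x) = S f g + c * S f h" if f: "f \<in> Dom" and g: "g \<in> Dom" and h: "h \<in> Dom" for f g h c
  proof -
    have H: "f \<in> H" "g \<in> H" "h \<in> H" using that domain_iff by auto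
    let ?X = "\<lambda>f g t. cnj (four f (complex_of_real t)) * four g (complex_of_real t) * complex_of_real (arch_weight t)"
    have "?X f (\<lambda>x. g x + c * h x) = (\<lambda>t. ?X f g t + c * ?X f h t)"
      unfolding four_lin[OF H(2,3)] by (simp add: algebra_simps)
    then show ?thesis
      unfolding S_def BP.lin_right[OF H] using cross_integrable[OF f g] cross_integrable[OF f h]
      by (simp add: algebra_simps)
  qed
  show "S g f = cnj (S f g)" if "f \<in> Dom" "g \<in> Dom" for f g
  proof -
    have H: "f \<in> H" "g \<in> H" using that domain_iff by auto
    show ?thesis
      unfolding S_def complex_cnj_add Bochner_Integration.integral_cnj[symmetric] BP.hermitian[OF H]
      by (simp add: mult_ac)
  qed
qed

lemma S_diag: "Re (S f f) = (LINT t|lborel. dens f t) + Re (bounded_part f f)"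
proof -
  have "(\<lambda>t. cnj (four f (complex_of_real t)) * four f (complex_of_real t) * complex_of_real (arch_weight t)) = (\<lambda>t. complex_of_real (dens f t))"
    by (simp only: cnj_mult_self of_real_mult)
  then show ?thesis unfolding S_def by (simp only: integral_complex_of_real plus_complex.sel Re_complex_of_real)
qed

lemma QW_eq: "f \<in> Dom \<Longrightarrow> QW lam f = ereal (Re (S f f))"
  unfolding S_diag using QW_cases(1) domain_iff by blast

section \<open>Compact embedding of the form domain\<close>

lemma four_lipschitz:
  "f \<in> H \<Longrightarrow> cmod (four f (complex_of_real s) - four f (complex_of_real t)) \<le> \<bar>s - t\<bar> * (L * (sqrt (2 * L) * nm f))"
  unfolding four_def using ft_lipschitz[OF logf_on L_nonneg] logf_mem(2)[OF _ lam] by simp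

lemma Plancherel_four:
  assumes f: "f \<in> H" and "integrable lborel (\<lambda>t. (cmod (four f (complex_of_real t)))\<^sup>2)"
  shows "2 * pi * (nm f)\<^sup>2 \<le> (LINT t|lborel. (cmod (four f (complex_of_real t)))\<^sup>2)"
  using Plancherel_le[OF logf_on[OF f] L_nonneg] assms(2) unfolding four_def logf_mem(2)[OF f lam] by simp

text \<open>The argument of Arzela and Ascoli: the uniform bound and a diagonal choice give
  convergence at all rational frequencies, and the common Lipschitz constant carries it to every
  real frequency.\<close>

lemma four_convergent_subsequence:
  assumes F: "\<And>n. F n \<in> H" and bd: "\<And>n. nm (F n) \<le> K"
  obtains r :: "nat \<Rightarrow> nat" and \<phi> where "strict_mono r" "\<And>t. (\<lambda>n. four (F (r n)) (complex_of_real t)) \<longlonglongrightarrow> \<phi> t"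
proof -
  have K: "0 \<le> K" using L2.nrm_nonneg[OF F[of 0]] bd[of 0] by linarith
  define C where "C = L * (sqrt (2 * L) * K)"
  have C: "0 \<le> C" using L_nonneg K by (simp add: C_def)
  have b: "cmod (four (F n) (complex_of_real t)) \<le> sqrt (2 * L) * K" for n t
    using four_bound[OF F, of n "complex_of_real t"] mult_left_mono[OF bd[of n], of "sqrt (2 * L)"] L_nonneg by simp
  have lip: "cmod (four (F n) (complex_of_real s) - four (F n) (complex_of_real t)) \<le> \<bar>s - t\<bar> * C" for n s t
  proof -
    have "L * (sqrt (2 * L) * nm (F n)) \<le> C"
      unfolding C_def using L_nonneg bd by (intro mult_left_mono) auto
    then show ?thesis using four_lipschitz[OF F, of n s t] mult_left_mono[of "L * (sqrt (2 * L) * nm (F n))" C "\<bar>s - t\<bar>"] by simp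
  qed
  obtain r :: "nat \<Rightarrow> nat" where r: "strict_mono r" and conv: "\<And>t. t \<in> \<rat> \<Longrightarrow> \<exists>l. (\<lambda>n. four (F (r n)) (complex_of_real t)) \<longlonglongrightarrow> l"
    using function_convergent_subsequence[where f = "\<lambda>n t. four (F n) (complex_of_real t)" and S = \<rat>, OF countable_rat b] by blast
  have "convergent (\<lambda>n. four (F (r n)) (complex_of_real t))" for t
  proof (rule Cauchy_convergent, rule metric_CauchyI)
    fix e :: real assume e: "0 < e"
    \<comment> \<open>A rational within \<open>d\<close> of \<open>t\<close> changes each transform
      by at most \<open>e / 3\<close>; the \<open>+ 1\<close> avoids a zero denominator.\<close>
    define d where "d = e / (3 * (C + 1))"
    have d: "0 < d" "d * C \<le> e / 3" using e C by (auto simp: d_def field_simps)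
    obtain q where q: "q \<in> \<rat>" "t < q" "q < t + d" using Rats_dense_in_real[of t "t + d"] d(1) by auto
    have tq: "\<bar>t - q\<bar> * C \<le> e / 3"
      using mult_right_mono[of "\<bar>t - q\<bar>" d C] q C d(2) by linarith
    have "Cauchy (\<lambda>n. four (F (r n)) (complex_of_real q))"
      using conv[OF q(1)] convergent_Cauchy convergent_def by blast
    then obtain N where N: "\<And>m n. m \<ge> N \<Longrightarrow> n \<ge> N \<Longrightarrow> dist (four (F (r m)) (complex_of_real q)) (four (F (r n)) (complex_of_real q)) < e / 3"
      using metric_CauchyD[of _ "e / 3"] e by (metis divide_pos_pos zero_less_numeral)
    have "dist (four (F (r m)) (complex_of_real t)) (four (F (r n)) (complex_of_real t)) < e" if "m \<ge> N" "n \<ge> N" for m n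
    proof -
      have "dist (four (F (r m)) (complex_of_real t)) (four (F (r m)) (complex_of_real q)) \<le> e / 3"
        "dist (four (F (r n)) (complex_of_real t)) (four (F (r n)) (complex_of_real q)) \<le> e / 3"
        using lip[of "r m" t q] lip[of "r n" t q] tq by (auto simp: dist_norm)
      then show ?thesis
        using N[OF that] dist_triangle[of "four (F (r m)) (complex_of_real t)" "four (F (r n)) (complex_of_real t)" "four (F (r m)) (complex_of_real q)"]
          dist_triangle[of "four (F (r m)) (complex_of_real q)" "four (F (r n)) (complex_of_real t)" "four (F (r n)) (complex_of_real q)"]
          dist_commute[of "four (F (r n)) (complex_of_real t)" "four (F (r n)) (complex_of_real q)"]
        by argo
    qed
    then show "\<exists>N. \<forall>m\<ge>N. \<forall>n\<ge>N. dist (four (F (r m)) (complex_of_real t)) (four (F (r n)) (complex_of_real t)) < e" by blast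
  qed
  then have "(\<lambda>n. four (F (r n)) (complex_of_real t)) \<longlonglongrightarrow> lim (\<lambda>n. four (F (r n)) (complex_of_real t))" for t
    by (simp add: convergent_LIMSEQ_iff)
  then show ?thesis by (rule that[OF r])
qed

text \<open>The positive part of the weight is the weight plus its negative part. The latter costs
  at most \<open>2 * L * W * (2 * T)\<close> times the squared norm, namely the bound on the
  transform and on the weight integrated over [-T, T], and the bounded part of the form costs
  another multiple.\<close>

lemma positive_part_bound:
  obtains C where "0 \<le> C" "\<And>f. f \<in> Dom \<Longrightarrow> integrable lborel (\<lambda>t. (cmod (four f (complex_of_real t)))\<^sup>2 * max 0 (arch_weight t))"
    "\<And>f. f \<in> Dom \<Longrightarrow> (LINT t|lborel. (cmod (four f (complex_of_real t)))\<^sup>2 * max 0 (arch_weight t)) \<le> Re (S f f) + C * (nm f)\<^sup>2"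
proof -
  obtain T W where TW: "0 \<le> T" "0 \<le> W" "\<And>t. max 0 (- arch_weight t) \<le> W * indicator {-T..T} t"
    using arch_weight_neg_part by blast
  obtain C where C: "0 \<le> C" "\<And>f. f \<in> H \<Longrightarrow> \<bar>Re (bounded_part f f)\<bar> \<le> C * (nm f)\<^sup>2"
    using bounded_part_bound by blast
  let ?p = "\<lambda>f t. (cmod (four f (complex_of_real t)))\<^sup>2"
  have neg: "?p f t * max 0 (- arch_weight t) \<le> (2 * L * (nm f)\<^sup>2) * (W * indicator {-T..T} t)" if "f \<in> H" for f t
    using L_nonneg by (intro mult_mono four_real_bound that TW(3)) auto
  have ii: "integrable lborel (\<lambda>t. (2 * L * (nm f)\<^sup>2) * (W * indicator {-T..T} t))" for f
    by (intro integrable_mult_right integrable_indicator_Icc)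
  have in_: "integrable lborel (\<lambda>t. ?p f t * max 0 (- arch_weight t))" if f: "f \<in> H" for f
  proof (rule Bochner_Integration.integrable_bound[OF ii])
    note [measurable] = four_measurable[OF f]
    show "(\<lambda>t. ?p f t * max 0 (- arch_weight t)) \<in> borel_measurable lborel" by measurable
    show "AE t in lborel. norm (?p f t * max 0 (- arch_weight t)) \<le> norm ((2 * L * (nm f)\<^sup>2) * (W * indicator {-T..T} t))"
    proof (rule AE_I2)
      fix t
      have "0 \<le> ?p f t * max 0 (- arch_weight t)" by simp
      then show "norm (?p f t * max 0 (- arch_weight t)) \<le> norm ((2 * L * (nm f)\<^sup>2) * (W * indicator {-T..T} t))"
        using neg[OF f, of t] unfolding real_norm_def by linarith
    qed
  qed
  have split: "(\<lambda>t. ?p f t * max 0 (arch_weight t)) = (\<lambda>t. dens f t + ?p f t * max 0 (- arch_weight t))" for f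
    by (rule ext) (simp add: max_def)
  have int: "integrable lborel (\<lambda>t. ?p f t * max 0 (arch_weight t))" if "f \<in> Dom" for f
    unfolding split using that domain_iff in_ by (intro Bochner_Integration.integrable_add) auto
  have "(LINT t|lborel. ?p f t * max 0 (arch_weight t)) \<le> Re (S f f) + (C + 2 * L * W * (2 * T)) * (nm f)\<^sup>2" if f: "f \<in> Dom" for f
  proof -
    have fH: "f \<in> H" using f domain_iff by blast
    have "(LINT t|lborel. ?p f t * max 0 (- arch_weight t)) \<le> (LINT t|lborel. (2 * L * (nm f)\<^sup>2) * (W * indicator {-T..T} t))"
      using in_[OF fH] ii neg[OF fH] by (intro integral_mono) auto
    also have "\<dots> = (2 * L * (nm f)\<^sup>2) * (W * (2 * T))" using TW(1) by simp
    finally have 1: "(LINT t|lborel. ?p f t * max 0 (- arch_weight t)) \<le> (2 * L * (nm f)\<^sup>2) * (W * (2 * T))" .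
    have "(LINT t|lborel. ?p f t * max 0 (arch_weight t)) = (LINT t|lborel. dens f t) + (LINT t|lborel. ?p f t * max 0 (- arch_weight t))"
      unfolding split using f domain_iff in_[OF fH] by (intro Bochner_Integration.integral_add) auto
    also have "\<dots> = Re (S f f) - Re (bounded_part f f) + (LINT t|lborel. ?p f t * max 0 (- arch_weight t))"
      by (simp add: S_diag)
    also have "\<dots> \<le> Re (S f f) + C * (nm f)\<^sup>2 + (2 * L * (nm f)\<^sup>2) * (W * (2 * T))"
      using 1 C(2)[OF fH] by linarith
    finally show ?thesis by (simp add: algebra_simps)
  qed
  moreover have "0 \<le> C + 2 * L * W * (2 * T)" using C(1) TW L_nonneg by simp
  ultimately show ?thesis using that int by blast
qed

lemma form_compact:
  fixes F :: "nat \<Rightarrow> real \<Rightarrow> complex"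
  assumes F: "\<And>n. F n \<in> Dom" and SF: "\<And>n. Re (S (F n) (F n)) \<le> K" and bd: "\<And>n. nm (F n) \<le> K"
  shows "\<exists>r::nat \<Rightarrow> nat. strict_mono r \<and> L2.cauchy (dstar_on lam) (F \<circ> r)"
proof -
  have FH: "F n \<in> H" for n using F domain_iff by blast
  have K: "0 \<le> K" using L2.nrm_nonneg[OF FH[of 0]] bd[of 0] by linarith
  obtain C where C: "0 \<le> C" and ip: "\<And>f. f \<in> Dom \<Longrightarrow> integrable lborel (\<lambda>t. (cmod (four f (complex_of_real t)))\<^sup>2 * max 0 (arch_weight t))"
    and le: "\<And>f. f \<in> Dom \<Longrightarrow> (LINT t|lborel. (cmod (four f (complex_of_real t)))\<^sup>2 * max 0 (arch_weight t)) \<le> Re (S f f) + C * (nm f)\<^sup>2"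
    using positive_part_bound by blast
  obtain r :: "nat \<Rightarrow> nat" and \<phi> where r: "strict_mono r" and lim: "\<And>t. (\<lambda>n. four (F (r n)) (complex_of_real t)) \<longlonglongrightarrow> \<phi> t"
    using four_convergent_subsequence[where F = F, OF FH bd] by blast
  define p where "p n t = four (F (r n)) (complex_of_real t)" for n t
  have pm[measurable]: "p n \<in> borel_measurable borel" for n
    unfolding p_def[abs_def] by (rule four_measurable[OF FH])
  \<comment> \<open>\<open>\<phi>\<close> is a mere pointwise limit and is never identified as a
    transform; it only mediates between \<open>p m\<close> and \<open>p n\<close> on bounded
    intervals.\<close>
  have \<phi>m[measurable]: "\<phi> \<in> borel_measurable borel"
    by (rule borel_measurable_LIMSEQ_metric[where f = p]) (auto simp: pm p_def lim)
  define K1 where "K1 = K + C * K\<^sup>2"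
  have K1: "0 \<le> K1" using K C by (simp add: K1_def)
  have pp: "integrable lborel (\<lambda>t. (cmod (p n t))\<^sup>2 * max 0 (arch_weight t))"
    "(LINT t|lborel. (cmod (p n t))\<^sup>2 * max 0 (arch_weight t)) \<le> K1" for n
  proof -
    show "integrable lborel (\<lambda>t. (cmod (p n t))\<^sup>2 * max 0 (arch_weight t))" unfolding p_def by (rule ip[OF F])
    have "(nm (F (r n)))\<^sup>2 \<le> K\<^sup>2" using bd L2.nrm_nonneg[OF FH] by (intro power_mono) auto
    then have "C * (nm (F (r n)))\<^sup>2 \<le> C * K\<^sup>2" using C by (rule mult_left_mono)
    then show "(LINT t|lborel. (cmod (p n t))\<^sup>2 * max 0 (arch_weight t)) \<le> K1"
      unfolding p_def K1_def using le[OF F, of "r n"] SF[of "r n"] by linarith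
  qed
  define B where "B = 2 * L * K\<^sup>2"
  have pB: "(cmod (p n t))\<^sup>2 \<le> B" for n t
  proof -
    have "(nm (F (r n)))\<^sup>2 \<le> K\<^sup>2" using bd L2.nrm_nonneg[OF FH] by (intro power_mono) auto
    then show ?thesis
      unfolding B_def p_def using four_real_bound[OF FH, of "r n" t] L_nonneg mult_left_mono[of "(nm (F (r n)))\<^sup>2" "K\<^sup>2" "2 * L"]
      by linarith
  qed
  have \<phi>B: "(cmod (\<phi> t))\<^sup>2 \<le> B" for t
  proof (rule LIMSEQ_le_const2)
    show "(\<lambda>n. (cmod (p n t))\<^sup>2) \<longlonglongrightarrow> (cmod (\<phi> t))\<^sup>2" unfolding p_def by (intro tendsto_intros lim)
    show "\<exists>N. \<forall>n\<ge>N. (cmod (p n t))\<^sup>2 \<le> B" using pB by blast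
  qed
  have sq2: "(cmod (a - b))\<^sup>2 \<le> 2 * (cmod a)\<^sup>2 + 2 * (cmod b)\<^sup>2" for a b :: complex
    using cmod_lin_power2_le[of a "-1" b] by simp
  define a where "a T n = (LINT t|lborel. (cmod (p n t - \<phi> t))\<^sup>2 * indicator {-T..T} t)" for T n
  have dom: "norm ((cmod (p n t - \<phi> t))\<^sup>2 * indicator {-T..T} t) \<le> 4 * B * indicator {-T..T} t" for n t T
    using sq2[of "p n t" "\<phi> t"] pB[of n t] \<phi>B[of t] by (cases "t \<in> {-T..T}") auto
  have dom_i: "integrable lborel (\<lambda>t. 4 * B * indicator {-T..T} t)" for T :: real
    by (intro integrable_mult_right integrable_indicator_Icc)
  have ai: "integrable lborel (\<lambda>t. (cmod (p n t - \<phi> t))\<^sup>2 * indicator {-T..T} t)" for T n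
  proof (rule Bochner_Integration.integrable_bound[OF dom_i[of T]])
    show "AE t in lborel. norm ((cmod (p n t - \<phi> t))\<^sup>2 * indicator {-T..T} t) \<le> norm (4 * B * indicator {-T..T} t)"
      unfolding real_norm_def[of "4 * B * _"] by (intro AE_I2 order_trans[OF dom abs_ge_self])
  qed measurable
  have a0: "a T \<longlonglongrightarrow> 0" for T
  proof -
    have "(\<lambda>n. LINT t|lborel. (cmod (p n t - \<phi> t))\<^sup>2 * indicator {-T..T} t) \<longlonglongrightarrow> integral\<^sup>L lborel (\<lambda>x::real. 0::real)"
    proof (rule Bochner_Integration.integral_dominated_convergence[where w = "\<lambda>t. 4 * B * indicator {-T..T} t"])
      show "integrable lborel (\<lambda>t. 4 * B * indicator {-T..T} t)" by (rule dom_i)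
      show "AE t in lborel. (\<lambda>n. (cmod (p n t - \<phi> t))\<^sup>2 * indicator {-T..T} t) \<longlonglongrightarrow> 0"
      proof (rule AE_I2)
        fix t
        have "(\<lambda>n. (cmod (p n t - \<phi> t))\<^sup>2 * indicator {-T..T} t) \<longlonglongrightarrow> (cmod (\<phi> t - \<phi> t))\<^sup>2 * indicator {-T..T} t"
          unfolding p_def by (intro tendsto_intros lim)
        then show "(\<lambda>n. (cmod (p n t - \<phi> t))\<^sup>2 * indicator {-T..T} t) \<longlonglongrightarrow> 0" by simp
      qed
      show "AE t in lborel. norm ((cmod (p n t - \<phi> t))\<^sup>2 * indicator {-T..T} t) \<le> 4 * B * indicator {-T..T} t" for n
        using dom by simp
    qed measurable
    then show ?thesis unfolding a_def[abs_def] by simp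
  qed
  \<comment> \<open>Plancherel for the difference, with its transform split at \<open>T\<close>.
    Inside, both transforms are compared with \<open>\<phi>\<close>; outside, the weight is at least
    \<open>R\<close>, so the mass of each is at most \<open>1 / R\<close> times its weighted
    integral.\<close>
  have key: "2 * pi * (nm (\<lambda>x. F (r m) x - F (r n) x))\<^sup>2 \<le> 2 * a T m + 2 * a T n + 2 / R * (K1 + K1)"
    if R: "R > 0" and T: "\<And>t. T \<le> \<bar>t\<bar> \<Longrightarrow> R \<le> arch_weight t" for R T m n
  proof -
    define d where "d t = (cmod (p m t - p n t))\<^sup>2" for t
    \<comment> \<open>One integrable majorant for both ranges of \<open>t\<close>: the first two
      terms serve on [-T, T], the last one outside. It also shows that the transform of the
      difference is square integrable, as \<open>Plancherel_four\<close> requires.\<close>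
    define u where "u t = 2 * ((cmod (p m t - \<phi> t))\<^sup>2 * indicator {-T..T} t) + 2 * ((cmod (p n t - \<phi> t))\<^sup>2 * indicator {-T..T} t)
      + 2 / R * ((cmod (p m t))\<^sup>2 * max 0 (arch_weight t) + (cmod (p n t))\<^sup>2 * max 0 (arch_weight t))" for t
    have ui: "integrable lborel u"
      unfolding u_def[abs_def] by (intro Bochner_Integration.integrable_add integrable_mult_right ai pp(1))
    have uI: "(LINT t|lborel. u t) = 2 * a T m + 2 * a T n + 2 / R *
       ((LINT t|lborel. (cmod (p m t))\<^sup>2 * max 0 (arch_weight t)) + (LINT t|lborel. (cmod (p n t))\<^sup>2 * max 0 (arch_weight t)))"
      unfolding u_def a_def using ai pp(1) by simp
    have du: "d t \<le> u t" for t
    proof (cases "t \<in> {-T..T}")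
      case True
      have "d t \<le> 2 * (cmod (p m t - \<phi> t))\<^sup>2 + 2 * (cmod (p n t - \<phi> t))\<^sup>2"
        using sq2[of "p m t - \<phi> t" "p n t - \<phi> t"] by (simp add: d_def)
      moreover have "0 \<le> 2 / R * ((cmod (p m t))\<^sup>2 * max 0 (arch_weight t) + (cmod (p n t))\<^sup>2 * max 0 (arch_weight t))"
        using R by simp
      ultimately show ?thesis unfolding u_def using True by simp
    next
      case False
      then have "T \<le> \<bar>t\<bar>" by auto
      then have w: "R \<le> max 0 (arch_weight t)" using T[of t] by simp
      have ge: "y \<le> 1 / R * (y * max 0 (arch_weight t))" if "0 \<le> y" for y
        using mult_left_mono[OF w that] R by (simp add: field_simps)
      have "d t \<le> 2 * (cmod (p m t))\<^sup>2 + 2 * (cmod (p n t))\<^sup>2" unfolding d_def by (rule sq2)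
      also have "\<dots> \<le> 2 * (1 / R * ((cmod (p m t))\<^sup>2 * max 0 (arch_weight t))) + 2 * (1 / R * ((cmod (p n t))\<^sup>2 * max 0 (arch_weight t)))"
        by (intro add_mono mult_left_mono ge) auto
      also have "\<dots> = 2 / R * ((cmod (p m t))\<^sup>2 * max 0 (arch_weight t) + (cmod (p n t))\<^sup>2 * max 0 (arch_weight t))"
        using R by (simp add: field_simps)
      finally show ?thesis unfolding u_def using False by simp
    qed
    have di: "integrable lborel d"
    proof (rule Bochner_Integration.integrable_bound[OF ui])
      show "d \<in> borel_measurable lborel" unfolding d_def[abs_def] by measurable
      show "AE t in lborel. norm (d t) \<le> norm (u t)"
      proof (rule AE_I2)
        fix t
        have "0 \<le> d t" by (simp add: d_def)
        then show "norm (d t) \<le> norm (u t)" using du[of t] by simp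
      qed
    qed
    have d_eq: "(\<lambda>t. (cmod (four (\<lambda>x. F (r m) x - F (r n) x) (complex_of_real t)))\<^sup>2) = d"
      using four_lin[OF FH FH, of "r m" "-1" "r n"] by (simp add: d_def p_def fun_eq_iff)
    have "2 * pi * (nm (\<lambda>x. F (r m) x - F (r n) x))\<^sup>2 \<le> (LINT t|lborel. d t)"
      using Plancherel_four[OF L2.diff_mem[OF FH FH], of "r m" "r n"] di unfolding d_eq by blast
    also have "\<dots> \<le> (LINT t|lborel. u t)" using di ui du by (intro integral_mono) auto
    also have "\<dots> \<le> 2 * a T m + 2 * a T n + 2 / R * (K1 + K1)"
      unfolding uI using R by (intro add_left_mono mult_left_mono add_mono pp(2)) auto
    finally show ?thesis .
  qed
  have "L2.cauchy (dstar_on lam) (F \<circ> r)"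
    unfolding L2.cauchy_def
  proof safe
    fix e :: real assume e: "e > 0"
    \<comment> \<open>Chosen so that the high frequencies contribute at most
      \<open>e\<^sup>2\<close>; the \<open>+ 1\<close> keeps \<open>R\<close> positive when
      \<open>K1\<close> is 0.\<close>
    define R where "R = 4 * K1 / e\<^sup>2 + 1"
    have R: "R > 0" using K1 by (simp add: R_def add_nonneg_pos)
    have R2: "2 / R * (K1 + K1) \<le> e\<^sup>2"
    proof -
      have "4 * K1 \<le> e\<^sup>2 * R" using e by (simp add: R_def field_simps)
      then show ?thesis using R by (simp add: field_simps)
    qed
    obtain T where T: "\<And>t. T \<le> \<bar>t\<bar> \<Longrightarrow> R \<le> arch_weight t" using arch_weight_unbounded[of R] by blast
    have "\<forall>\<^sub>F n in sequentially. a T n < e\<^sup>2" using a0[of T] e by (intro order_tendstoD(2)[where y = 0]) auto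
    then obtain N where N: "\<And>n. n \<ge> N \<Longrightarrow> a T n < e\<^sup>2" by (auto simp: eventually_sequentially)
    have "nm (\<lambda>x. (F \<circ> r) m x - (F \<circ> r) n x) < e" if "m \<ge> N" "n \<ge> N" for m n
    proof -
      let ?d = "nm (\<lambda>x. F (r m) x - F (r n) x)"
      have "2 * pi * ?d\<^sup>2 \<le> 2 * a T m + 2 * a T n + 2 / R * (K1 + K1)"
        by (rule key[OF R]) (rule T)
      then have "2 * pi * ?d\<^sup>2 < 5 * e\<^sup>2"
        using N[OF that(1)] N[OF that(2)] R2 by argo
      \<comment> \<open>The low frequencies give less than \<open>4 * e\<^sup>2\<close> and the high
        ones at most \<open>e\<^sup>2\<close>; as \<open>2 * pi\<close> exceeds 6, a total below
        \<open>5 * e\<^sup>2\<close> suffices.\<close>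
      moreover have "6 * ?d\<^sup>2 \<le> 2 * pi * ?d\<^sup>2" using pi_gt3 by (intro mult_right_mono) auto
      ultimately have "?d\<^sup>2 < e\<^sup>2" using zero_le_power2[of e] by linarith
      then show ?thesis using e by (simp add: power2_less_imp_less)
    qed
    then show "\<exists>N. \<forall>m\<ge>N. \<forall>n\<ge>N. nm (\<lambda>x. (F \<circ> r) m x - (F \<circ> r) n x) < e" by blast
  qed
  then show ?thesis using r by blast
qed

end

theorem theorem3p6:
  fixes lam :: real
  assumes "lam > 1"
    and "form_lower_bounded (dstar_on lam) (QW lam)"
    and "form_lsc (dstar_on lam) (QW lam)"
  shows "purely_discrete_spectrum (dstar_on lam) (Weil_operator lam) \<and>
         spectrum_bounded_below (dstar_on lam) (Weil_operator lam)"
proof -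
  interpret W: Weil_form lam by standard (rule assms(1))
  obtain c where c: "\<And>f. f \<in> L2_space (dstar_on lam) \<Longrightarrow> ereal (c * (L2_norm (dstar_on lam) f)\<^sup>2) \<le> QW lam f"
    using assms(2) unfolding form_lower_bounded_def by blast
  interpret closed_form "dstar_on lam" "QW lam" W.S c
    \<comment> \<open>The two assumed properties of \<open>QW\<close> enter here, as the constant
      \<open>c\<close> and as lower semicontinuity; the other clauses come from the analysis in
      \<open>Weil_form\<close>.\<close>
    by (rule closed_form.intro[OF c assms(3) W.sesquilinear_S W.QW_eq W.form_compact])
  show ?thesis unfolding Weil_operator_def by (rule discrete_spectrum)
qed

end
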